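(* Let $n\ge2$. For the systems $$\dot x=y,\qquad \dot y=-x(x^2-1)^2-\varepsilon_a\sum_{i=0}^na_ix^{2i}y-\varepsilon_b\sum_{i=0}^nb_ix^{2i+1}y,$$ with $0<\varepsilon_b^2\ll\varepsilon_a\ll\varepsilon_b\ll1$, $a_n\ne0$, consider the maximal lips hierarchy $0<|\Lambda_0^+(a)|\ll|\Lambda_1^+(a)|\ll\cdots\ll|\Lambda_n^+(a)|$ (part of the definition of $\mathbb P_3$) and the maximal origin hierarchy $0<|C_0^0|\ll|C_2^0|\ll\cdots\ll|C_{2n}^0|\ll1$ (part of the definition of $\mathcal C_{\rm org}$), with $\ll$ interpreted in the usual asymptotic sense. Then these two hierarchies cannot be realized simultaneously with arbitrarily strong dominance; equivalently, there is no sequence of parameters, normalized by $|a|=1$, satisfying the conditions defining $\mathbb P_3$ and $\mathcal C_{\rm org}$, along which both sets of successive dominance ratios $|\Lambda_j^+|/|\Lambda_{j+1}^+|$ and $|C_{2j}^0|/|C_{2j+2}^0|$, $j=0,\dots,n-1$, tend to zero.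
   Context: $a=(a_0,\dots,a_n)$, $b=(b_0,\dots,b_n)\in\mathbb R^{n+1}$. $A\ll B$ along a sequence of parameters means $A/B\to0$. Origin. Let $\omega=x^2$, $u=\operatorname{sgn}(x)\sqrt{((x^2-1)^3+1)/3}$, $d\tau=\frac{x(x^2-1)^2}{u}dt$. With $u=r\cos\theta$, $y=r\sin\theta$ the system near the origin becomes $\frac{dr}{d\theta}=\frac{r^2\sin^2\theta\,Q}{1+r\sin\theta\cos\theta\,Q}$, where $Q=\big(\varepsilon_a|\cos\theta|\sum a_i\omega^{i-1/2}+\varepsilon_b\cos\theta\sum b_i\omega^i\big)/(\omega-1)^2$, $r^2\cos^2\theta=\frac{(\omega-1)^3+1}{3}$, on the branch $\omega\to0$ as $r\to0$. Its first return map ($\theta$ from $0$ to $2\pi$) is $P_0$, with $P_0(r)-r=\sum_{i\ge0}C^0_ir^{i+1}$. Put $\delta=\max_i\{|\varepsilon_aa_i|,|\varepsilon_bb_i|\}$. The selected coefficients have first-order parts: $C^0_{2j}=\varepsilon_a(\gamma_ja_j+\mathcal L_j(a_0,\dots,a_{j-1}))+O(\delta^2)$, $\gamma_j\ne0$, $\mathcal L_j$ linear, $0\le j\le n$. $\mathcal C_{\rm org}$ is the set of $(a,b,\varepsilon_a,\varepsilon_b)$ with $0<|C^0_0|\ll|C^0_2|\ll\cdots\ll|C^0_{2n}|\ll1$; $C^0_0C^0_2>0$; $C^0_{2j}C^0_{2j+2}<0$ for $j=1,\dots,n-1$; and the terms $C^0_{2j+1}=O(\delta^2)$ dominated by (negligible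 relative to) the selected even terms. Lips. Let $H(x,y)=\frac{y^2}{2}+\frac{3x^2-3x^4+x^6}{6}$, $h_0=\frac16$, $\tau_+=h_0-h>0$; let $L_h^+$ ($h<h_0$) be the periodic orbits in $\{H=h\}$ inside and near the two-cuspidal loop $\{H=\frac16\}$, oriented by the Hamiltonian flow, and $M^+(h)=\oint_{L_h^+}\sum_{i=0}^na_ix^{2i}y\,dx$. Near the loop, $$M^+(h)=\sum_{j\ge0}C_j^+\tau_+^j+\sum_{j\ge0}D_j^+\tau_+^{j+5/6}+\sum_{j\ge0}E_j^+\tau_+^{j+7/6}.$$ Put $\Lambda_0^+=C_0^+$ and $\Lambda_{3j+1}^+=D_j^+$, $\Lambda_{3j+2}^+=C_{j+1}^+$, $\Lambda_{3j+3}^+=E_j^+$ for $j\ge0$ (linear functions of $a$). $\mathbb P_3$ is the set of $(a,b,\varepsilon_a,\varepsilon_b)$ with $0<\varepsilon_b^2\ll\varepsilon_a\ll\varepsilon_b\ll1$, $\Lambda_j^+(a)\Lambda_{j+1}^+(a)<0$ for $j=0,\dots,n-1$ and $0<|\Lambda_0^+(a)|\ll\cdots\ll|\Lambda_n^+(a)|$.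
   Formalization: The formal theorem additionally assumes that δ = max{|ε_a a_i|, |ε_b b_i|} stays bounded along the sequence (automatic for bounded b); with ε_b b unbounded, the b-terms can create the origin hierarchy and the claim as stated fails. *)

theory Defs
  imports "HOL-Analysis.Analysis"
begin

text \<open>
  A coefficient vector in $R^{n+1}$ is a function \<open>nat \<Rightarrow> real\<close> of which only the values at
  indices \<open>\<le> n\<close> are used. A sequence of vectors is \<open>nat \<Rightarrow> nat \<Rightarrow> real\<close>, the first argument
  being the position in the sequence.
\<close>

definition much_less :: "(nat \<Rightarrow> real) \<Rightarrow> (nat \<Rightarrow> real) \<Rightarrow> bool"  (infix "\<lless>" 50) where
  "A \<lless> B \<longleftrightarrow> (\<lambda>m. A m / B m) \<longlonglongrightarrow> 0"


subsection \<open>The origin\<close>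

text \<open>
  \<open>omega r \<theta>\<close> solves $r^2\cos^2\theta = ((\omega-1)^3+1)/3$. With the real cube root (\<open>root 3\<close> is odd)
  this solution is unique, and it is the branch with $\omega \to 0$ as $r \to 0$.
\<close>

definition omega :: "real \<Rightarrow> real \<Rightarrow> real" where
  "omega r \<theta> = 1 + root 3 (3 * (r * cos \<theta>)\<^sup>2 - 1)"

lemma omega_iff: "omega r \<theta> = w \<longleftrightarrow> r\<^sup>2 * (cos \<theta>)\<^sup>2 = ((w - 1) ^ 3 + 1) / 3"
proof -
  have "omega r \<theta> = w \<longleftrightarrow> root 3 (3 * (r * cos \<theta>)\<^sup>2 - 1) = w - 1"
    by (auto simp: omega_def)
  also have "\<dots> \<longleftrightarrow> 3 * (r * cos \<theta>)\<^sup>2 - 1 = (w - 1) ^ 3"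
    using odd_real_root_pow[of 3 "3 * (r * cos \<theta>)\<^sup>2 - 1"] odd_real_root_power_cancel[of 3 "w - 1"]
    by auto
  finally show ?thesis
    by (auto simp: power_mult_distrib)
qed

definition Q_fun ::
    "nat \<Rightarrow> (nat \<Rightarrow> real) \<Rightarrow> (nat \<Rightarrow> real) \<Rightarrow> real \<Rightarrow> real \<Rightarrow> real \<Rightarrow> real \<Rightarrow> real" where
  "Q_fun n a b \<epsilon>a \<epsilon>b r \<theta> =
     (\<epsilon>a * \<bar>cos \<theta>\<bar> * (\<Sum>i\<le>n. a i * omega r \<theta> powr (real i - 1/2))
      + \<epsilon>b * cos \<theta> * (\<Sum>i\<le>n. b i * omega r \<theta> ^ i)) / (omega r \<theta> - 1)\<^sup>2"

text \<open>
  \<open>polar_solution n a b \<epsilon>a \<epsilon>b \<rho>\<close>: \<open>\<rho>\<close> solves the polar equation on $[0,2\pi]$. Where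
  $\cos\theta = 0$ the term $|\cos\theta|\,\omega^{-1/2}$ of $Q$ has the form $0\cdot\infty$, a
  removable singularity that \<open>powr\<close> does not fill in with the limit; hence the equation is imposed
  at the other angles, together with continuity of \<open>\<rho>\<close>. The bound $3\rho^2 < 1$ keeps the solution
  inside the cuspidal loop, where $0 \le \omega < 1$. This and the positivity of the denominator
  hold for all sufficiently small initial radii and small $\varepsilon_a$, and ensure that no
  division by zero occurs.
\<close>

definition polar_solution ::
    "nat \<Rightarrow> (nat \<Rightarrow> real) \<Rightarrow> (nat \<Rightarrow> real) \<Rightarrow> real \<Rightarrow> real \<Rightarrow> (real \<Rightarrow> real) \<Rightarrow> bool" where
  "polar_solution n a b \<epsilon>a \<epsilon>b \<rho> \<longleftrightarrow>
     continuous_on {0..2*pi} \<rho> \<and>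
     (\<forall>\<theta>\<in>{0..2*pi}. 0 < \<rho> \<theta> \<and> 3 * (\<rho> \<theta>)\<^sup>2 < 1) \<and>
     (\<forall>\<theta>\<in>{0..2*pi}. cos \<theta> \<noteq> 0 \<longrightarrow>
        (let Q = Q_fun n a b \<epsilon>a \<epsilon>b (\<rho> \<theta>) \<theta> in
           1 + \<rho> \<theta> * sin \<theta> * cos \<theta> * Q > 0 \<and>
           (\<rho> has_real_derivative
              (\<rho> \<theta>)\<^sup>2 * (sin \<theta>)\<^sup>2 * Q / (1 + \<rho> \<theta> * sin \<theta> * cos \<theta> * Q)) (at \<theta> within {0..2*pi})))"

text \<open>\<open>first_return n a b \<epsilon>a \<epsilon>b r s\<close>: the first return map $P_0$ takes the value \<open>s\<close> at \<open>r\<close>.\<close>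

definition first_return ::
    "nat \<Rightarrow> (nat \<Rightarrow> real) \<Rightarrow> (nat \<Rightarrow> real) \<Rightarrow> real \<Rightarrow> real \<Rightarrow> real \<Rightarrow> real \<Rightarrow> bool" where
  "first_return n a b \<epsilon>a \<epsilon>b r s \<longleftrightarrow>
     (\<exists>\<rho>. polar_solution n a b \<epsilon>a \<epsilon>b \<rho> \<and> \<rho> 0 = r \<and> \<rho> (2*pi) = s)"

text \<open>\<open>C\<close> is the sequence of coefficients in $P_0(r) - r = \sum_{i\ge0} C_i r^{i+1}$.\<close>

definition origin_coeffs ::
    "nat \<Rightarrow> (nat \<Rightarrow> real) \<Rightarrow> (nat \<Rightarrow> real) \<Rightarrow> real \<Rightarrow> real \<Rightarrow> (nat \<Rightarrow> real) \<Rightarrow> bool" where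
  "origin_coeffs n a b \<epsilon>a \<epsilon>b C \<longleftrightarrow>
     (\<exists>r0>0. \<forall>r\<in>{0<..<r0}. \<exists>s. first_return n a b \<epsilon>a \<epsilon>b r s \<and>
        (\<lambda>i. C i * r ^ (i + 1)) sums (s - r))"

definition delta ::
    "nat \<Rightarrow> (nat \<Rightarrow> real) \<Rightarrow> (nat \<Rightarrow> real) \<Rightarrow> real \<Rightarrow> real \<Rightarrow> real" where
  "delta n a b \<epsilon>a \<epsilon>b = (MAX i\<in>{..n}. max \<bar>\<epsilon>a * a i\<bar> \<bar>\<epsilon>b * b i\<bar>)"

text \<open>
  The conditions defining $\mathcal C_{\rm org}$ along a sequence of parameters. An odd coefficient
  is required to be negligible only relative to the next selected even one. Since the even ones
  increase along the hierarchy, this is weaker than negligibility relative to the preceding one or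
  to all of them.
\<close>

definition in_C_org ::
    "nat \<Rightarrow> (nat \<Rightarrow> nat \<Rightarrow> real) \<Rightarrow> (nat \<Rightarrow> nat \<Rightarrow> real) \<Rightarrow> (nat \<Rightarrow> real) \<Rightarrow> (nat \<Rightarrow> real)
       \<Rightarrow> (nat \<Rightarrow> nat \<Rightarrow> real) \<Rightarrow> bool" where
  "in_C_org n a b \<epsilon>a \<epsilon>b C \<longleftrightarrow>
     (\<forall>m. origin_coeffs n (a m) (b m) (\<epsilon>a m) (\<epsilon>b m) (C m)) \<and>
     (\<forall>m. 0 < \<bar>C m 0\<bar>) \<and>
     (\<forall>j<n. (\<lambda>m. \<bar>C m (2*j)\<bar>) \<lless> (\<lambda>m. \<bar>C m (2*j+2)\<bar>)) \<and>
     (\<lambda>m. \<bar>C m (2*n)\<bar>) \<lless> (\<lambda>m. 1) \<and>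
     (\<forall>m. C m 0 * C m 2 > 0) \<and>
     (\<forall>m. \<forall>j\<in>{1..n-1}. C m (2*j) * C m (2*j+2) < 0) \<and>
     (\<forall>j<n. (\<lambda>m. \<bar>C m (2*j+1)\<bar>) \<lless> (\<lambda>m. \<bar>C m (2*j+2)\<bar>))"


subsection \<open>The lips\<close>

definition H_fun :: "real \<Rightarrow> real \<Rightarrow> real" where
  "H_fun x y = y\<^sup>2 / 2 + (3 * x^2 - 3 * x^4 + x^6) / 6"

text \<open>
  \<open>(x, y)\<close> runs through the periodic orbit $L_h^+$ following the Hamiltonian flow
  $\dot x = H_y$, $\dot y = -H_x = -x(x^2-1)^2$, with minimal period \<open>T\<close>. The region bounded by the
  two-cuspidal loop $\{H = 1/6\}$ is $\{H < 1/6\}$, and for $0 < h < 1/6$ the level set $\{H = h\}$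
  is a single closed orbit.
\<close>

definition lips_orbit :: "real \<Rightarrow> (real \<Rightarrow> real) \<Rightarrow> (real \<Rightarrow> real) \<Rightarrow> real \<Rightarrow> bool" where
  "lips_orbit h x y T \<longleftrightarrow>
     (\<forall>t. (x has_real_derivative y t) (at t)) \<and>
     (\<forall>t. (y has_real_derivative - (x t * ((x t)\<^sup>2 - 1)\<^sup>2)) (at t)) \<and>
     (\<forall>t. H_fun (x t) (y t) = h) \<and>
     T > 0 \<and>
     (\<forall>t. x (t + T) = x t \<and> y (t + T) = y t) \<and>
     (\<forall>t. 0 < t \<and> t < T \<longrightarrow> (x t, y t) \<noteq> (x 0, y 0))"

text \<open>
  \<open>M_plus n a h M\<close>: the line integral $M^+(h)$ has the value \<open>M\<close>; along the orbit $dx = y\,dt$.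
\<close>

definition M_plus :: "nat \<Rightarrow> (nat \<Rightarrow> real) \<Rightarrow> real \<Rightarrow> real \<Rightarrow> bool" where
  "M_plus n a h M \<longleftrightarrow>
     (\<exists>x y T. lips_orbit h x y T \<and>
        ((\<lambda>t. (\<Sum>i\<le>n. a i * x t ^ (2*i)) * y t * y t) has_integral M) {0..T})"

definition lips_expansion ::
    "nat \<Rightarrow> (nat \<Rightarrow> real) \<Rightarrow> (nat \<Rightarrow> real) \<Rightarrow> (nat \<Rightarrow> real) \<Rightarrow> (nat \<Rightarrow> real) \<Rightarrow> bool" where
  "lips_expansion n a C D E \<longleftrightarrow>
     (\<exists>\<tau>0>0. \<forall>\<tau>\<in>{0<..<\<tau>0}. \<exists>c d e.
        (\<lambda>j. C j * \<tau> ^ j) sums c \<and>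
        (\<lambda>j. D j * \<tau> powr (real j + 5/6)) sums d \<and>
        (\<lambda>j. E j * \<tau> powr (real j + 7/6)) sums e \<and>
        M_plus n a (1/6 - \<tau>) (c + d + e))"

definition lips_coeffs :: "nat \<Rightarrow> (nat \<Rightarrow> real) \<Rightarrow> (nat \<Rightarrow> real) \<Rightarrow> bool" where
  "lips_coeffs n a L \<longleftrightarrow>
     (\<exists>C D E. lips_expansion n a C D E \<and> L 0 = C 0 \<and>
        (\<forall>j. L (3*j+1) = D j \<and> L (3*j+2) = C (j+1) \<and> L (3*j+3) = E j))"

text \<open>The conditions defining $\mathbb P_3$ along a sequence of parameters (\<open>b\<close> does not enter).\<close>

definition in_P3 ::
    "nat \<Rightarrow> (nat \<Rightarrow> nat \<Rightarrow> real) \<Rightarrow> (nat \<Rightarrow> real) \<Rightarrow> (nat \<Rightarrow> real) \<Rightarrow> (nat \<Rightarrow> nat \<Rightarrow> real) \<Rightarrow> bool" where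
  "in_P3 n a \<epsilon>a \<epsilon>b L \<longleftrightarrow>
     (\<forall>m. lips_coeffs n (a m) (L m)) \<and>
     (\<forall>m. 0 < \<epsilon>a m \<and> 0 < \<epsilon>b m) \<and>
     (\<lambda>m. (\<epsilon>b m)\<^sup>2) \<lless> \<epsilon>a \<and> \<epsilon>a \<lless> \<epsilon>b \<and> \<epsilon>b \<lless> (\<lambda>m. 1) \<and>
     (\<forall>m. \<forall>j<n. L m j * L m (j+1) < 0) \<and>
     (\<forall>m. 0 < \<bar>L m 0\<bar>) \<and>
     (\<forall>j<n. (\<lambda>m. \<bar>L m j\<bar>) \<lless> (\<lambda>m. \<bar>L m (j+1)\<bar>))"

end

theory Submission
  imports Defs
begin

text \<open>
  Each hierarchy restricts the limiting direction of the coefficient vector \<open>a\<close>, and the two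
  restrictions contradict each other.

  At the origin, the polar equation with \<open>\<epsilon>a = 0\<close> is reversible: in the coordinates
  $u = r\cos\theta$, $y = r\sin\theta$ the terms with the $b_i$ are odd in $u$, and the reflection
  $\theta \mapsto \pi - \theta$ maps orbits to orbits. Only the terms with the $a_i$, which are even
  in $u$, break this symmetry. Comparing a solution with its own mirror image over each of
  the two half turns centred at a crossing of the axis $u = 0$ therefore gives
  (\<open>displacement_expansion\<close>)
  \[ P_0(r) - r = r \sum_{i\le n} \varepsilon_a a_i\, r^{2i} \kappa_i(r), \]
  where, for bounded \<open>delta\<close> and small $\varepsilon_a$, the Taylor coefficients of $\kappa_i$ at
  $r = 0$ are bounded uniformly in the parameters and $\kappa_i(0)$ is bounded below by a positive
  constant. Reading off the coefficient of $r^{2j+1}$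
  (\<open>origin_coeff_structure\<close>) expresses $C^0_{2j}$ through $\varepsilon_a a_0, \dots,
  \varepsilon_a a_j$ by a triangular matrix with bounded entries and a diagonal bounded away from
  zero. Hence $\varepsilon_a a_j = O(|C^0_0| + \dots + |C^0_{2j}|)$, while
  $C^0_{2n} = O(\varepsilon_a)$, and the hierarchy at the origin forces $a_j \to 0$ for all $j < n$
  (\<open>origin_hierarchy_limit\<close>). By the normalization $|a_n| \to 1$.

  At the lips, $\Lambda_0^+$ is the limit of $M^+(h)$ as the orbit approaches the two-cuspidal loop.
  The integral of $x^{2n} y\,dx$ stays away from zero there, and those of $x^{2i} y\,dx$ are bounded,
  so that $|\Lambda_0^+| \ge c\,|a_n| - 2\pi \sum_{i<n} |a_i|$ (\<open>lips_L0_lower\<close>): it is bounded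
  away from zero along the sequence. On the other hand $\Lambda_n^+$ depends linearly on \<open>a\<close> and
  is therefore bounded (\<open>lips_coeff_bounded\<close>). This contradicts
  $|\Lambda_0^+| / |\Lambda_n^+| \to 0$.

  Two devices keep the analysis elementary. The dependence of the solutions on the initial radius is
  described by finite expansions whose coefficients, but not whose remainders, are uniform in the
  parameters (\<open>jet\<close>); this suffices because coefficients are compared for each parameter
  separately, as $r \to 0$. For the lips no expansion has to be constructed: the expansion of $M^+$
  determines its coefficients, hence $a \mapsto \Lambda_n^+$ is a linear map on the subspace of those
  \<open>a\<close> that admit one, and a linear functional in finitely many coordinates is bounded.
\<close>

section \<open>The squared coordinate as a function of the polar variable\<close>

text \<open>
  The branch \<open>omega\<close> as a function of $u = r\cos\theta$ alone: $u^2 = ((\omega-1)^3+1)/3$, where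
  $\omega = x^2$.
\<close>

definition om :: "real \<Rightarrow> real" where
  "om u = 1 + root 3 (3 * u\<^sup>2 - 1)"

text \<open>
  The smooth continuation of $|u|/\sqrt\omega$ to $u = 0$, see \<open>sq_mult\<close>. It removes the
  singularity of $|\cos\theta|\,\omega^{-1/2}$.
\<close>

definition sq :: "real \<Rightarrow> real" where
  "sq u = sqrt (1 - om u + (om u)\<^sup>2 / 3)"

text \<open>
  The part of $rQ$ that comes from the $a_i$, as an even function of $u$; the parameter $\varepsilon_a$
  is absorbed into the coefficients.
\<close>

definition Se :: "nat \<Rightarrow> (nat \<Rightarrow> real) \<Rightarrow> real \<Rightarrow> real" where
  "Se n a u = (\<Sum>i\<le>n. a i * om u ^ i) * sq u / (1 - om u)\<^sup>2"

text \<open>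
  The part of $rQ$ that comes from the $b_i$, an odd function of $u$.
\<close>

definition So :: "nat \<Rightarrow> (nat \<Rightarrow> real) \<Rightarrow> real \<Rightarrow> real" where
  "So n b u = u * (\<Sum>i\<le>n. b i * om u ^ i) / (1 - om u)\<^sup>2"

lemma omega_eq_om: "omega r \<theta> = om (r * cos \<theta>)"
  by (simp add: omega_def om_def)

lemma om_minus [simp]: "om (- u) = om u"
  by (simp add: om_def)

lemma sq_minus [simp]: "sq (- u) = sq u"
  by (simp add: sq_def)

lemma om_0 [simp]: "om 0 = 0"
  by (simp add: om_def real_root_minus)

lemma Se_minus [simp]: "Se n a (- u) = Se n a u"
  by (simp add: Se_def)

lemma So_minus [simp]: "So n b (- u) = - So n b u"
  by (simp add: So_def)

lemma om_eqI:
  assumes "3 * u\<^sup>2 = (w - 1) ^ 3 + 1"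
  shows "om u = w"
  using omega_iff[of u 0 w] assms by (simp add: omega_eq_om)

lemma om_cube: "(om u - 1) ^ 3 = 3 * u\<^sup>2 - 1"
  by (simp add: om_def odd_real_root_pow)

lemma om_eq: "u\<^sup>2 = om u * (1 - om u + (om u)\<^sup>2 / 3)"
proof -
  have "(om u - 1) ^ 3 = 3 * (om u * (1 - om u + (om u)\<^sup>2 / 3)) - 1"
    by (simp add: power3_eq_cube power2_eq_square algebra_simps)
  then show ?thesis using om_cube[of u] by simp
qed

lemma quadratic_ge: "1 - w + w\<^sup>2 / 3 \<ge> 1 / 4" for w :: real
proof -
  have "1 - w + w\<^sup>2 / 3 = 1 / 4 + (w - 3 / 2)\<^sup>2 / 3"
    by (simp add: power2_eq_square field_simps)
  then show ?thesis by simp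
qed

lemma om_nonneg: "om u \<ge> 0"
proof (rule ccontr)
  assume "\<not> om u \<ge> 0"
  then have "om u * (1 - om u + (om u)\<^sup>2 / 3) < 0"
    using quadratic_ge[of "om u"] by (intro mult_neg_pos) auto
  then show False using om_eq[of u] by (metis not_less zero_le_power2)
qed

lemma om_less_1: "3 * u\<^sup>2 < 1 \<Longrightarrow> om u < 1"
  by (simp add: om_def)

lemma continuous_om [continuous_intros]:
  "continuous_on I f \<Longrightarrow> continuous_on I (\<lambda>x. om (f x))"
  unfolding om_def by (intro continuous_intros)

lemma continuous_sq [continuous_intros]:
  "continuous_on I f \<Longrightarrow> continuous_on I (\<lambda>x. sq (f x))"
  unfolding sq_def by (intro continuous_intros) auto

lemma sq_sq: "(sq u)\<^sup>2 = 1 - om u + (om u)\<^sup>2 / 3"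
  using quadratic_ge[of "om u"] by (simp add: sq_def)

lemma sq_ge: "sq u \<ge> 1 / 2"
  unfolding sq_def by (rule real_le_rsqrt) (use quadratic_ge[of "om u"] in \<open>simp add: power2_eq_square\<close>)

lemma sq_le: "3 * u\<^sup>2 < 1 \<Longrightarrow> sq u \<le> 1"
proof -
  assume "3 * u\<^sup>2 < 1"
  then have "om u * om u \<le> om u * 3"
    using om_less_1[of u] om_nonneg[of u] by (intro mult_left_mono) auto
  then show ?thesis
    unfolding sq_def by (simp add: power2_eq_square)
qed

lemma sq_mult: "(sq u)\<^sup>2 * om u = u\<^sup>2"
  using om_eq[of u] sq_sq[of u] by (simp add: mult.commute)

lemma continuous_Se [continuous_intros]:
  assumes "continuous_on I f" "\<And>x. x \<in> I \<Longrightarrow> 3 * (f x)\<^sup>2 < 1"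
  shows "continuous_on I (\<lambda>x. Se n a (f x))"
  unfolding Se_def using assms om_less_1 by (intro continuous_intros) fastforce+

lemma continuous_So [continuous_intros]:
  assumes "continuous_on I f" "\<And>x. x \<in> I \<Longrightarrow> 3 * (f x)\<^sup>2 < 1"
  shows "continuous_on I (\<lambda>x. So n b (f x))"
  unfolding So_def using assms om_less_1 by (intro continuous_intros) fastforce+

lemma Q_fun_eq:
  assumes "r > 0" "cos \<theta> \<noteq> 0"
  shows "r * Q_fun n a b \<epsilon>a \<epsilon>b r \<theta> =
     Se n (\<lambda>i. \<epsilon>a * a i) (r * cos \<theta>) + So n (\<lambda>i. \<epsilon>b * b i) (r * cos \<theta>)"
proof -
  define u where "u = r * cos \<theta>"
  have u: "u \<noteq> 0" using assms by (simp add: u_def)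
  have om: "om u > 0"
    using om_nonneg[of u] sq_mult[of u] u by (cases "om u = 0") auto
  have root: "\<bar>u\<bar> = sq u * sqrt (om u)"
  proof -
    have "\<bar>u\<bar> = sqrt ((sq u)\<^sup>2 * om u)" by (simp add: sq_mult)
    also have "\<dots> = sq u * sqrt (om u)" using sq_ge[of u] by (simp add: real_sqrt_mult)
    finally show ?thesis .
  qed
  have powr: "\<bar>u\<bar> * om u powr (real i - 1 / 2) = om u ^ i * sq u" for i
    using om by (simp add: root powr_diff powr_half_sqrt powr_realpow)
  have "r * (\<epsilon>a * \<bar>cos \<theta>\<bar> * (\<Sum>i\<le>n. a i * om u powr (real i - 1 / 2)))
      = \<epsilon>a * (\<Sum>i\<le>n. a i * (\<bar>u\<bar> * om u powr (real i - 1 / 2)))"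
    using assms(1) by (simp add: u_def abs_mult sum_distrib_left mult_ac)
  also have "\<dots> = (\<Sum>i\<le>n. \<epsilon>a * a i * om u ^ i) * sq u"
    by (simp add: powr sum_distrib_left sum_distrib_right mult_ac)
  finally have A: "r * (\<epsilon>a * \<bar>cos \<theta>\<bar> * (\<Sum>i\<le>n. a i * om u powr (real i - 1 / 2)))
      = (\<Sum>i\<le>n. \<epsilon>a * a i * om u ^ i) * sq u" .
  have B: "r * (\<epsilon>b * cos \<theta> * (\<Sum>i\<le>n. b i * om u ^ i)) = u * (\<Sum>i\<le>n. \<epsilon>b * b i * om u ^ i)"
    by (simp add: u_def sum_distrib_left mult_ac)
  have C: "(om u - 1)\<^sup>2 = (1 - om u)\<^sup>2" by (simp add: power2_eq_square algebra_simps)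
  have "r * Q_fun n a b \<epsilon>a \<epsilon>b r \<theta> =
     (r * (\<epsilon>a * \<bar>cos \<theta>\<bar> * (\<Sum>i\<le>n. a i * om u powr (real i - 1 / 2)))
      + r * (\<epsilon>b * cos \<theta> * (\<Sum>i\<le>n. b i * om u ^ i))) / (1 - om u)\<^sup>2"
    by (simp add: Q_fun_def omega_eq_om u_def[symmetric] C distrib_left)
  then show ?thesis
    unfolding A B by (simp add: Se_def So_def u_def[symmetric] add_divide_distrib)
qed

section \<open>Families of expansions with uniformly bounded coefficients\<close>

text \<open>
  A continuous function with an explicit bound. Continuity is carried along because expansions are
  integrated over \<open>I\<close>.
\<close>

abbreviation bdd_on :: "real set \<Rightarrow> real \<Rightarrow> (real \<Rightarrow> real) \<Rightarrow> bool" where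
  "bdd_on I B g \<equiv> continuous_on I g \<and> (\<forall>t\<in>I. \<bar>g t\<bar> \<le> B)"

text \<open>
  \<open>\<forall>\<^sub>0 r. P r\<close>: the property holds for all sufficiently small $r > 0$.
\<close>

abbreviation near_0 :: "(real \<Rightarrow> bool) \<Rightarrow> bool"  (binder "\<forall>\<^sub>0" 10) where
  "near_0 P \<equiv> eventually P (at_right 0)"

text \<open>
  A family of coefficients, indexed by a parameter \<open>m\<close>: continuous functions of the angle, bounded
  uniformly in \<open>m\<close>.
\<close>

definition bdd_cont :: "real set \<Rightarrow> ('i \<Rightarrow> real \<Rightarrow> real) \<Rightarrow> bool" where
  "bdd_cont I c \<longleftrightarrow> (\<forall>m. continuous_on I (c m)) \<and> (\<exists>K. \<forall>m. \<forall>t\<in>I. \<bar>c m t\<bar> \<le> K)"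

text \<open>
  \<open>jet N I f\<close>: as $r \to 0$, the functions \<open>f m r\<close> on \<open>I\<close> have an expansion
  $\sum_{k<N} c_k(m,t)\,r^k + O(r^N)$ whose coefficients are families in the sense of
  \<open>bdd_cont\<close>. The constant in the remainder, and the range of \<open>r\<close> in which the
  estimate holds, may depend on \<open>m\<close>. The recursion peels off one coefficient at a time, which
  turns the closure properties below into short inductions; the explicit form is \<open>jet_expand\<close>.
\<close>

primrec jet :: "nat \<Rightarrow> real set \<Rightarrow> ('i \<Rightarrow> real \<Rightarrow> real \<Rightarrow> real) \<Rightarrow> bool" where
  "jet 0 I f \<longleftrightarrow> (\<forall>m. \<exists>M. \<forall>\<^sub>0 r. bdd_on I M (f m r))"
| "jet (Suc N) I f \<longleftrightarrow> (\<exists>c g. bdd_cont I c \<and> jet N I g \<and>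
      (\<forall>m. \<forall>\<^sub>0 r. \<forall>t\<in>I. f m r t = c m t + r * g m r t))"

lemma bdd_contI:
  assumes "\<And>m. continuous_on I (c m)" "\<And>m t. t \<in> I \<Longrightarrow> \<bar>c m t\<bar> \<le> K"
  shows "bdd_cont I c"
  using assms unfolding bdd_cont_def by blast

lemma bdd_cont_add: "bdd_cont I c \<Longrightarrow> bdd_cont I d \<Longrightarrow> bdd_cont I (\<lambda>m t. c m t + d m t)"
proof -
  assume "bdd_cont I c" "bdd_cont I d"
  then obtain K K' where
    "\<And>m t. t \<in> I \<Longrightarrow> \<bar>c m t\<bar> \<le> K" "\<And>m t. t \<in> I \<Longrightarrow> \<bar>d m t\<bar> \<le> K'"
    "\<And>m. continuous_on I (c m)" "\<And>m. continuous_on I (d m)"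
    unfolding bdd_cont_def by blast
  then show ?thesis
    by (intro bdd_contI[where K = "K + K'"] continuous_intros) (auto intro!: order_trans[OF abs_triangle_ineq add_mono])
qed

lemma bdd_cont_mult: "bdd_cont I c \<Longrightarrow> bdd_cont I d \<Longrightarrow> bdd_cont I (\<lambda>m t. c m t * d m t)"
proof -
  assume "bdd_cont I c" "bdd_cont I d"
  then obtain K K' where *:
    "\<And>m t. t \<in> I \<Longrightarrow> \<bar>c m t\<bar> \<le> K" "\<And>m t. t \<in> I \<Longrightarrow> \<bar>d m t\<bar> \<le> K'"
    "\<And>m. continuous_on I (c m)" "\<And>m. continuous_on I (d m)"
    unfolding bdd_cont_def by blast
  have "\<bar>c m t * d m t\<bar> \<le> K * K'" if "t \<in> I" for m t
    using *(1)[OF that, of m] *(2)[OF that, of m] by (simp add: abs_mult mult_mono')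
  with * show ?thesis by (intro bdd_contI[where K = "K * K'"] continuous_intros) auto
qed

lemma bdd_cont_const [intro]: "bdd_cont I (\<lambda>m t. k)"
  by (rule bdd_contI[where K = "\<bar>k\<bar>"]) auto

lemma bdd_cont_reparam:
  assumes "bdd_cont I c" "continuous_on J \<phi>" "\<phi> ` J \<subseteq> I"
  shows "bdd_cont J (\<lambda>m t. c m (\<phi> t))"
proof -
  obtain K where "\<And>m t. t \<in> I \<Longrightarrow> \<bar>c m t\<bar> \<le> K" "\<And>m. continuous_on I (c m)"
    using assms(1) unfolding bdd_cont_def by blast
  with assms show ?thesis
    by (intro bdd_contI[where K = K] continuous_on_compose2[OF _ assms(2,3)]) auto
qed

lemma bdd_cont_inverse:
  assumes "bdd_cont I c" "\<delta> > 0" "\<And>m t. t \<in> I \<Longrightarrow> c m t \<ge> \<delta>"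
  shows "bdd_cont I (\<lambda>m t. inverse (c m t))"
proof (rule bdd_contI[where K = "inverse \<delta>"])
  fix m
  show "continuous_on I (\<lambda>t. inverse (c m t))"
    using assms unfolding bdd_cont_def by (intro continuous_intros) (auto dest!: assms(3)[of _ m])
next
  fix m t assume "t \<in> I"
  from assms(3)[OF this, of m] assms(2) show "\<bar>inverse (c m t)\<bar> \<le> inverse \<delta>"
    by (auto simp: abs_if intro!: le_imp_inverse_le)
qed

lemma bdd_cont_sqrt:
  assumes "bdd_cont I c" "\<And>m t. t \<in> I \<Longrightarrow> c m t \<ge> 0"
  shows "bdd_cont I (\<lambda>m t. sqrt (c m t))"
proof -
  obtain K where *: "\<And>m t. t \<in> I \<Longrightarrow> \<bar>c m t\<bar> \<le> K" "\<And>m. continuous_on I (c m)"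
    using assms(1) unfolding bdd_cont_def by blast
  then have "\<bar>sqrt (c m t)\<bar> \<le> sqrt K" if "t \<in> I" for m t
    using *(1)[OF that, of m] assms(2)[OF that, of m] by simp
  with * show ?thesis by (intro bdd_contI[where K = "sqrt K"] continuous_intros) auto
qed

lemma bdd_cont_integral:
  assumes "bdd_cont {0..T} c"
  shows "bdd_cont {0..T} (\<lambda>m t. integral {0..t} (c m))"
proof -
  obtain K where *: "\<And>m t. t \<in> {0..T} \<Longrightarrow> \<bar>c m t\<bar> \<le> K" "\<And>m. continuous_on {0..T} (c m)"
    using assms(1) unfolding bdd_cont_def by blast
  have "\<bar>integral {0..t} (c m)\<bar> \<le> \<bar>K\<bar> * T" if "t \<in> {0..T}" for m t
  proof -
    have "norm (integral {0..t} (c m)) \<le> \<bar>K\<bar> * (t - 0)"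
      using that *(1)[of _ m] by (intro integral_bound continuous_on_subset[OF *(2)]) force+
    also have "\<dots> \<le> \<bar>K\<bar> * T" using that by (intro mult_left_mono) auto
    finally show ?thesis by simp
  qed
  moreover have "continuous_on {0..T} (\<lambda>t. integral {0..t} (c m))" for m
    by (intro indefinite_integral_continuous_1 integrable_continuous_real *)
  ultimately show ?thesis by (intro bdd_contI[where K = "\<bar>K\<bar> * T"])
qed

lemma bdd_cont_exp: "bdd_cont I c \<Longrightarrow> bdd_cont I (\<lambda>m t. exp (c m t))"
proof -
  assume "bdd_cont I c"
  then obtain K where *: "\<And>m t. t \<in> I \<Longrightarrow> \<bar>c m t\<bar> \<le> K" "\<And>m. continuous_on I (c m)"
    unfolding bdd_cont_def by blast
  then have "\<bar>exp (c m t)\<bar> \<le> exp K" if "t \<in> I" for m t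
    using *(1)[OF that, of m] by simp
  with * show ?thesis by (intro bdd_contI[where K = "exp K"] continuous_intros) auto
qed

lemma eventually_right_0: "c > 0 \<Longrightarrow> \<forall>\<^sub>0 r. 0 < r \<and> r < (c::real)"
  unfolding eventually_at_right_field by auto

lemma eventually_small:
  assumes "\<delta> > 0"
  shows "\<forall>\<^sub>0 r. 0 < r \<and> r * \<bar>M\<bar> < (\<delta>::real)"
proof -
  have "\<delta> / (\<bar>M\<bar> + 1) > 0" using assms by auto
  from eventually_right_0[OF this] show ?thesis
  proof eventually_elim
    case (elim r)
    then have "r * (\<bar>M\<bar> + 1) < \<delta>" by (simp add: pos_less_divide_eq)
    with elim show ?case by (simp add: distrib_left)
  qed
qed

lemma small_mult:
  fixes r :: real
  assumes "0 < r \<and> r * \<bar>M\<bar> < \<delta>" "\<bar>x\<bar> \<le> M"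
  shows "\<bar>r * x\<bar> \<le> \<delta>"
proof -
  have "\<bar>r * x\<bar> = r * \<bar>x\<bar>" using assms by (simp add: abs_mult)
  also have "\<dots> \<le> r * \<bar>M\<bar>" by (rule mult_left_mono) (use assms in auto)
  finally show ?thesis using assms by linarith
qed

lemma jet_cong:
  assumes "jet N I f" "\<And>m. \<forall>\<^sub>0 r. \<forall>t\<in>I. f m r t = g m r t"
  shows "jet N I g"
proof (cases N)
  case 0
  have "\<exists>M. \<forall>\<^sub>0 r. bdd_on I M (g m r)" for m
  proof -
    from assms 0 obtain M where
      "\<forall>\<^sub>0 r. bdd_on I M (f m r)" by auto
    with assms(2)[of m] have "\<forall>\<^sub>0 r. bdd_on I M (g m r)"
      by eventually_elim (auto cong: continuous_on_cong)
    then show ?thesis ..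
  qed
  then show ?thesis using 0 by simp
next
  case (Suc k)
  with assms(1) obtain c h where ch: "bdd_cont I c" "jet k I h"
    and e: "\<And>m. \<forall>\<^sub>0 r. \<forall>t\<in>I. f m r t = c m t + r * h m r t" by auto
  have "\<forall>\<^sub>0 r. \<forall>t\<in>I. g m r t = c m t + r * h m r t" for m
    using e[of m] assms(2)[of m] by eventually_elim auto
  with ch Suc show ?thesis by auto
qed

lemma jet_bounded: "jet N I f \<Longrightarrow> jet 0 I f"
proof (induction N arbitrary: f)
  case (Suc N)
  from Suc.prems obtain c g where c: "bdd_cont I c" and g': "jet N I g"
    and e: "\<And>m. \<forall>\<^sub>0 r. \<forall>t\<in>I. f m r t = c m t + r * g m r t" by auto
  have g: "jet 0 I g" using g' by (rule Suc.IH)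
  from c obtain K where K: "\<And>m t. t \<in> I \<Longrightarrow> \<bar>c m t\<bar> \<le> K" "\<And>m. continuous_on I (c m)"
    unfolding bdd_cont_def by blast
  have "\<exists>M. \<forall>\<^sub>0 r. bdd_on I M (f m r)" for m
  proof -
    from g obtain M where
      "\<forall>\<^sub>0 r. bdd_on I M (g m r)" by auto
    with e[of m] eventually_small[OF zero_less_one, of M]
    have "\<forall>\<^sub>0 r. bdd_on I (K + 1) (f m r)"
    proof eventually_elim
      case (elim r)
      have "\<bar>f m r t\<bar> \<le> K + 1" if "t \<in> I" for t
      proof -
        have "\<bar>r * g m r t\<bar> \<le> 1" by (rule small_mult[where M = M]) (use elim that in auto)
        with K(1)[OF that, of m] show ?thesis using elim that by fastforce
      qed
      moreover have "continuous_on I (\<lambda>t. c m t + r * g m r t)"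
        using elim K by (intro continuous_intros) auto
      ultimately show ?case using elim by (auto cong: continuous_on_cong)
    qed
    then show ?thesis ..
  qed
  then show ?case by simp
qed

lemma jet_boundedE:
  assumes "jet N I f"
  obtains M where "\<forall>\<^sub>0 r. bdd_on I M (f m r)"
  using jet_bounded[OF assms] by auto

lemma jet_continuous: "jet N I f \<Longrightarrow> \<forall>\<^sub>0 r. continuous_on I (f m r)"
  by (erule jet_boundedE[where m = m]) (auto elim: eventually_mono)

lemma jet_SucD: "jet (Suc N) I f \<Longrightarrow> jet N I f"
proof (induction N arbitrary: f)
  case 0 then show ?case using jet_bounded by blast
next
  case (Suc N)
  from Suc.prems obtain c g where "bdd_cont I c" "jet (Suc N) I g"
     "\<And>m. \<forall>\<^sub>0 r. \<forall>t\<in>I. f m r t = c m t + r * g m r t" by auto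
  with Suc.IH[of g] show ?case by (auto simp del: jet.simps intro!: jet.simps(2)[THEN iffD2])
qed

lemma jet_bc:
  fixes c :: "'i \<Rightarrow> real \<Rightarrow> real"
  shows "bdd_cont I c \<Longrightarrow> jet N I (\<lambda>m r. c m)"
proof (induction N arbitrary: c)
  case 0 then show ?case by (auto simp: bdd_cont_def)
next
  case (Suc N)
  have "jet N I (\<lambda>(m :: 'i) r t. 0)" by (rule Suc.IH) (rule bdd_cont_const)
  then show ?case using Suc.prems by force
qed

lemma jet_const: "jet N I (\<lambda>m r t. k)"
  by (rule jet_bc) auto

text \<open>
  A factor $r$ gains one order. Together with \<open>jet_mult\<close>, \<open>jet_inverse\<close> and
  \<open>jet_exp_integral\<close> this allows expansions to be bootstrapped: a quantity that equals a
  function of $r$ times itself inherits expansions of all orders from mere boundedness.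
\<close>

lemma jet_r: "jet N I f \<Longrightarrow> jet (Suc N) I (\<lambda>m r t. r * f m r t)"
  by (auto intro!: exI[of _ "\<lambda>m t. 0"] exI[of _ f])

lemma jet_add: "jet N I f \<Longrightarrow> jet N I g \<Longrightarrow> jet N I (\<lambda>m r t. f m r t + g m r t)"
proof (induction N arbitrary: f g)
  case 0
  have "\<exists>M. \<forall>\<^sub>0 r. bdd_on I M (\<lambda>t. f m r t + g m r t)" for m
  proof -
    from 0(1) obtain M where M:
      "\<forall>\<^sub>0 r. bdd_on I M (f m r)" by auto
    from 0(2) obtain M' where
      "\<forall>\<^sub>0 r. bdd_on I M' (g m r)" by auto
    with M have "\<forall>\<^sub>0 r. bdd_on I (M + M') (\<lambda>t. f m r t + g m r t)"
      by eventually_elim (auto intro!: continuous_intros order_trans[OF abs_triangle_ineq add_mono])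
    then show ?thesis ..
  qed
  then show ?case by simp
next
  case (Suc N)
  then obtain c d f' g' where cd: "bdd_cont I c" "bdd_cont I d" and fg: "jet N I f'" "jet N I g'"
    and e: "\<And>m. \<forall>\<^sub>0 r. \<forall>t\<in>I. f m r t = c m t + r * f' m r t"
           "\<And>m. \<forall>\<^sub>0 r. \<forall>t\<in>I. g m r t = d m t + r * g' m r t" by auto
  have "\<forall>\<^sub>0 r. \<forall>t\<in>I. f m r t + g m r t = (c m t + d m t) + r * (f' m r t + g' m r t)" for m
    using e(1)[of m] e(2)[of m] by eventually_elim (auto simp: algebra_simps)
  with bdd_cont_add[OF cd] Suc.IH[OF fg] show ?case
    by (auto intro!: exI[of _ "\<lambda>m t. c m t + d m t"] exI[of _ "\<lambda>m r t. f' m r t + g' m r t"])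
qed

lemma jet_mult: "jet N I f \<Longrightarrow> jet N I g \<Longrightarrow> jet N I (\<lambda>m r t. f m r t * g m r t)"
proof (induction N arbitrary: f g)
  case 0
  have "\<exists>M. \<forall>\<^sub>0 r. bdd_on I M (\<lambda>t. f m r t * g m r t)" for m
  proof -
    from 0(1) obtain M where M:
      "\<forall>\<^sub>0 r. bdd_on I M (f m r)" by auto
    from 0(2) obtain M' where
      "\<forall>\<^sub>0 r. bdd_on I M' (g m r)" by auto
    with M have "\<forall>\<^sub>0 r. bdd_on I (M * M') (\<lambda>t. f m r t * g m r t)"
      by eventually_elim (auto intro!: continuous_intros mult_mono' simp: abs_mult)
    then show ?thesis ..
  qed
  then show ?case by simp
next
  case (Suc N)
  then obtain c d f' g' where cd: "bdd_cont I c" "bdd_cont I d" and fg: "jet N I f'" "jet N I g'"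
    and e: "\<And>m. \<forall>\<^sub>0 r. \<forall>t\<in>I. f m r t = c m t + r * f' m r t"
           "\<And>m. \<forall>\<^sub>0 r. \<forall>t\<in>I. g m r t = d m t + r * g' m r t" by auto
  have f: "jet N I f" using Suc.prems(1) by (rule jet_SucD)
  have j: "jet N I (\<lambda>m r t. f' m r t * d m t + f m r t * g' m r t)"
    using Suc.IH[OF fg(1) jet_bc[OF cd(2)]] Suc.IH[OF f fg(2)] by (rule jet_add)
  have "\<forall>\<^sub>0 r. \<forall>t\<in>I. f m r t * g m r t = c m t * d m t + r * (f' m r t * d m t + f m r t * g' m r t)" for m
    using e(1)[of m] e(2)[of m] by eventually_elim (auto simp: algebra_simps)
  with bdd_cont_mult[OF cd] j show ?case
    by (auto intro!: exI[of _ "\<lambda>m t. c m t * d m t"]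
        exI[of _ "\<lambda>m r t. f' m r t * d m t + f m r t * g' m r t"])
qed

lemma jet_minus: "jet N I f \<Longrightarrow> jet N I (\<lambda>m r t. - f m r t)"
  using jet_mult[OF jet_const[of N I "-1"], of f] by simp

lemma jet_diff: "jet N I f \<Longrightarrow> jet N I g \<Longrightarrow> jet N I (\<lambda>m r t. f m r t - g m r t)"
  using jet_add[of N I f "\<lambda>m r t. - g m r t"] jet_minus[of N I g] by simp

lemma jet_power: "jet N I f \<Longrightarrow> jet N I (\<lambda>m r t. f m r t ^ k)"
  by (induction k) (auto intro: jet_const jet_mult)

lemma jet_sum: "(\<And>k. k \<in> A \<Longrightarrow> jet N I (f k)) \<Longrightarrow> jet N I (\<lambda>m r t. \<Sum>k\<in>A. f k m r t)"
  by (induction A rule: infinite_finite_induct) (auto intro: jet_const jet_add)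

lemma jet_coeff_ge:
  assumes "jet 0 I g" "\<And>m. \<forall>\<^sub>0 r. \<forall>t\<in>I. f m r t = c m t + r * g m r t"
    and "\<And>m. \<forall>\<^sub>0 r. \<forall>t\<in>I. f m r t \<ge> \<delta>" and "t \<in> I"
  shows "c m t \<ge> \<delta>"
proof (rule field_le_epsilon)
  fix e :: real assume "e > 0"
  from assms(1) obtain M where
    "\<forall>\<^sub>0 r. bdd_on I M (g m r)" by auto
  with assms(2)[of m] assms(3)[of m] eventually_small[OF \<open>e > 0\<close>, of M]
  have "\<forall>\<^sub>F r in at_right (0::real). \<delta> \<le> c m t + e"
  proof eventually_elim
    case (elim r)
    have "\<bar>r * g m r t\<bar> \<le> e" by (rule small_mult[where M = M]) (use elim \<open>t \<in> I\<close> in auto)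
    then show ?case using elim \<open>t \<in> I\<close> by fastforce
  qed
  then show "\<delta> \<le> c m t + e" by (simp add: eventually_const_iff)
qed

lemma jet_inverse:
  assumes "jet N I f" "\<delta> > 0" "\<And>m. \<forall>\<^sub>0 r. \<forall>t\<in>I. f m r t \<ge> \<delta>"
  shows "jet N I (\<lambda>m r t. inverse (f m r t))"
  using assms
proof (induction N arbitrary: f)
  case 0
  have "\<exists>M. \<forall>\<^sub>0 r. bdd_on I M (\<lambda>t. inverse (f m r t))" for m
  proof -
    have "\<forall>\<^sub>0 r. continuous_on I (f m r)" using 0(1) by (rule jet_continuous)
    with 0(3)[of m] have "\<forall>\<^sub>0 r. bdd_on I (inverse \<delta>) (\<lambda>t. inverse (f m r t))"
    proof eventually_elim
      case (elim r)
      have "f m r t > 0" if "t \<in> I" for t using elim(1) that \<open>\<delta> > 0\<close> by fastforce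
      then show ?case using elim \<open>\<delta> > 0\<close>
        by (fastforce intro!: continuous_intros le_imp_inverse_le simp: abs_if)
    qed
    then show ?thesis ..
  qed
  then show ?case by simp
next
  case (Suc N)
  from Suc.prems(1) obtain c g where c: "bdd_cont I c" and g: "jet N I g"
    and e: "\<And>m. \<forall>\<^sub>0 r. \<forall>t\<in>I. f m r t = c m t + r * g m r t" by auto
  have ge: "c m t \<ge> \<delta>" if "t \<in> I" for m t
    using jet_coeff_ge[OF jet_bounded[OF g] e Suc.prems(3) that] .
  have c': "bdd_cont I (\<lambda>m t. inverse (c m t))" using c \<open>\<delta> > 0\<close> ge by (rule bdd_cont_inverse)
  have IH: "jet N I (\<lambda>m r t. inverse (f m r t))"
    by (rule Suc.IH[OF jet_SucD[OF Suc.prems(1)] Suc.prems(2,3)])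
  have j: "jet N I (\<lambda>m r t. - (g m r t * inverse (c m t) * inverse (f m r t)))"
    by (intro jet_minus jet_mult g IH jet_bc c')
  have "\<forall>\<^sub>0 r. \<forall>t\<in>I. inverse (f m r t) =
      inverse (c m t) + r * (- (g m r t * inverse (c m t) * inverse (f m r t)))" for m
    using e[of m] Suc.prems(3)[of m]
  proof eventually_elim
    case (elim r)
    show ?case
    proof
      fix t assume "t \<in> I"
      with elim ge[of t m] \<open>\<delta> > 0\<close> have "c m t > 0" "f m r t > 0" "f m r t = c m t + r * g m r t"
        by fastforce+
      then have "inverse (f m r t) - inverse (c m t) =
          - (r * g m r t * inverse (c m t) * inverse (f m r t))"
        using inverse_diff_inverse[of "f m r t" "c m t"] by (simp add: mult_ac)
      then show "inverse (f m r t) =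
          inverse (c m t) + r * (- (g m r t * inverse (c m t) * inverse (f m r t)))"
        by (simp add: mult_ac)
    qed
  qed
  with c' j show ?case by (auto intro!: exI[of _ "\<lambda>m t. inverse (c m t)"] exI)
qed

lemma jet_divide:
  assumes "jet N I g" "jet N I f" "\<delta> > 0" "\<And>m. \<forall>\<^sub>0 r. \<forall>t\<in>I. f m r t \<ge> \<delta>"
  shows "jet N I (\<lambda>m r t. g m r t / f m r t)"
  using jet_mult[OF assms(1) jet_inverse[OF assms(2-4)]] by (simp add: divide_inverse)

lemma jet_sqrt:
  assumes "jet N I f" "\<delta> > 0" "\<And>m. \<forall>\<^sub>0 r. \<forall>t\<in>I. f m r t \<ge> \<delta>"
  shows "jet N I (\<lambda>m r t. sqrt (f m r t))"
  using assms
proof (induction N arbitrary: f)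
  case 0
  have "\<exists>M. \<forall>\<^sub>0 r. bdd_on I M (\<lambda>t. sqrt (f m r t))" for m
  proof -
    from 0(1) obtain M where
      "\<forall>\<^sub>0 r. bdd_on I M (f m r)" by auto
    with 0(3)[of m] have "\<forall>\<^sub>0 r. bdd_on I (sqrt M) (\<lambda>t. sqrt (f m r t))"
    proof eventually_elim
      case (elim r)
      have "\<bar>sqrt (f m r t)\<bar> \<le> sqrt M" if "t \<in> I" for t
        using elim that \<open>\<delta> > 0\<close> by (smt (verit) real_sqrt_ge_zero real_sqrt_le_mono)
      then show ?case using elim by (auto intro!: continuous_on_real_sqrt)
    qed
    then show ?thesis ..
  qed
  then show ?case by simp
next
  case (Suc N)
  from Suc.prems(1) obtain c g where c: "bdd_cont I c" and g: "jet N I g"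
    and e: "\<And>m. \<forall>\<^sub>0 r. \<forall>t\<in>I. f m r t = c m t + r * g m r t" by auto
  have ge: "c m t \<ge> \<delta>" if "t \<in> I" for m t
    using jet_coeff_ge[OF jet_bounded[OF g] e Suc.prems(3) that] .
  have c': "bdd_cont I (\<lambda>m t. sqrt (c m t))"
    by (rule bdd_cont_sqrt[OF c]) (meson ge \<open>\<delta> > 0\<close> less_le_trans less_imp_le)
  have IH: "jet N I (\<lambda>m r t. sqrt (f m r t))"
    by (rule Suc.IH[OF jet_SucD[OF Suc.prems(1)] Suc.prems(2,3)])
  have j: "jet N I (\<lambda>m r t. g m r t / (sqrt (f m r t) + sqrt (c m t)))"
  proof (rule jet_divide[where \<delta> = "sqrt \<delta>"])
    show "jet N I (\<lambda>m r t. sqrt (f m r t) + sqrt (c m t))"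
      by (intro jet_add IH jet_bc c')
    show "\<forall>\<^sub>0 r. \<forall>t\<in>I. sqrt \<delta> \<le> sqrt (f m r t) + sqrt (c m t)" for m
      using Suc.prems(3)[of m]
    proof eventually_elim
      case (elim r)
      show ?case
      proof
        fix t assume "t \<in> I"
        with elim ge[of t m] \<open>\<delta> > 0\<close> have "sqrt \<delta> \<le> sqrt (f m r t)" "0 \<le> sqrt (c m t)"
          by fastforce+
        then show "sqrt \<delta> \<le> sqrt (f m r t) + sqrt (c m t)" by linarith
      qed
    qed
  qed (use g \<open>\<delta> > 0\<close> in auto)
  have "\<forall>\<^sub>0 r. \<forall>t\<in>I. sqrt (f m r t) =
      sqrt (c m t) + r * (g m r t / (sqrt (f m r t) + sqrt (c m t)))" for m
    using e[of m] Suc.prems(3)[of m]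
  proof eventually_elim
    case (elim r)
    show ?case
    proof
      fix t assume "t \<in> I"
      with elim ge[of t m] \<open>\<delta> > 0\<close> have p: "c m t > 0" "f m r t > 0" and fe: "f m r t = c m t + r * g m r t"
        by fastforce+
      have "(sqrt (f m r t) - sqrt (c m t)) * (sqrt (f m r t) + sqrt (c m t)) = r * g m r t"
        using p fe by (simp add: algebra_simps)
      moreover have "sqrt (f m r t) + sqrt (c m t) > 0" using p by (simp add: add_pos_pos)
      ultimately show "sqrt (f m r t) =
          sqrt (c m t) + r * (g m r t / (sqrt (f m r t) + sqrt (c m t)))"
        by (simp add: field_simps)
    qed
  qed
  with c' j show ?case by (auto intro!: exI[of _ "\<lambda>m t. sqrt (c m t)"] exI)
qed

lemma jet_reparam:
  assumes "jet N I f" "continuous_on J \<phi>" "\<phi> ` J \<subseteq> I"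
  shows "jet N J (\<lambda>m r t. f m r (\<phi> t))"
  using assms(1)
proof (induction N arbitrary: f)
  case 0
  have "\<exists>M. \<forall>\<^sub>0 r. bdd_on J M (\<lambda>t. f m r (\<phi> t))" for m
  proof -
    from 0(1) obtain M where
      "\<forall>\<^sub>0 r. bdd_on I M (f m r)" by auto
    then have "\<forall>\<^sub>0 r. bdd_on J M (\<lambda>t. f m r (\<phi> t))"
      using assms(2,3) by (auto elim!: eventually_mono intro: continuous_on_compose2[where g = "f _ _"])
    then show ?thesis ..
  qed
  then show ?case by simp
next
  case (Suc N)
  from Suc.prems(1) obtain c g where c: "bdd_cont I c" and g: "jet N I g"
    and e: "\<And>m. \<forall>\<^sub>0 r. \<forall>t\<in>I. f m r t = c m t + r * g m r t" by auto
  have "\<forall>\<^sub>0 r. \<forall>t\<in>J. f m r (\<phi> t) = c m (\<phi> t) + r * g m r (\<phi> t)" for m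
    using e[of m] assms(3) by (auto elim!: eventually_mono)
  with bdd_cont_reparam[OF c assms(2,3)] Suc.IH[OF g] show ?case 
    by (auto intro!: exI[of _ "\<lambda>m t. c m (\<phi> t)"] exI[of _ "\<lambda>m r t. g m r (\<phi> t)"])
qed

lemma jet_integral:
  assumes "jet N {0..T} f"
  shows "jet N {0..T} (\<lambda>m r t. integral {0..t} (f m r))"
  using assms
proof (induction N arbitrary: f)
  case 0
  have "\<exists>M. \<forall>\<^sub>0 r. bdd_on {0..T} M (\<lambda>t. integral {0..t} (f m r))" for m
  proof -
    from 0(1) obtain M where
      "\<forall>\<^sub>0 r. bdd_on {0..T} M (f m r)" by auto
    then have "\<forall>\<^sub>0 r. bdd_on {0..T} (\<bar>M\<bar> * T) (\<lambda>t. integral {0..t} (f m r))"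
    proof eventually_elim
      case (elim r)
      have "bdd_cont {0..T} (\<lambda>_::unit. f m r)" by (rule bdd_contI[where K = M]) (use elim in auto)
      from bdd_cont_integral[OF this] have "continuous_on {0..T} (\<lambda>t. integral {0..t} (f m r))"
        by (simp add: bdd_cont_def)
      moreover have "\<bar>integral {0..t} (f m r)\<bar> \<le> \<bar>M\<bar> * T" if "t \<in> {0..T}" for t
      proof -
        have "norm (integral {0..t} (f m r)) \<le> \<bar>M\<bar> * (t - 0)"
          using that elim by (intro integral_bound) (force intro: continuous_on_subset)+
        also have "\<dots> \<le> \<bar>M\<bar> * T" using that by (intro mult_left_mono) auto
        finally show ?thesis by simp
      qed
      ultimately show ?case by auto
    qed
    then show ?thesis ..
  qed
  then show ?case by simp
next
  case (Suc N)
  from Suc.prems(1) obtain c g where c: "bdd_cont {0..T} c" and g: "jet N {0..T} g"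
    and e: "\<And>m. \<forall>\<^sub>0 r. \<forall>t\<in>{0..T}. f m r t = c m t + r * g m r t" by auto
  have "\<forall>\<^sub>0 r. \<forall>t\<in>{0..T}. integral {0..t} (f m r) = integral {0..t} (c m) + r * integral {0..t} (g m r)" for m
    using e[of m] jet_continuous[OF g, of m]
  proof eventually_elim
    case (elim r)
    show ?case
    proof
      fix t assume t: "t \<in> {0..T}"
      then have "integral {0..t} (f m r) = integral {0..t} (\<lambda>t. c m t + r * g m r t)"
        using elim by (intro integral_cong) auto
      also have "\<dots> = integral {0..t} (c m) + integral {0..t} (\<lambda>t. r * g m r t)"
      proof (rule integral_add)
        have "{0..t} \<subseteq> {0..T}" using t by auto
        then show "c m integrable_on {0..t}" "(\<lambda>t. r * g m r t) integrable_on {0..t}"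
          using elim c unfolding bdd_cont_def
          by (auto intro!: integrable_continuous_real continuous_intros intro: continuous_on_subset)
      qed
      finally show "integral {0..t} (f m r) = integral {0..t} (c m) + r * integral {0..t} (g m r)" by simp
    qed
  qed
  with bdd_cont_integral[OF c] Suc.IH[OF g] show ?case
    by (auto intro!: exI[of _ "\<lambda>m t. integral {0..t} (c m)"] exI[of _ "\<lambda>m r t. integral {0..t} (g m r)"])
qed

text \<open>
  The solution operator of the scalar linear equation $v' = f v$.
\<close>

lemma jet_exp_integral:
  assumes "jet N {0..T} f"
  shows "jet N {0..T} (\<lambda>m r t. exp (integral {0..t} (f m r)))"
  using assms
proof (induction N arbitrary: f)
  case 0
  have *: "jet 0 {0..T} (\<lambda>m r t. integral {0..t} (f m r))" by (rule jet_integral[OF 0])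
  have "\<exists>M. \<forall>\<^sub>0 r. bdd_on {0..T} M (\<lambda>t. exp (integral {0..t} (f m r)))" for m
  proof -
    from * obtain M where
      "\<forall>\<^sub>0 r. bdd_on {0..T} M (\<lambda>t. integral {0..t} (f m r))" by auto
    then have "\<forall>\<^sub>0 r. bdd_on {0..T} (exp M) (\<lambda>t. exp (integral {0..t} (f m r)))"
      by eventually_elim (fastforce intro!: continuous_intros)
    then show ?thesis ..
  qed
  then show ?case by simp
next
  case (Suc N)
  from Suc.prems(1) obtain c g where c: "bdd_cont {0..T} c" and g: "jet N {0..T} g"
    and e: "\<And>m. \<forall>\<^sub>0 r. \<forall>t\<in>{0..T}. f m r t = c m t + r * g m r t" by auto
  \<comment> \<open>after splitting off the leading coefficient, $v = 1 + r\int g v$ gains one order\<close>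
  define v where "v = (\<lambda>m r t. exp (integral {0..t} (\<lambda>s. r * g m r s)))"
  have v: "jet N {0..T} v" unfolding v_def
    by (rule Suc.IH[OF jet_SucD[OF jet_r[OF g]]])
  have gv: "jet N {0..T} (\<lambda>m r t. integral {0..t} (\<lambda>s. g m r s * v m r s))"
    by (intro jet_integral jet_mult g v)
  have E0: "\<forall>\<^sub>0 r. \<forall>t\<in>{0..T}. exp (integral {0..t} (f m r)) =
      exp (integral {0..t} (c m)) * (1 + r * integral {0..t} (\<lambda>s. g m r s * v m r s))" for m
    using e[of m] jet_continuous[OF g, of m] jet_continuous[OF v, of m]
  proof eventually_elim
    case (elim r)
    show ?case
    proof
      fix t assume t: "t \<in> {0..T}"
      have sub: "{0..t} \<subseteq> {0..T}" using t by auto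
      have "((\<lambda>s. r * g m r s * v m r s) has_integral (v m r t - v m r 0)) {0..t}"
      proof (rule fundamental_theorem_of_calculus)
        fix s assume s: "s \<in> {0..t}"
        have "((\<lambda>x. integral {0..x} (\<lambda>s. r * g m r s)) has_real_derivative r * g m r s) (at s within {0..t})"
          using s elim sub by (intro integral_has_real_derivative continuous_intros) (auto intro: continuous_on_subset)
        from DERIV_chain2[OF DERIV_exp this]
        show "(v m r has_vector_derivative r * g m r s * v m r s) (at s within {0..t})"
          unfolding v_def has_real_derivative_iff_has_vector_derivative[symmetric]
          by (simp add: mult_ac)
      qed (use t in auto)
      then have "v m r t = 1 + integral {0..t} (\<lambda>s. r * g m r s * v m r s)"
        by (simp add: v_def integral_unique)
      moreover have "integral {0..t} (\<lambda>s. r * g m r s * v m r s) = r * integral {0..t} (\<lambda>s. g m r s * v m r s)"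
        by (simp add: mult.assoc)
      moreover have "integral {0..t} (f m r) = integral {0..t} (c m) + integral {0..t} (\<lambda>s. r * g m r s)"
      proof -
        have "integral {0..t} (f m r) = integral {0..t} (\<lambda>t. c m t + r * g m r t)"
          using elim t by (intro integral_cong) auto
        also have "\<dots> = integral {0..t} (c m) + integral {0..t} (\<lambda>t. r * g m r t)"
        proof (rule integral_add)
          show "c m integrable_on {0..t}" "(\<lambda>t. r * g m r t) integrable_on {0..t}"
            using elim c sub unfolding bdd_cont_def
            by (auto intro!: integrable_continuous_real continuous_intros intro: continuous_on_subset)
        qed
        finally show ?thesis .
      qed
      ultimately show "exp (integral {0..t} (f m r)) =
          exp (integral {0..t} (c m)) * (1 + r * integral {0..t} (\<lambda>s. g m r s * v m r s))"
        by (simp add: exp_add v_def)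
    qed
  qed
  have E: "\<forall>\<^sub>0 r. \<forall>t\<in>{0..T}.
      exp (integral {0..t} (c m)) * (1 + r * integral {0..t} (\<lambda>s. g m r s * v m r s)) =
      exp (integral {0..t} (f m r))" for m
    using E0[of m]
  proof (rule eventually_mono)
    fix r assume "\<forall>t\<in>{0..T}. exp (integral {0..t} (f m r)) =
      exp (integral {0..t} (c m)) * (1 + r * integral {0..t} (\<lambda>s. g m r s * v m r s))"
    then show "\<forall>t\<in>{0..T}. exp (integral {0..t} (c m)) * (1 + r * integral {0..t} (\<lambda>s. g m r s * v m r s)) =
      exp (integral {0..t} (f m r))"
      unfolding eq_commute[of "exp (integral {0.._} (f m r))"] .
  qed
  have "jet (Suc N) {0..T} (\<lambda>m r t. exp (integral {0..t} (c m)) * (1 + r * integral {0..t} (\<lambda>s. g m r s * v m r s)))"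
    by (rule jet_mult[OF jet_bc[OF bdd_cont_exp[OF bdd_cont_integral[OF c]]] jet_add[OF jet_const jet_r[OF gv]]])
  then show ?case by (rule jet_cong) (rule E)
qed

lemma jet_expand:
  assumes "jet N I f"
  obtains c where "\<And>k. bdd_cont I (c k)"
    and "\<And>m. \<exists>M. \<forall>\<^sub>0 r. \<forall>t\<in>I. \<bar>f m r t - (\<Sum>k<N. c k m t * r ^ k)\<bar> \<le> M * r ^ N"
proof -
  have "\<exists>c. (\<forall>k. bdd_cont I (c k)) \<and> (\<forall>m. \<exists>M. \<forall>\<^sub>0 r. \<forall>t\<in>I. \<bar>f m r t - (\<Sum>k<N. c k m t * r ^ k)\<bar> \<le> M * r ^ N)"
    using assms
  proof (induction N arbitrary: f)
    case 0
    then show ?case by (intro exI[of _ "\<lambda>k m t. 0"]) (fastforce elim: eventually_mono)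
  next
    case (Suc N)
    from Suc.prems(1) obtain c g where c: "bdd_cont I c" and g: "jet N I g"
      and e: "\<And>m. \<forall>\<^sub>0 r. \<forall>t\<in>I. f m r t = c m t + r * g m r t" by auto
    from Suc.IH[OF g] obtain d where d: "\<And>k. bdd_cont I (d k)"
      and M: "\<And>m. \<exists>M. \<forall>\<^sub>0 r. \<forall>t\<in>I. \<bar>g m r t - (\<Sum>k<N. d k m t * r ^ k)\<bar> \<le> M * r ^ N"
      by blast
    define c' where "c' = case_nat c d"
    have "bdd_cont I (c' k)" for k using c d by (cases k) (auto simp: c'_def)
    moreover have "\<exists>M. \<forall>\<^sub>0 r. \<forall>t\<in>I. \<bar>f m r t - (\<Sum>k<Suc N. c' k m t * r ^ k)\<bar> \<le> M * r ^ Suc N" for m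
    proof -
      from M[of m] obtain M where
        "\<forall>\<^sub>0 r. \<forall>t\<in>I. \<bar>g m r t - (\<Sum>k<N. d k m t * r ^ k)\<bar> \<le> M * r ^ N" by blast
      with e[of m] eventually_right_0[OF zero_less_one]
      have "\<forall>\<^sub>0 r. \<forall>t\<in>I. \<bar>f m r t - (\<Sum>k<Suc N. c' k m t * r ^ k)\<bar> \<le> M * r ^ Suc N"
      proof eventually_elim
        case (elim r)
        show ?case
        proof
          fix t assume t: "t \<in> I"
          have "(\<Sum>k<Suc N. c' k m t * r ^ k) = c m t + r * (\<Sum>k<N. d k m t * r ^ k)"
            unfolding sum.lessThan_Suc_shift by (simp add: c'_def sum_distrib_left mult_ac)
          then have "\<bar>f m r t - (\<Sum>k<Suc N. c' k m t * r ^ k)\<bar> = r * \<bar>g m r t - (\<Sum>k<N. d k m t * r ^ k)\<bar>"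
            using elim t by (simp add: abs_mult flip: right_diff_distrib)
          also have "\<dots> \<le> r * (M * r ^ N)" using elim t by (intro mult_left_mono) auto
          finally show "\<bar>f m r t - (\<Sum>k<Suc N. c' k m t * r ^ k)\<bar> \<le> M * r ^ Suc N"
            by (simp add: mult_ac)
        qed
      qed
      then show ?thesis ..
    qed
    ultimately show ?case by blast
  qed
  then show ?thesis using that by blast
qed

section \<open>Expansions of the dissipative terms\<close>

lemma jet_unif_bounded:
  assumes "jet (Suc N) I f"
  obtains K where "K > 0" "\<And>m. \<forall>\<^sub>0 r. \<forall>t\<in>I. \<bar>f m r t\<bar> \<le> K"
proof -
  from assms obtain c g where c: "bdd_cont I c" and g: "jet N I g"
    and e: "\<And>m. \<forall>\<^sub>0 r. \<forall>t\<in>I. f m r t = c m t + r * g m r t" by auto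
  from c obtain K where K: "\<And>m t. t \<in> I \<Longrightarrow> \<bar>c m t\<bar> \<le> K" unfolding bdd_cont_def by blast
  have "\<forall>\<^sub>0 r. \<forall>t\<in>I. \<bar>f m r t\<bar> \<le> \<bar>K\<bar> + 1" for m
  proof -
    obtain M where "\<forall>\<^sub>0 r. bdd_on I M (g m r)"
      using g by (rule jet_boundedE)
    with e[of m] eventually_small[OF zero_less_one, of M] show ?thesis
    proof eventually_elim
      case (elim r)
      show ?case
      proof
        fix t assume t: "t \<in> I"
        have "\<bar>r * g m r t\<bar> \<le> 1" by (rule small_mult[where M = M]) (use elim t in auto)
        moreover have "f m r t = c m t + r * g m r t" using elim t by blast
        ultimately show "\<bar>f m r t\<bar> \<le> \<bar>K\<bar> + 1" using K[OF t, of m] by linarith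
      qed
    qed
  qed
  then show ?thesis by (intro that[of "\<bar>K\<bar> + 1"]) auto
qed

lemma jet_r_small:
  assumes "jet N I z" "\<delta> > 0"
  shows "\<forall>\<^sub>0 r. \<forall>t\<in>I. \<bar>r * z m r t\<bar> \<le> \<delta>"
proof -
  obtain M where "\<forall>\<^sub>0 r. bdd_on I M (z m r)"
    using assms(1) by (rule jet_boundedE)
  with eventually_small[OF assms(2), of M] show ?thesis
  proof eventually_elim
    case (elim r)
    show ?case
    proof
      fix t assume "t \<in> I"
      then show "\<bar>r * z m r t\<bar> \<le> \<delta>" by (intro small_mult[where M = M]) (use elim in auto)
    qed
  qed
qed

text \<open>
  The quotient $\omega/u^2$, with its continuous value at $u = 0$, see \<open>om_V\<close>.
\<close>

definition V :: "real \<Rightarrow> real" where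
  "V u = inverse (1 - om u + (om u)\<^sup>2 / 3)"

text \<open>
  $Y_i(u)$ is the factor of the $i$-th even term that does not vanish at $u = 0$, see \<open>Se_Y\<close>.
\<close>

definition Y :: "nat \<Rightarrow> real \<Rightarrow> real" where
  "Y i u = V u ^ i * sq u / (1 - om u)\<^sup>2"

lemma om_V: "om u = u\<^sup>2 * V u"
  using om_eq[of u] quadratic_ge[of "om u"] by (simp add: V_def field_simps)

lemma V_bounds: "0 < V u" "V u \<le> 4"
  using quadratic_ge[of "om u"] le_imp_inverse_le[of "1/4" "1 - om u + (om u)\<^sup>2 / 3"] by (auto simp: V_def)

lemma V_ge_1: "3 * u\<^sup>2 < 1 \<Longrightarrow> 1 \<le> V u"
proof -
  assume "3 * u\<^sup>2 < 1"
  then have "om u * om u \<le> om u * 3"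
    using om_less_1[of u] om_nonneg[of u] by (intro mult_left_mono) auto
  then show ?thesis
    unfolding V_def using quadratic_ge[of "om u"]
    by (intro one_le_inverse) (auto simp: power2_eq_square)
qed

lemma Se_Y: "Se n a u = (\<Sum>i\<le>n. a i * u ^ (2 * i) * Y i u)"
proof -
  have "om u ^ i = u ^ (2 * i) * V u ^ i" for i
    by (subst om_V) (simp add: power_mult_distrib power_mult)
  then show ?thesis
    by (simp add: Se_def Y_def sum_distrib_right sum_divide_distrib divide_inverse mult.assoc)
qed

lemma om_small: "\<bar>u\<bar> \<le> 1 / 4 \<Longrightarrow> 3 * u\<^sup>2 < 1 \<and> om u \<le> 1 / 4"
proof -
  assume "\<bar>u\<bar> \<le> 1 / 4"
  then have u: "u\<^sup>2 \<le> 1 / 16" using power_mono[of "\<bar>u\<bar>" "1 / 4" 2] by (simp add: power2_eq_square)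
  then have "u\<^sup>2 * V u \<le> 1 / 16 * 4" using V_bounds[of u] by (intro mult_mono) auto
  then show ?thesis using u om_V[of u] by simp
qed

lemma Y_ge: "3 * u\<^sup>2 < 1 \<Longrightarrow> Y i u \<ge> 1 / 2"
proof -
  assume u: "3 * u\<^sup>2 < 1"
  have "1 - om u > 0" "1 - om u \<le> 1" using om_less_1[OF u] om_nonneg[of u] by auto
  then have "(1 - om u)\<^sup>2 > 0" "(1 - om u)\<^sup>2 \<le> 1" by (auto simp: power_le_one)
  moreover have "1 * (1 / 2) \<le> V u ^ i * sq u"
    using V_ge_1[OF u] sq_ge[of u] by (intro mult_mono one_le_power) auto
  ultimately have "1 / 2 * (1 - om u)\<^sup>2 \<le> V u ^ i * sq u"
    by linarith
  then show ?thesis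
    unfolding Y_def by (subst pos_le_divide_eq[OF \<open>(1 - om u)\<^sup>2 > 0\<close>])
qed

text \<open>
  The equation $V = 1/(1-\omega+\omega^2/3)$ with $\omega = u^2 V$ and $u = rz$ gives one more
  coefficient of $V$ in each step.
\<close>

lemma jet_V:
  assumes "jet N I z"
  shows "jet N I (\<lambda>m r t. V (r * z m r t))"
  using assms
proof (induction N)
  case 0
  have "\<forall>\<^sub>0 r. bdd_on I 4 (\<lambda>t. V (r * z m r t))" for m
    using jet_continuous[OF 0, of m]
  proof eventually_elim
    case (elim r)
    have "1 - om u + (om u)\<^sup>2 / 3 \<noteq> 0" for u using quadratic_ge[of "om u"] by linarith
    then have "continuous_on I (\<lambda>t. V (r * z m r t))"
      unfolding V_def using elim by (intro continuous_intros) auto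
    then show ?case using V_bounds by (auto simp: abs_if dest: less_imp_le) (meson V_bounds(1) less_asym)
  qed
  then show ?case by auto
next
  case (Suc N)
  have z: "jet N I z" using Suc.prems by (rule jet_SucD)
  have "jet (Suc N) I (\<lambda>m r t. r * (r * (z m r t ^ 2 * V (r * z m r t))))"
    by (rule jet_r[OF jet_SucD[OF jet_r[OF jet_mult[OF jet_power[OF z] Suc.IH[OF z]]]]])
  then have om: "jet (Suc N) I (\<lambda>m r t. om (r * z m r t))"
    by (rule jet_cong) (simp add: om_V[of "_ * _"] power_mult_distrib power2_eq_square mult_ac)
  have "jet (Suc N) I (\<lambda>m r t. 1 - om (r * z m r t) + om (r * z m r t) ^ 2 * (1/3))"
    by (rule jet_add[OF jet_diff[OF jet_const om] jet_mult[OF jet_power[OF om] jet_const]])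
  then have "jet (Suc N) I (\<lambda>m r t. inverse (1 - om (r * z m r t) + om (r * z m r t) ^ 2 * (1/3)))"
    by (rule jet_inverse[where \<delta> = "1/4"]) (use quadratic_ge in auto)
  then show ?case by (simp add: V_def)
qed

lemma jet_om:
  assumes z: "jet N I z"
  shows "jet (Suc N) I (\<lambda>m r t. om (r * z m r t))"
proof -
  have "jet (Suc N) I (\<lambda>m r t. r * (r * (z m r t ^ 2 * V (r * z m r t))))"
    by (rule jet_r[OF jet_SucD[OF jet_r[OF jet_mult[OF jet_power[OF z] jet_V[OF z]]]]])
  then show ?thesis
    by (rule jet_cong) (simp add: om_V[of "_ * _"] power_mult_distrib power2_eq_square mult_ac)
qed

lemma jet_sq:
  assumes z: "jet N I z"
  shows "jet (Suc N) I (\<lambda>m r t. sq (r * z m r t))"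
proof -
  note om = jet_om[OF z]
  have "jet (Suc N) I (\<lambda>m r t. 1 - om (r * z m r t) + om (r * z m r t) ^ 2 * (1/3))"
    by (rule jet_add[OF jet_diff[OF jet_const om] jet_mult[OF jet_power[OF om] jet_const]])
  then have "jet (Suc N) I (\<lambda>m r t. sqrt (1 - om (r * z m r t) + om (r * z m r t) ^ 2 * (1/3)))"
    by (rule jet_sqrt[where \<delta> = "1/4"]) (use quadratic_ge in auto)
  then show ?thesis by (simp add: sq_def)
qed

lemma jet_inv_1om:
  assumes z: "jet N I z"
  shows "jet (Suc N) I (\<lambda>m r t. inverse ((1 - om (r * z m r t))\<^sup>2))"
proof (rule jet_inverse[where \<delta> = "1/4"])
  show "jet (Suc N) I (\<lambda>m r t. (1 - om (r * z m r t))\<^sup>2)"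
    by (rule jet_power[OF jet_diff[OF jet_const jet_om[OF z]]])
  show "\<forall>\<^sub>0 r. \<forall>t\<in>I. 1 / 4 \<le> (1 - om (r * z m r t))\<^sup>2" for m
  proof -
    have "\<forall>\<^sub>0 r. \<forall>t\<in>I. \<bar>r * z m r t\<bar> \<le> 1 / 4" by (rule jet_r_small[OF z]) simp
    then show ?thesis
    proof eventually_elim
      case (elim r)
      show ?case
      proof
        fix t assume "t \<in> I"
        then have "1 / 2 \<le> 1 - om (r * z m r t)" using om_small elim by fastforce
        from power_mono[OF this, of 2] show "1 / 4 \<le> (1 - om (r * z m r t))\<^sup>2" by (simp add: power2_eq_square)
      qed
    qed
  qed
qed simp

lemma jet_Y:
  assumes z: "jet N I z"
  shows "jet N I (\<lambda>m r t. Y i (r * z m r t))"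
  unfolding Y_def divide_inverse
  by (rule jet_mult[OF jet_mult[OF jet_power[OF jet_V[OF z]] jet_SucD[OF jet_sq[OF z]]] jet_SucD[OF jet_inv_1om[OF z]]])

lemma bdd_cont_param: "(\<And>m. \<bar>k m\<bar> \<le> B) \<Longrightarrow> bdd_cont I (\<lambda>m t. k m)"
  by (rule bdd_contI[where K = B]) auto

lemma jet_poly:
  assumes "jet N I z" "\<And>m i. i \<le> n \<Longrightarrow> \<bar>\<beta> m i\<bar> \<le> B"
  shows "jet N I (\<lambda>m r t. \<Sum>i\<le>n. \<beta> m i * z m r t ^ i)"
  by (intro jet_sum jet_mult jet_power assms(1), rule jet_bc, rule bdd_cont_param) (use assms(2) in auto)

lemma jet_Se:
  assumes z: "jet N I z" and "\<And>m i. i \<le> n \<Longrightarrow> \<bar>\<alpha> m i\<bar> \<le> B"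
  shows "jet (Suc N) I (\<lambda>m r t. Se n (\<alpha> m) (r * z m r t))"
  unfolding Se_def divide_inverse
  by (rule jet_mult[OF jet_mult[OF jet_poly[OF jet_om[OF z] assms(2)] jet_sq[OF z]] jet_inv_1om[OF z]])

lemma jet_So:
  assumes z: "jet N I z" and "\<And>m i. i \<le> n \<Longrightarrow> \<bar>\<beta> m i\<bar> \<le> B"
  shows "jet (Suc N) I (\<lambda>m r t. So n (\<beta> m) (r * z m r t))"
  unfolding So_def divide_inverse
  by (rule jet_mult[OF jet_mult[OF jet_r[OF z] jet_poly[OF jet_om[OF z] assms(2)]] jet_inv_1om[OF z]])

lemma NN_small:
  assumes "\<bar>\<alpha> 0\<bar> \<le> 1 / 2"
  obtains \<delta> where "\<delta> > 0" "\<delta> \<le> 1 / 4" "\<And>u. \<bar>u\<bar> \<le> \<delta> \<Longrightarrow> \<bar>Se n \<alpha> u\<bar> + \<bar>So n \<beta> u\<bar> \<le> 1"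
proof -
  have "continuous_on {-1/4..1/4} (\<lambda>u. \<bar>Se n \<alpha> u\<bar> + \<bar>So n \<beta> u\<bar>)"
    using om_small by (intro continuous_intros) auto
  then have "isCont (\<lambda>u. \<bar>Se n \<alpha> u\<bar> + \<bar>So n \<beta> u\<bar>) 0"
    by (rule continuous_on_interior) auto
  then have "((\<lambda>u. \<bar>Se n \<alpha> u\<bar> + \<bar>So n \<beta> u\<bar>) \<longlongrightarrow> \<bar>\<alpha> 0\<bar>) (at 0)"
    by (simp add: isCont_def Se_def So_def sq_def atMost_atLeast0 sum.atLeast_Suc_atMost)
  then have "\<forall>\<^sub>F u in at 0. \<bar>Se n \<alpha> u\<bar> + \<bar>So n \<beta> u\<bar> < 1"
    by (rule order_tendstoD) (use assms in auto)
  then obtain d where d: "d > 0" "\<And>u. u \<noteq> 0 \<Longrightarrow> \<bar>u\<bar> < d \<Longrightarrow> \<bar>Se n \<alpha> u\<bar> + \<bar>So n \<beta> u\<bar> < 1"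
    unfolding eventually_at by auto
  have 0: "\<bar>Se n \<alpha> 0\<bar> + \<bar>So n \<beta> 0\<bar> \<le> 1"
    using assms by (simp add: Se_def So_def sq_def atMost_atLeast0 sum.atLeast_Suc_atMost)
  show ?thesis
  proof (rule that[of "min (d / 2) (1 / 4)"])
    fix u :: real assume "\<bar>u\<bar> \<le> min (d / 2) (1 / 4)"
    then show "\<bar>Se n \<alpha> u\<bar> + \<bar>So n \<beta> u\<bar> \<le> 1"
      using d(2)[of u] d(1) 0 by (cases "u = 0") auto
  qed (use d in auto)
qed

section \<open>Difference quotients at two points\<close>

text \<open>
  The divided difference of $\omega \mapsto \omega - \omega^2 + \omega^3/3 = u^2$ at the values
  $\omega(u)$, $\omega(v)$.
\<close>

definition W2 :: "real \<Rightarrow> real \<Rightarrow> real" where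
  "W2 u v = 1 - (om u + om v) + ((om u)\<^sup>2 + om u * om v + (om v)\<^sup>2) / 3"

text \<open>
  The difference quotient of \<open>So\<close> at $u$ and $v$, written without division by $u - v$, so
  that it has expansions even where the two points coincide.
\<close>

definition dSo :: "nat \<Rightarrow> (nat \<Rightarrow> real) \<Rightarrow> real \<Rightarrow> real \<Rightarrow> real" where
  "dSo n \<beta> u v = (\<Sum>i\<le>n. \<beta> i * om u ^ i) * inverse ((1 - om u)\<^sup>2) +
     v * ((u + v) * inverse (W2 u v)) *
       ((\<Sum>i\<le>n. \<beta> i * (\<Sum>j<i. om v ^ (i - Suc j) * om u ^ j)) * inverse ((1 - om u)\<^sup>2) +
        (\<Sum>i\<le>n. \<beta> i * om v ^ i) * (2 - om u - om v) * inverse ((1 - om u)\<^sup>2) * inverse ((1 - om v)\<^sup>2))"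

lemma W2_ge: "\<bar>u\<bar> \<le> 1 / 4 \<Longrightarrow> \<bar>v\<bar> \<le> 1 / 4 \<Longrightarrow> W2 u v \<ge> 1 / 2"
proof -
  assume "\<bar>u\<bar> \<le> 1 / 4" "\<bar>v\<bar> \<le> 1 / 4"
  then have "om u \<le> 1 / 4" "om v \<le> 1 / 4" using om_small by auto
  moreover have "((om u)\<^sup>2 + om u * om v + (om v)\<^sup>2) / 3 \<ge> 0" using om_nonneg by simp
  ultimately have "1 - (1 / 4 + 1 / 4) + 0 \<le> W2 u v" unfolding W2_def by (intro add_mono diff_mono) auto
  then show ?thesis by simp
qed

lemma om_diff: "\<bar>u\<bar> \<le> 1 / 4 \<Longrightarrow> \<bar>v\<bar> \<le> 1 / 4 \<Longrightarrow> om u - om v = (u - v) * ((u + v) * inverse (W2 u v))"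
proof -
  assume uv: "\<bar>u\<bar> \<le> 1 / 4" "\<bar>v\<bar> \<le> 1 / 4"
  have "(om u - om v) * W2 u v = om u * (1 - om u + (om u)\<^sup>2 / 3) - om v * (1 - om v + (om v)\<^sup>2 / 3)"
    by (simp add: W2_def power2_eq_square field_simps)
  also have "\<dots> = u\<^sup>2 - v\<^sup>2" by (simp add: om_eq[symmetric])
  also have "\<dots> = (u - v) * (u + v)" by (simp add: power2_eq_square algebra_simps)
  finally show ?thesis using W2_ge[OF uv] by (simp add: field_simps)
qed

lemma So_diff:
  assumes "\<bar>u\<bar> \<le> 1 / 4" "\<bar>v\<bar> \<le> 1 / 4"
  shows "So n \<beta> u - So n \<beta> v = (u - v) * dSo n \<beta> u v"
proof -
  define O' where "O' = (u + v) * inverse (W2 u v)"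
  define P where "P = (\<lambda>u. \<Sum>i\<le>n. \<beta> i * om u ^ i)"
  define R where "R = (\<lambda>u. inverse ((1 - om u)\<^sup>2))"
  define S where "S = (\<Sum>i\<le>n. \<beta> i * (\<Sum>j<i. om v ^ (i - Suc j) * om u ^ j))"
  have o: "om u - om v = (u - v) * O'" unfolding O'_def by (rule om_diff[OF assms])
  have P: "P u - P v = (om u - om v) * S"
  proof -
    have "P u - P v = (\<Sum>i\<le>n. \<beta> i * (om u ^ i - om v ^ i))"
      by (simp add: P_def right_diff_distrib sum_subtractf)
    also have "\<dots> = (om u - om v) * S"
      unfolding S_def sum_distrib_left
      by (intro sum.cong refl) (simp add: power_diff_sumr2 sum_distrib_left mult_ac)
    finally show ?thesis .
  qed
  have nz: "1 - om u \<noteq> 0" "1 - om v \<noteq> 0" using om_small[OF assms(1)] om_small[OF assms(2)] by linarith+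
  have R: "R u - R v = (om u - om v) * ((2 - om u - om v) * R u * R v)"
  proof -
    have "R u - R v = R u * ((1 - om v)\<^sup>2 - (1 - om u)\<^sup>2) * R v"
      unfolding R_def using nz by (simp add: algebra_simps)
    also have "(1 - om v)\<^sup>2 - (1 - om u)\<^sup>2 = (om u - om v) * (2 - om u - om v)"
      by (simp add: power2_eq_square algebra_simps)
    finally show ?thesis by (simp add: mult_ac)
  qed
  have "So n \<beta> u - So n \<beta> v = u * P u * R u - v * P v * R v"
    by (simp add: So_def P_def R_def divide_inverse)
  also have "\<dots> = (u - v) * P u * R u + v * ((P u - P v) * R u + P v * (R u - R v))"
    by (simp add: algebra_simps)
  also have "\<dots> = (u - v) * (P u * R u + v * O' * (S * R u + P v * (2 - om u - om v) * R u * R v))"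
    unfolding P R o by (simp add: algebra_simps)
  also have "P u * R u + v * O' * (S * R u + P v * (2 - om u - om v) * R u * R v) = dSo n \<beta> u v"
    by (simp add: dSo_def P_def R_def S_def O'_def)
  finally show ?thesis .
qed

lemma jet_W2:
  assumes z: "jet N I z" and w: "jet N I w"
  shows "jet (Suc N) I (\<lambda>m r t. inverse (W2 (r * z m r t) (r * w m r t)))"
proof (rule jet_inverse[where \<delta> = "1/2"])
  note om = jet_om[OF z] jet_om[OF w]
  have "jet (Suc N) I (\<lambda>m r t. 1 - (om (r * z m r t) + om (r * w m r t)) +
      (om (r * z m r t) ^ 2 + om (r * z m r t) * om (r * w m r t) + om (r * w m r t) ^ 2) * (1 / 3))"
    by (intro jet_add jet_diff jet_mult jet_power jet_const om)
  then show "jet (Suc N) I (\<lambda>m r t. W2 (r * z m r t) (r * w m r t))" by (simp add: W2_def)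
  show "\<forall>\<^sub>0 r. \<forall>t\<in>I. 1 / 2 \<le> W2 (r * z m r t) (r * w m r t)" for m
  proof -
    have "\<forall>\<^sub>0 r. \<forall>t\<in>I. \<bar>r * z m r t\<bar> \<le> 1 / 4" "\<forall>\<^sub>0 r. \<forall>t\<in>I. \<bar>r * w m r t\<bar> \<le> 1 / 4"
      by (rule jet_r_small[OF z], simp) (rule jet_r_small[OF w], simp)
    then show ?thesis
    proof eventually_elim
      case (elim r)
      then show ?case by (intro ballI W2_ge) (blast)+
    qed
  qed
qed simp

lemma jet_dSo:
  assumes z: "jet N I z" and w: "jet N I w" and \<beta>: "\<And>m i. i \<le> n \<Longrightarrow> \<bar>\<beta> m i\<bar> \<le> B"
  shows "jet (Suc N) I (\<lambda>m r t. dSo n (\<beta> m) (r * z m r t) (r * w m r t))"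
proof -
  have b: "jet (Suc N) I (\<lambda>m r t. \<beta> m i)" if "i \<le> n" for i
    by (rule jet_bc, rule bdd_cont_param) (use \<beta> that in auto)
  show ?thesis
    unfolding dSo_def
    by (intro jet_add[of "Suc N"] jet_mult[of "Suc N"] jet_diff[of "Suc N"] jet_sum[of _ "Suc N"] jet_power[of "Suc N"] b jet_om jet_inv_1om jet_W2
          jet_const z w jet_r) auto
qed

text \<open>
  The right-hand side of the equation for $\ln r$ in terms of the angle $t$ measured from the axis
  $u = 0$, as a function of the value $x = \pm rQ$.
\<close>

definition phi :: "real \<Rightarrow> real \<Rightarrow> real" where
  "phi t x = (cos t)\<^sup>2 * x * inverse (1 - sin t * cos t * x)"

lemma phi_diff:
  assumes "1 - sin t * cos t * x \<noteq> 0" "1 - sin t * cos t * y \<noteq> 0"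
  shows "phi t x - phi t y =
    (cos t)\<^sup>2 * (x - y) * inverse (1 - sin t * cos t * x) * inverse (1 - sin t * cos t * y)"
proof -
  define E F where "E = inverse (1 - sin t * cos t * x)" "F = inverse (1 - sin t * cos t * y)"
  have E: "E * (1 - sin t * cos t * x) = 1" and F: "F * (1 - sin t * cos t * y) = 1"
    using assms by (auto simp: E_F_def)
  have "x * E - y * F = x * E * (F * (1 - sin t * cos t * y)) - y * F * (E * (1 - sin t * cos t * x))"
    unfolding E F by simp
  also have "\<dots> = (x - y) * E * F" by (simp add: algebra_simps)
  finally have *: "x * E - y * F = (x - y) * E * F" .
  have "phi t x - phi t y = (cos t)\<^sup>2 * (x * E - y * F)"
    by (simp add: phi_def E_F_def algebra_simps)
  then show ?thesis unfolding * by (simp add: E_F_def mult_ac)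
qed

lemma sin_cos_half: "\<bar>sin t * cos t\<bar> \<le> (1 / 2 :: real)"
  using abs_sin_le_one[of "2 * t"] by (simp add: sin_double abs_mult)

lemma denominator_bounds:
  fixes x :: real
  assumes "\<bar>x\<bar> \<le> 1" shows "1 / 2 \<le> 1 - sin t * cos t * x" "1 - sin t * cos t * x \<le> 3 / 2"
proof -
  have "\<bar>sin t * cos t * x\<bar> \<le> 1 / 2 * 1"
    unfolding abs_mult[of "sin t * cos t"] by (intro mult_mono sin_cos_half assms) auto
  then show "1 / 2 \<le> 1 - sin t * cos t * x" "1 - sin t * cos t * x \<le> 3 / 2" by linarith+
qed

lemma jet_fun:
  assumes "continuous_on {a..b::real} f"
  shows "jet N {a..b} (\<lambda>m r. f)"
proof -
  have "bounded (f ` {a..b})" using assms by (intro compact_imp_bounded compact_continuous_image) auto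
  then obtain K where "\<And>t. t \<in> {a..b} \<Longrightarrow> \<bar>f t\<bar> \<le> K" unfolding bounded_iff by fastforce
  then show ?thesis using assms by (intro jet_bc bdd_contI[where K = K]) auto
qed

section \<open>Comparing a half turn with its mirror image\<close>

text \<open>
  Here \<open>z\<close> and \<open>w\<close> stand for the arcs of one solution after and before it crosses
  the axis $u = 0$, the latter reflected in the axis; both are divided by the initial radius and
  parametrized by the angle $t$ from the axis, where they agree. They satisfy the same equation up to
  the sign of the even part \<open>Se\<close>. Hence $z - w$ solves a linear equation whose inhomogeneity
  is a linear combination of the coefficients \<open>\<alpha>\<close> of the even part, and variation of
  constants gives the asserted formula.
  The sign \<open>\<sigma>\<close> distinguishes the half axes $\theta = \pi/2$ and $\theta = 3\pi/2$.
\<close>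

lemma half_turn:
  fixes z w :: "'i \<Rightarrow> real \<Rightarrow> real \<Rightarrow> real" and \<alpha> \<beta> :: "'i \<Rightarrow> nat \<Rightarrow> real"
  assumes \<sigma>: "\<sigma> = 1 \<or> \<sigma> = (-1 :: real)"
    and \<alpha>0: "\<And>m. \<bar>\<alpha> m 0\<bar> \<le> 1 / 2"
    and \<alpha>: "\<And>m i. i \<le> n \<Longrightarrow> \<bar>\<alpha> m i\<bar> \<le> B"
    and \<beta>: "\<And>m i. i \<le> n \<Longrightarrow> \<bar>\<beta> m i\<bar> \<le> B"
    and z: "\<And>N. jet N {0..pi/2} z" and w: "\<And>N. jet N {0..pi/2} w"
    and pos: "\<kappa>0 > 0" "\<And>m. \<forall>\<^sub>0 r. \<forall>t\<in>{0..pi/2}. \<kappa>0 \<le> z m r t \<and> \<kappa>0 \<le> w m r t"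
    and init: "\<And>m. \<forall>\<^sub>0 r. z m r 0 = w m r 0"
    and ode: "\<And>m. \<forall>\<^sub>0 r. \<forall>t\<in>{0<..<pi/2}.
       (z m r has_real_derivative z m r t *
          phi t (Se n (\<alpha> m) (r * (z m r t * sin t)) - \<sigma> * So n (\<beta> m) (r * (z m r t * sin t)))) (at t) \<and>
       (w m r has_real_derivative w m r t *
          phi t (- Se n (\<alpha> m) (r * (w m r t * sin t)) - \<sigma> * So n (\<beta> m) (r * (w m r t * sin t)))) (at t)"
  obtains \<kappa> and c :: "nat \<Rightarrow> real" where "\<And>i N. jet N {0..pi/2} (\<kappa> i)"
    "\<And>i m. \<forall>\<^sub>0 r. c i \<le> \<kappa> i m r (pi/2)" "\<And>i. c i > 0"
    "\<And>m. \<forall>\<^sub>0 r. z m r (pi/2) - w m r (pi/2) =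
        (\<Sum>i\<le>n. \<alpha> m i * r ^ (2 * i) * \<kappa> i m r (pi/2))"
proof -
  let ?I = "{0..pi/2}"
  define zs where "zs = (\<lambda>m r t. z m r t * sin t)"
  define ws where "ws = (\<lambda>m r t. w m r t * sin t)"
  define x where "x = (\<lambda>m r t. Se n (\<alpha> m) (r * zs m r t) - \<sigma> * So n (\<beta> m) (r * zs m r t))"
  define y where "y = (\<lambda>m r t. - Se n (\<alpha> m) (r * ws m r t) - \<sigma> * So n (\<beta> m) (r * ws m r t))"
  define E where "E = (\<lambda>m r t. inverse (1 - sin t * cos t * x m r t))"
  define F where "F = (\<lambda>m r t. inverse (1 - sin t * cos t * y m r t))"
  define G where "G = (\<lambda>m r t. (cos t)\<^sup>2 * x m r t * E m r t -
    w m r t * (cos t)\<^sup>2 * \<sigma> * (r * sin t) * dSo n (\<beta> m) (r * zs m r t) (r * ws m r t) * E m r t * F m r t)"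
  define h where "h = (\<lambda>i m r t. w m r t * (cos t)\<^sup>2 * (zs m r t ^ (2 * i) * Y i (r * zs m r t) +
    ws m r t ^ (2 * i) * Y i (r * ws m r t)) * E m r t * F m r t)"
  \<comment> \<open>$(z-w)' = G\,(z-w) + \sum_i \alpha_i r^{2i} h_i$; $\mu$ is the integrating factor and $\nu$ its inverse\<close>
  define \<mu> where "\<mu> = (\<lambda>m r t. exp (integral {0..t} (\<lambda>t. - G m r t)))"
  define \<nu> where "\<nu> = (\<lambda>m r t. exp (integral {0..t} (G m r)))"
  define \<kappa> where "\<kappa> = (\<lambda>i m r t. \<nu> m r t * integral {0..t} (\<lambda>t. \<mu> m r t * h i m r t))"

  have zs: "jet N ?I zs" and ws: "jet N ?I ws" for N
    unfolding zs_def ws_def by (intro jet_mult z w jet_fun continuous_intros)+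
  have sc: "jet N ?I (\<lambda>m r t. sin t)" "jet N ?I (\<lambda>m r t. cos t)" for N
    by (intro jet_fun continuous_intros)+
  have x: "jet N ?I x" and y: "jet N ?I y" for N
    unfolding x_def y_def
    using jet_SucD[OF jet_Se[OF zs \<alpha>]] jet_SucD[OF jet_So[OF zs \<beta>]]
      jet_SucD[OF jet_Se[OF ws \<alpha>]] jet_SucD[OF jet_So[OF ws \<beta>]]
    by (auto intro!: jet_diff jet_minus jet_mult jet_const)

  have ev: "\<forall>\<^sub>0 r. (\<forall>t\<in>?I. \<bar>r * zs m r t\<bar> \<le> 1 / 4 \<and> \<bar>r * ws m r t\<bar> \<le> 1 / 4 \<and>
      \<bar>x m r t\<bar> \<le> 1 \<and> \<bar>y m r t\<bar> \<le> 1)" for m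
  proof -
    obtain \<delta> where \<delta>: "\<delta> > 0" "\<delta> \<le> 1 / 4"
      "\<And>u. \<bar>u\<bar> \<le> \<delta> \<Longrightarrow> \<bar>Se n (\<alpha> m) u\<bar> + \<bar>So n (\<beta> m) u\<bar> \<le> 1"
      using NN_small[of "\<alpha> m" n "\<beta> m", OF \<alpha>0] by metis
    from jet_r_small[OF zs \<delta>(1), of m] jet_r_small[OF ws \<delta>(1), of m] show ?thesis
    proof eventually_elim
      case (elim r)
      show ?case
      proof
        fix t assume "t \<in> ?I"
        with elim have *: "\<bar>r * zs m r t\<bar> \<le> \<delta>" "\<bar>r * ws m r t\<bar> \<le> \<delta>" by blast+
        then have "\<bar>x m r t\<bar> \<le> 1" "\<bar>y m r t\<bar> \<le> 1"
          using \<delta>(3)[OF *(1)] \<delta>(3)[OF *(2)] \<sigma> unfolding x_def y_def by (auto simp: abs_if split: if_splits)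
        with * \<delta>(2) show "\<bar>r * zs m r t\<bar> \<le> 1 / 4 \<and> \<bar>r * ws m r t\<bar> \<le> 1 / 4 \<and>
          \<bar>x m r t\<bar> \<le> 1 \<and> \<bar>y m r t\<bar> \<le> 1" by linarith
      qed
    qed
  qed

  have E: "jet N ?I E" for N
    unfolding E_def
  proof (rule jet_inverse[where \<delta> = "1 / 2"])
    show "jet N ?I (\<lambda>m r t. 1 - sin t * cos t * x m r t)"
      by (intro jet_diff jet_const jet_mult sc x)
    show "\<forall>\<^sub>0 r. \<forall>t\<in>?I. 1 / 2 \<le> 1 - sin t * cos t * x m r t" for m
      using ev[of m] by (rule eventually_mono) (blast intro: denominator_bounds)
  qed simp
  have F: "jet N ?I F" for N
    unfolding F_def
  proof (rule jet_inverse[where \<delta> = "1 / 2"])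
    show "jet N ?I (\<lambda>m r t. 1 - sin t * cos t * y m r t)"
      by (intro jet_diff jet_const jet_mult sc y)
    show "\<forall>\<^sub>0 r. \<forall>t\<in>?I. 1 / 2 \<le> 1 - sin t * cos t * y m r t" for m
      using ev[of m] by (rule eventually_mono) (blast intro: denominator_bounds)
  qed simp
  have G: "jet N ?I G" for N
    unfolding G_def
    by (intro jet_diff jet_mult jet_power jet_const sc x w E F jet_SucD[OF jet_r]
        jet_SucD[OF jet_dSo[OF zs ws \<beta>]]) assumption
  have h: "jet N ?I (h i)" for N i
    unfolding h_def by (intro jet_mult jet_power jet_add sc w zs ws jet_Y E F)
  have \<mu>: "jet N ?I \<mu>" and \<nu>: "jet N ?I \<nu>" for N
    unfolding \<mu>_def \<nu>_def by (intro jet_exp_integral jet_minus G)+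
  have \<kappa>: "jet N ?I (\<kappa> i)" for N i
    unfolding \<kappa>_def by (intro jet_mult jet_integral \<mu> \<nu> h)

  have hc: "\<forall>\<^sub>0 r. continuous_on ?I (h i m r)" for i m
    by (rule jet_continuous) (rule h)
  \<comment> \<open>a bound on $G$ that does not depend on the parameter, needed for the uniform lower bound of $\kappa$\<close>
  obtain K where K: "K > 0" "\<And>m. \<forall>\<^sub>0 r. \<forall>t\<in>?I. \<bar>G m r t\<bar> \<le> K"
    using jet_unif_bounded[OF G[of "Suc 0"]] by blast
  let ?e = "exp (- (K * (pi / 2)))"
  define J where "J = (\<lambda>i. integral ?I (\<lambda>t. (cos t)\<^sup>2 * (sin t) ^ (2 * i)))"
  define c where "c = (\<lambda>i. ?e * (?e * (\<kappa>0 ^ Suc (2 * i) * (4 / 9)) * J i))"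
  have J_pos: "J i > 0" for i
  proof -
    have "0 \<noteq> integral ?I (\<lambda>t. (cos t)\<^sup>2 * (sin t) ^ (2 * i))"
    proof
      assume "0 = integral ?I (\<lambda>t. (cos t)\<^sup>2 * (sin t) ^ (2 * i))"
      moreover have "continuous_on ?I (\<lambda>t. (cos t)\<^sup>2 * (sin t) ^ (2 * i))"
        by (intro continuous_intros)
      ultimately have "\<forall>t\<in>?I. (cos t)\<^sup>2 * (sin t) ^ (2 * i) = 0"
        using integral_eq_0_iff[of 0 "pi / 2" "\<lambda>t. (cos t)\<^sup>2 * (sin t) ^ (2 * i)"]
        by (simp add: power_mult)
      then have "(cos (pi / 4))\<^sup>2 * (sin (pi / 4)) ^ (2 * i) = 0"
        by (rule bspec) simp
      then show False by (simp add: cos_45 sin_45)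
    qed
    moreover have "0 \<le> J i"
      unfolding J_def by (intro integral_nonneg integrable_continuous_real continuous_intros) (auto simp: power_mult)
    ultimately show ?thesis by (simp add: J_def)
  qed
  have c: "c i > 0" for i
    unfolding c_def using J_pos pos(1) by (intro mult_pos_pos) auto

  have lower: "\<forall>\<^sub>0 r. c i \<le> \<kappa> i m r (pi/2)" for i m
    using ev[of m] K(2)[of m] pos(2)[of m] jet_continuous[OF G[of 0], of m] jet_continuous[OF \<mu>[of 0], of m]
      hc[of i m]
  proof eventually_elim
    case (elim r)
    have Gint: "\<bar>integral {0..t} (G m r)\<bar> \<le> K * (pi / 2)" if t: "t \<in> ?I" for t
    proof -
      have "norm (integral {0..t} (G m r)) \<le> K * (t - 0)"
        using t elim by (intro integral_bound) (force intro: continuous_on_subset)+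
      also have "\<dots> \<le> K * (pi / 2)" using t K(1) by (intro mult_left_mono) auto
      finally show ?thesis by simp
    qed
    have \<mu>_ge: "?e \<le> \<mu> m r t" if t: "t \<in> ?I" for t
      using Gint[OF t] by (simp add: \<mu>_def)
    have \<nu>_ge: "?e \<le> \<nu> m r (pi / 2)"
      using Gint[of "pi / 2"] by (simp add: \<nu>_def)
    have h_ge: "\<kappa>0 ^ Suc (2 * i) * (4 / 9) * ((cos t)\<^sup>2 * (sin t) ^ (2 * i)) \<le> h i m r t" if t: "t \<in> ?I" for t
    proof -
      have b: "\<bar>r * zs m r t\<bar> \<le> 1 / 4" "\<bar>r * ws m r t\<bar> \<le> 1 / 4" "\<bar>x m r t\<bar> \<le> 1" "\<bar>y m r t\<bar> \<le> 1"
        "\<kappa>0 \<le> z m r t" "\<kappa>0 \<le> w m r t"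
        using elim t by blast+
      have s: "sin t \<ge> 0" using t by (intro sin_ge_zero) auto
      have Yp: "1 / 2 \<le> Y i (r * zs m r t)" "1 / 2 \<le> Y i (r * ws m r t)"
        using om_small b Y_ge by blast+
      have "\<kappa>0 * sin t \<le> zs m r t" "\<kappa>0 * sin t \<le> ws m r t"
        unfolding zs_def ws_def by (intro mult_right_mono b s)+
      then have zw: "(\<kappa>0 * sin t) ^ (2 * i) \<le> zs m r t ^ (2 * i)" "(\<kappa>0 * sin t) ^ (2 * i) \<le> ws m r t ^ (2 * i)"
        using pos(1) s by (intro power_mono; simp)+
      have nn: "0 \<le> (\<kappa>0 * sin t) ^ (2 * i)" using pos(1) s by simp
      have "(\<kappa>0 * sin t) ^ (2 * i) * (1 / 2) + (\<kappa>0 * sin t) ^ (2 * i) * (1 / 2) \<le>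
          zs m r t ^ (2 * i) * Y i (r * zs m r t) + ws m r t ^ (2 * i) * Y i (r * ws m r t)"
        using zw Yp nn by (intro add_mono mult_mono) auto
      then have 1: "(\<kappa>0 * sin t) ^ (2 * i) \<le> zs m r t ^ (2 * i) * Y i (r * zs m r t) + ws m r t ^ (2 * i) * Y i (r * ws m r t)"
        by simp
      have EF: "2 / 3 \<le> E m r t" "2 / 3 \<le> F m r t"
        using denominator_bounds[OF b(3), of t] denominator_bounds[OF b(4), of t]
          le_imp_inverse_le[of "1 - sin t * cos t * x m r t" "3/2"] le_imp_inverse_le[of "1 - sin t * cos t * y m r t" "3/2"]
        unfolding E_def F_def by auto
      have "\<kappa>0 * (cos t)\<^sup>2 * (\<kappa>0 * sin t) ^ (2 * i) * (2 / 3) * (2 / 3) \<le> h i m r t"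
        unfolding h_def using b(6) 1 EF pos(1) nn s
        by (intro mult_mono') auto
      then show ?thesis by (simp add: power_mult_distrib mult_ac)
    qed
    have "?e * (\<kappa>0 ^ Suc (2 * i) * (4 / 9)) * J i =
      integral ?I (\<lambda>t. ?e * (\<kappa>0 ^ Suc (2 * i) * (4 / 9) * ((cos t)\<^sup>2 * (sin t) ^ (2 * i))))"
      unfolding J_def by (simp add: mult.assoc)
    also have "\<dots> \<le> integral ?I (\<lambda>t. \<mu> m r t * h i m r t)"
    proof (rule integral_le)
      show "(\<lambda>t. \<mu> m r t * h i m r t) integrable_on ?I"
        using elim by (intro integrable_continuous_real continuous_intros)
      fix t assume t: "t \<in> ?I"
      show "?e * (\<kappa>0 ^ Suc (2 * i) * (4 / 9) * ((cos t)\<^sup>2 * (sin t) ^ (2 * i))) \<le> \<mu> m r t * h i m r t"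
        using pos(1) by (intro mult_mono \<mu>_ge h_ge t) (auto simp: \<mu>_def power_mult)
    qed (intro integrable_continuous_real continuous_intros)
    finally have I: "?e * (\<kappa>0 ^ Suc (2 * i) * (4 / 9)) * J i \<le> integral ?I (\<lambda>t. \<mu> m r t * h i m r t)" .
    show ?case unfolding c_def \<kappa>_def
      using pos(1) J_pos[of i] by (intro mult_mono \<nu>_ge I) (auto simp: \<nu>_def)
  qed

  have id: "\<forall>\<^sub>0 r. z m r (pi/2) - w m r (pi/2) =
        (\<Sum>i\<le>n. \<alpha> m i * r ^ (2 * i) * \<kappa> i m r (pi/2))" for m
    using ev[of m] init[of m] ode[of m] jet_continuous[OF G[of 0], of m] jet_continuous[OF \<mu>[of 0], of m]
      eventually_ball_finite[OF finite_atMost[of n], of "\<lambda>r i. continuous_on ?I (h i m r)", OF ballI, OF hc]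
      jet_continuous[OF z[of 0], of m] jet_continuous[OF w[of 0], of m]
  proof eventually_elim
    case (elim r)
    define H where "H = (\<lambda>t. \<Sum>i\<le>n. \<alpha> m i * r ^ (2 * i) * (\<mu> m r t * h i m r t))"
    have "(H has_integral ((z m r (pi/2) - w m r (pi/2)) * \<mu> m r (pi/2) - (z m r 0 - w m r 0) * \<mu> m r 0)) ?I"
    proof (rule fundamental_theorem_of_calculus_interior)
      show "continuous_on ?I (\<lambda>t. (z m r t - w m r t) * \<mu> m r t)"
        using elim by (intro continuous_intros)
      fix t assume t: "t \<in> {0<..<pi/2}"
      then have tI: "t \<in> ?I" by auto
      have b: "\<bar>r * zs m r t\<bar> \<le> 1 / 4" "\<bar>r * ws m r t\<bar> \<le> 1 / 4" "\<bar>x m r t\<bar> \<le> 1" "\<bar>y m r t\<bar> \<le> 1"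
        using elim tI by blast+
      have dz: "(z m r has_real_derivative z m r t * phi t (x m r t)) (at t)"
       and dw: "(w m r has_real_derivative w m r t * phi t (y m r t)) (at t)"
        using elim t by (auto simp: x_def y_def zs_def ws_def)
      have "((\<lambda>t. integral {0..t} (\<lambda>t. - G m r t)) has_real_derivative - G m r t) (at t within ?I)"
        using elim tI by (intro integral_has_real_derivative continuous_intros)
      then have "((\<lambda>t. integral {0..t} (\<lambda>t. - G m r t)) has_real_derivative - G m r t) (at t)"
        using t by (simp add: at_within_Icc_at)
      from DERIV_chain2[OF DERIV_exp this]
      have d\<mu>: "(\<mu> m r has_real_derivative \<mu> m r t * - G m r t) (at t)" by (simp add: \<mu>_def)
      have nz: "1 - sin t * cos t * x m r t \<noteq> 0" "1 - sin t * cos t * y m r t \<noteq> 0"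
        using denominator_bounds[OF b(3), of t] denominator_bounds[OF b(4), of t] by linarith+
      have xy: "x m r t - y m r t = (Se n (\<alpha> m) (r * zs m r t) + Se n (\<alpha> m) (r * ws m r t)) -
          \<sigma> * ((r * sin t) * (z m r t - w m r t) * dSo n (\<beta> m) (r * zs m r t) (r * ws m r t))"
      proof -
        have "So n (\<beta> m) (r * zs m r t) - So n (\<beta> m) (r * ws m r t) =
            (r * sin t) * (z m r t - w m r t) * dSo n (\<beta> m) (r * zs m r t) (r * ws m r t)"
          unfolding So_diff[OF b(1,2)] by (simp add: zs_def ws_def algebra_simps)
        from this[symmetric] show ?thesis
          unfolding x_def y_def by (simp only:) (simp add: algebra_simps)
      qed
      have S: "w m r t * (cos t)\<^sup>2 * (Se n (\<alpha> m) (r * zs m r t) + Se n (\<alpha> m) (r * ws m r t)) * E m r t * F m r t =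
          (\<Sum>i\<le>n. \<alpha> m i * r ^ (2 * i) * h i m r t)"
        unfolding Se_Y h_def sum.distrib[symmetric] sum_distrib_left sum_distrib_right
        by (intro sum.cong refl) (simp add: power_mult_distrib algebra_simps)
      have "z m r t * phi t (x m r t) - w m r t * phi t (y m r t) =
          (z m r t - w m r t) * phi t (x m r t) + w m r t * (phi t (x m r t) - phi t (y m r t))"
        by (simp add: algebra_simps)
      also have "\<dots> = (z m r t - w m r t) * G m r t +
          w m r t * (cos t)\<^sup>2 * (Se n (\<alpha> m) (r * zs m r t) + Se n (\<alpha> m) (r * ws m r t)) * E m r t * F m r t"
        unfolding phi_diff[OF nz] xy unfolding phi_def G_def E_def[symmetric] F_def[symmetric]
        by (simp add: E_def F_def algebra_simps)
      finally have D: "z m r t * phi t (x m r t) - w m r t * phi t (y m r t) =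
          (z m r t - w m r t) * G m r t + (\<Sum>i\<le>n. \<alpha> m i * r ^ (2 * i) * h i m r t)"
        unfolding S .
      have "((\<lambda>t. (z m r t - w m r t) * \<mu> m r t) has_real_derivative
          (z m r t * phi t (x m r t) - w m r t * phi t (y m r t)) * \<mu> m r t +
          (\<mu> m r t * - G m r t) * (z m r t - w m r t)) (at t)"
        by (intro DERIV_mult DERIV_diff dz dw d\<mu>)
      also have "(z m r t * phi t (x m r t) - w m r t * phi t (y m r t)) * \<mu> m r t +
          (\<mu> m r t * - G m r t) * (z m r t - w m r t) = (\<Sum>i\<le>n. \<alpha> m i * r ^ (2 * i) * h i m r t) * \<mu> m r t"
        unfolding D by (simp add: algebra_simps)
      also have "\<dots> = H t"
        by (simp add: H_def sum_distrib_left mult_ac)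
      finally show "((\<lambda>t. (z m r t - w m r t) * \<mu> m r t) has_vector_derivative H t) (at t)"
        by (simp add: has_real_derivative_iff_has_vector_derivative)
    qed simp
    then have "(z m r (pi/2) - w m r (pi/2)) * \<mu> m r (pi/2) = integral ?I H"
      using elim(2) by (simp add: integral_unique)
    also have "\<dots> = (\<Sum>i\<le>n. \<alpha> m i * r ^ (2 * i) * integral ?I (\<lambda>t. \<mu> m r t * h i m r t))"
      unfolding H_def
    proof (subst integral_sum)
      show "(\<lambda>t. \<alpha> m i * r ^ (2 * i) * (\<mu> m r t * h i m r t)) integrable_on ?I" if "i \<in> {..n}" for i
        using elim that by (intro integrable_continuous_real continuous_intros) auto
    qed auto
    finally have eq: "(z m r (pi/2) - w m r (pi/2)) * \<mu> m r (pi/2) =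
      (\<Sum>i\<le>n. \<alpha> m i * r ^ (2 * i) * integral ?I (\<lambda>t. \<mu> m r t * h i m r t))" .
    have "\<mu> m r (pi/2) * \<nu> m r (pi/2) = 1" by (simp add: \<mu>_def \<nu>_def flip: exp_add)
    then have "z m r (pi/2) - w m r (pi/2) = (z m r (pi/2) - w m r (pi/2)) * (\<mu> m r (pi/2) * \<nu> m r (pi/2))"
      by simp
    also have "\<dots> = ((z m r (pi/2) - w m r (pi/2)) * \<mu> m r (pi/2)) * \<nu> m r (pi/2)" by simp
    also have "\<dots> = (\<Sum>i\<le>n. \<alpha> m i * r ^ (2 * i) * \<kappa> i m r (pi/2))"
      unfolding eq \<kappa>_def sum_distrib_right by (intro sum.cong refl) (simp add: mult_ac)
    finally show ?case .
  qed
  show ?thesis using that[OF \<kappa> lower c id] .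
qed

section \<open>The return map at the origin\<close>

text \<open>
  The solution of $f' = f\psi$, where the equation may fail at finitely many points.
\<close>

lemma exp_formula:
  fixes f \<psi> :: "real \<Rightarrow> real"
  assumes "0 \<le> x" "continuous_on {0..x} f" "continuous_on {0..x} \<psi>" "finite S"
    "\<And>t. t \<in> {0<..<x} - S \<Longrightarrow> (f has_real_derivative f t * \<psi> t) (at t)"
  shows "f x = f 0 * exp (integral {0..x} \<psi>)"
proof -
  define g where "g = (\<lambda>t. f t * exp (- integral {0..t} \<psi>))"
  have "((\<lambda>t. 0) has_integral (g x - g 0)) {0..x}"
  proof (rule fundamental_theorem_of_calculus_interior_strong[OF assms(4,1)])
    show "continuous_on {0..x} g"
      unfolding g_def
      by (intro continuous_intros assms indefinite_integral_continuous_1 integrable_continuous_real)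
    fix t assume t: "t \<in> {0<..<x} - S"
    have "((\<lambda>t. integral {0..t} \<psi>) has_real_derivative \<psi> t) (at t within {0..x})"
      using t assms(3) by (intro integral_has_real_derivative) auto
    then have d: "((\<lambda>t. integral {0..t} \<psi>) has_real_derivative \<psi> t) (at t)"
      using t by (simp add: at_within_Icc_at)
    have "(g has_real_derivative f t * \<psi> t * exp (- integral {0..t} \<psi>) +
        exp (- integral {0..t} \<psi>) * - \<psi> t * f t) (at t)"
      unfolding g_def by (intro DERIV_mult assms(5) t DERIV_chain2[OF DERIV_exp] DERIV_minus d)
    then show "(g has_vector_derivative 0) (at t)"
      by (simp add: has_real_derivative_iff_has_vector_derivative algebra_simps)
  qed
  then have "g x = g 0" using has_integral_unique[of "\<lambda>t. 0 :: real" "g x - g 0" "{0..x}" 0] by simp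
  then show ?thesis by (simp add: g_def exp_minus field_simps)
qed

lemma cos_zero_cases:
  assumes "0 < \<theta>" "\<theta> < 2 * pi" "cos \<theta> = 0"
  shows "\<theta> \<in> {pi / 2, 3 * pi / 2}"
proof (cases "\<theta> \<le> pi")
  case True
  then have "\<theta> = pi / 2" using assms by - (rule cos_inj_pi, auto)
  then show ?thesis by simp
next
  case False
  have "cos (\<theta> - pi) = cos (pi / 2)" using assms by (simp add: cos_diff)
  then have "\<theta> - pi = pi / 2" using False assms by - (rule cos_inj_pi, auto)
  then show ?thesis by simp
qed

text \<open>
  The value of $rQ$ at $u = r\cos\theta$, including $u = 0$.
\<close>

definition NN :: "nat \<Rightarrow> (nat \<Rightarrow> real) \<Rightarrow> (nat \<Rightarrow> real) \<Rightarrow> real \<Rightarrow> real" where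
  "NN n \<alpha> \<beta> u = Se n \<alpha> u + So n \<beta> u"

text \<open>
  The logarithmic derivative of the radius along a solution of the polar equation. Unlike the quotient
  in \<open>polar_solution\<close> it is continuous across the angles with $\cos\theta = 0$.
\<close>

definition psi :: "nat \<Rightarrow> (nat \<Rightarrow> real) \<Rightarrow> (nat \<Rightarrow> real) \<Rightarrow> real \<Rightarrow> real \<Rightarrow> real" where
  "psi n \<alpha> \<beta> \<rho> \<theta> = (sin \<theta>)\<^sup>2 * NN n \<alpha> \<beta> (\<rho> * cos \<theta>) *
     inverse (1 + sin \<theta> * cos \<theta> * NN n \<alpha> \<beta> (\<rho> * cos \<theta>))"

lemma cos_square_bound: "3 * \<rho>\<^sup>2 < 1 \<Longrightarrow> 3 * (\<rho> * cos \<theta>)\<^sup>2 < (1 :: real)"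
proof -
  assume "3 * \<rho>\<^sup>2 < 1"
  moreover have "\<rho>\<^sup>2 * (cos \<theta>)\<^sup>2 \<le> \<rho>\<^sup>2 * 1"
    by (intro mult_left_mono) (auto simp: cos_squared_eq)
  ultimately show ?thesis by (simp add: power_mult_distrib)
qed

lemma polar_ode:
  assumes sol: "polar_solution n a b \<epsilon>a \<epsilon>b \<rho>"
  defines "\<alpha> \<equiv> \<lambda>i. \<epsilon>a * a i" and "\<beta> \<equiv> \<lambda>i. \<epsilon>b * b i"
  shows "\<theta> \<in> {0..2*pi} \<Longrightarrow> 1 + sin \<theta> * cos \<theta> * NN n \<alpha> \<beta> (\<rho> \<theta> * cos \<theta>) > 0"
    and "\<theta> \<in> {0<..<2*pi} \<Longrightarrow> cos \<theta> \<noteq> 0 \<Longrightarrow>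
      (\<rho> has_real_derivative \<rho> \<theta> * psi n \<alpha> \<beta> (\<rho> \<theta>) \<theta>) (at \<theta>)"
    and "continuous_on {0..2*pi} (\<lambda>\<theta>. psi n \<alpha> \<beta> (\<rho> \<theta>) \<theta>)"
    and "\<theta> \<in> {0..2*pi} \<Longrightarrow> \<rho> \<theta> = \<rho> 0 * exp (integral {0..\<theta>} (\<lambda>\<theta>. psi n \<alpha> \<beta> (\<rho> \<theta>) \<theta>))"
proof -
  have cont: "continuous_on {0..2*pi} \<rho>" and pos: "\<And>\<theta>. \<theta> \<in> {0..2*pi} \<Longrightarrow> 0 < \<rho> \<theta> \<and> 3 * (\<rho> \<theta>)\<^sup>2 < 1"
    using sol by (auto simp: polar_solution_def)
  have Q: "\<rho> \<theta> * Q_fun n a b \<epsilon>a \<epsilon>b (\<rho> \<theta>) \<theta> = NN n \<alpha> \<beta> (\<rho> \<theta> * cos \<theta>)"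
    if "\<theta> \<in> {0..2*pi}" "cos \<theta> \<noteq> 0" for \<theta>
    using Q_fun_eq[of "\<rho> \<theta>" \<theta> n a b \<epsilon>a \<epsilon>b] pos[OF that(1)] that(2) by (simp add: NN_def \<alpha>_def \<beta>_def)
  have D: "1 + sin \<theta> * cos \<theta> * NN n \<alpha> \<beta> (\<rho> \<theta> * cos \<theta>) > 0" if t: "\<theta> \<in> {0..2*pi}" for \<theta>
  proof (cases "cos \<theta> = 0")
    case False
    then have "1 + \<rho> \<theta> * sin \<theta> * cos \<theta> * Q_fun n a b \<epsilon>a \<epsilon>b (\<rho> \<theta>) \<theta> > 0"
      using sol t by (auto simp: polar_solution_def Let_def)
    then show ?thesis unfolding Q[OF t False, symmetric] by (simp add: mult_ac)
  qed simp
  then show "\<theta> \<in> {0..2*pi} \<Longrightarrow> 1 + sin \<theta> * cos \<theta> * NN n \<alpha> \<beta> (\<rho> \<theta> * cos \<theta>) > 0" .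
  have der: "(\<rho> has_real_derivative \<rho> \<theta> * psi n \<alpha> \<beta> (\<rho> \<theta>) \<theta>) (at \<theta>)"
    if t: "\<theta> \<in> {0<..<2*pi}" "cos \<theta> \<noteq> 0" for \<theta>
  proof -
    have t': "\<theta> \<in> {0..2*pi}" using t by auto
    have "(\<rho> has_real_derivative (\<rho> \<theta>)\<^sup>2 * (sin \<theta>)\<^sup>2 * Q_fun n a b \<epsilon>a \<epsilon>b (\<rho> \<theta>) \<theta> /
        (1 + \<rho> \<theta> * sin \<theta> * cos \<theta> * Q_fun n a b \<epsilon>a \<epsilon>b (\<rho> \<theta>) \<theta>)) (at \<theta> within {0..2*pi})"
      using sol t' t(2) by (auto simp: polar_solution_def Let_def)
    moreover have "(\<rho> \<theta>)\<^sup>2 * (sin \<theta>)\<^sup>2 * Q_fun n a b \<epsilon>a \<epsilon>b (\<rho> \<theta>) \<theta> /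
        (1 + \<rho> \<theta> * sin \<theta> * cos \<theta> * Q_fun n a b \<epsilon>a \<epsilon>b (\<rho> \<theta>) \<theta>) = \<rho> \<theta> * psi n \<alpha> \<beta> (\<rho> \<theta>) \<theta>"
      unfolding psi_def Q[OF t' t(2), symmetric] by (simp add: divide_inverse power2_eq_square mult_ac)
    ultimately show ?thesis using t(1) by (simp add: at_within_Icc_at)
  qed
  then show "\<theta> \<in> {0<..<2*pi} \<Longrightarrow> cos \<theta> \<noteq> 0 \<Longrightarrow>
      (\<rho> has_real_derivative \<rho> \<theta> * psi n \<alpha> \<beta> (\<rho> \<theta>) \<theta>) (at \<theta>)" .
  show c: "continuous_on {0..2*pi} (\<lambda>\<theta>. psi n \<alpha> \<beta> (\<rho> \<theta>) \<theta>)"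
    unfolding psi_def NN_def using pos cos_square_bound D
    by (intro continuous_intros cont ballI) (force simp: NN_def)+
  assume t: "\<theta> \<in> {0..2*pi}"
  show "\<rho> \<theta> = \<rho> 0 * exp (integral {0..\<theta>} (\<lambda>\<theta>. psi n \<alpha> \<beta> (\<rho> \<theta>) \<theta>))"
  proof (rule exp_formula)
    show "continuous_on {0..\<theta>} \<rho>" "continuous_on {0..\<theta>} (\<lambda>\<theta>. psi n \<alpha> \<beta> (\<rho> \<theta>) \<theta>)"
      using t by (auto intro: continuous_on_subset[OF cont] continuous_on_subset[OF c])
    show "finite {pi / 2, 3 * pi / 2}" by simp
    fix s assume s: "s \<in> {0<..<\<theta>} - {pi / 2, 3 * pi / 2}"
    then show "(\<rho> has_real_derivative \<rho> s * psi n \<alpha> \<beta> (\<rho> s) s) (at s)"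
      using t cos_zero_cases[of s] by (intro der) auto
  qed (use t in auto)
qed

lemma psi_bound:
  assumes "\<bar>NN n \<alpha> \<beta> (\<rho> * cos \<theta>)\<bar> \<le> 1"
  shows "\<bar>psi n \<alpha> \<beta> \<rho> \<theta>\<bar> \<le> 2" "1 / 2 \<le> 1 + sin \<theta> * cos \<theta> * NN n \<alpha> \<beta> (\<rho> * cos \<theta>)"
proof -
  show D: "1 / 2 \<le> 1 + sin \<theta> * cos \<theta> * NN n \<alpha> \<beta> (\<rho> * cos \<theta>)"
    using denominator_bounds(1)[of "- NN n \<alpha> \<beta> (\<rho> * cos \<theta>)" \<theta>] assms by simp
  have "\<bar>psi n \<alpha> \<beta> \<rho> \<theta>\<bar> = (sin \<theta>)\<^sup>2 * \<bar>NN n \<alpha> \<beta> (\<rho> * cos \<theta>)\<bar> *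
      inverse (1 + sin \<theta> * cos \<theta> * NN n \<alpha> \<beta> (\<rho> * cos \<theta>))"
    using D by (simp add: psi_def abs_mult)
  also have "\<dots> \<le> 1 * 1 * 2"
    using D assms le_imp_inverse_le[OF D] by (intro mult_mono) (auto simp: sin_squared_eq)
  finally show "\<bar>psi n \<alpha> \<beta> \<rho> \<theta>\<bar> \<le> 2" by simp
qed

text \<open>
  An a priori bound: a solution with small initial radius stays so small during the whole turn that
  $|rQ| \le 1$.
\<close>

lemma polar_bound:
  assumes sol: "polar_solution n a b \<epsilon>a \<epsilon>b \<rho>"
  defines "\<alpha> \<equiv> \<lambda>i. \<epsilon>a * a i" and "\<beta> \<equiv> \<lambda>i. \<epsilon>b * b i"
  assumes \<delta>: "\<And>u. \<bar>u\<bar> \<le> \<delta> \<Longrightarrow> \<bar>NN n \<alpha> \<beta> u\<bar> \<le> 1" and small: "\<rho> 0 * exp (4 * pi) < \<delta>"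
    and \<theta>: "\<theta> \<in> {0..2*pi}"
  shows "\<bar>NN n \<alpha> \<beta> (\<rho> \<theta> * cos \<theta>)\<bar> \<le> 1"
    and "\<rho> 0 * exp (- (4 * pi)) \<le> \<rho> \<theta>" "\<rho> \<theta> \<le> \<rho> 0 * exp (4 * pi)"
proof -
  have cont: "continuous_on {0..2*pi} \<rho>" and pos: "\<And>\<theta>. \<theta> \<in> {0..2*pi} \<Longrightarrow> 0 < \<rho> \<theta>"
    using sol by (auto simp: polar_solution_def)
  have N: "\<bar>NN n \<alpha> \<beta> (\<rho> t * cos t)\<bar> \<le> 1" if "t \<in> {0..2*pi}" "\<rho> t \<le> \<delta>" for t
  proof (rule \<delta>)
    have "\<bar>\<rho> t * cos t\<bar> \<le> \<rho> t * 1"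
      using pos[OF that(1)] unfolding abs_mult by (intro mult_mono) auto
    then show "\<bar>\<rho> t * cos t\<bar> \<le> \<delta>" using that by simp
  qed
  have I: "\<bar>integral {0..x} (\<lambda>\<theta>. psi n \<alpha> \<beta> (\<rho> \<theta>) \<theta>)\<bar> \<le> 4 * pi"
    if x: "x \<in> {0..2*pi}" and *: "\<And>t. t \<in> {0..x} \<Longrightarrow> \<rho> t \<le> \<delta>" for x
  proof -
    have "norm (integral {0..x} (\<lambda>\<theta>. psi n \<alpha> \<beta> (\<rho> \<theta>) \<theta>)) \<le> 2 * (x - 0)"
    proof (rule integral_bound)
      show "continuous_on {0..x} (\<lambda>\<theta>. psi n \<alpha> \<beta> (\<rho> \<theta>) \<theta>)"
        using continuous_on_subset[OF polar_ode(3)[OF sol]] x by (auto simp: \<alpha>_def \<beta>_def)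
      show "norm (psi n \<alpha> \<beta> (\<rho> t) t) \<le> 2" if "t \<in> {0..x}" for t
        using psi_bound(1)[OF N] * that x by auto
    qed (use x in auto)
    then show ?thesis using x by simp
  qed
  have formula: "\<rho> x = \<rho> 0 * exp (integral {0..x} (\<lambda>\<theta>. psi n \<alpha> \<beta> (\<rho> \<theta>) \<theta>))" if "x \<in> {0..2*pi}" for x
    using polar_ode(4)[OF sol that] by (simp add: \<alpha>_def \<beta>_def)
  have r: "\<rho> 0 > 0" using pos by simp
  have "\<rho> 0 * 1 \<le> \<rho> 0 * exp (4 * pi)" using r by (intro mult_left_mono) auto
  then have r\<delta>: "\<rho> 0 < \<delta>" using small by linarith
  have less: "\<rho> t < \<delta>" if t: "t \<in> {0..2*pi}" for t
  proof (rule ccontr)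
    assume "\<not> \<rho> t < \<delta>"
    \<comment> \<open>at the first time when the radius reaches $\delta$, the growth bound still holds and excludes this value\<close>
    define S where "S = {s \<in> {0..2*pi}. \<delta> \<le> \<rho> s}"
    have "S = {0..2*pi} \<inter> \<rho> -` {\<delta>..}" by (auto simp: S_def)
    then have "closed S" using continuous_closed_preimage[OF cont] by simp
    moreover have "S \<noteq> {}" using t \<open>\<not> \<rho> t < \<delta>\<close> by (auto simp: S_def)
    moreover have bdd: "bdd_below S" by (auto simp: S_def intro!: bdd_belowI[of _ 0])
    ultimately have "Inf S \<in> S" by (intro closed_contains_Inf)
    then have x: "Inf S \<in> {0..2*pi}" "\<delta> \<le> \<rho> (Inf S)" by (auto simp: S_def)
    have below: "\<rho> s < \<delta>" if "s \<in> {0..<Inf S}" for s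
      using cInf_lower[OF _ bdd, of s] that x(1) by (force simp: S_def)
    have "continuous_on {0..Inf S} \<rho>" using x(1) by (intro continuous_on_subset[OF cont]) auto
    then obtain y where y: "0 \<le> y" "y \<le> Inf S" "\<rho> y = \<delta>"
      using IVT'[of \<rho> 0 \<delta> "Inf S"] x r\<delta> by auto
    then have "y = Inf S" using below[of y] by force
    then have "\<rho> s \<le> \<delta>" if "s \<in> {0..Inf S}" for s
      using below[of s] y(3) that by (cases "s = Inf S") auto
    then have "\<bar>integral {0..Inf S} (\<lambda>\<theta>. psi n \<alpha> \<beta> (\<rho> \<theta>) \<theta>)\<bar> \<le> 4 * pi" by (intro I x(1))
    then have "\<rho> (Inf S) \<le> \<rho> 0 * exp (4 * pi)" using r by (subst formula[OF x(1)]) simp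
    then show False using small x(2) by simp
  qed
  show "\<bar>NN n \<alpha> \<beta> (\<rho> \<theta> * cos \<theta>)\<bar> \<le> 1" using N[OF \<theta>] less[OF \<theta>] by simp
  have *: "\<bar>integral {0..\<theta>} (\<lambda>\<theta>. psi n \<alpha> \<beta> (\<rho> \<theta>) \<theta>)\<bar> \<le> 4 * pi"
    using \<theta> less by (intro I) (auto intro: less_imp_le)
  then show "\<rho> 0 * exp (- (4 * pi)) \<le> \<rho> \<theta>" "\<rho> \<theta> \<le> \<rho> 0 * exp (4 * pi)"
    using r by (subst formula[OF \<theta>]; simp)+
qed

lemma jet_NN:
  assumes z: "jet N I z" and "\<And>m i. i \<le> n \<Longrightarrow> \<bar>\<alpha> m i\<bar> \<le> B" "\<And>m i. i \<le> n \<Longrightarrow> \<bar>\<beta> m i\<bar> \<le> B"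
  shows "jet (Suc N) I (\<lambda>m r t. NN n (\<alpha> m) (\<beta> m) (r * z m r t))"
  unfolding NN_def by (rule jet_add[OF jet_Se[OF z assms(2)] jet_So[OF z assms(3)]])

text \<open>
  The expansion of the displacement. The normalized radius \<open>w\<close> satisfies
  $w = \exp\int\psi$, where $\psi$ is a function of $r w$; each use of this equation yields one more
  coefficient. Then \<open>half_turn\<close> is applied on both sides of $\theta = \pi/2$ and of
  $\theta = 3\pi/2$, which covers the turn from $0$ to $2\pi$.
\<close>

lemma displacement_expansion:
  fixes \<rho> :: "'i \<Rightarrow> real \<Rightarrow> real \<Rightarrow> real" and a b :: "'i \<Rightarrow> nat \<Rightarrow> real" and \<epsilon>a \<epsilon>b :: "'i \<Rightarrow> real"
  assumes sol: "\<And>m. \<forall>\<^sub>0 r. polar_solution n (a m) (b m) (\<epsilon>a m) (\<epsilon>b m) (\<rho> m r) \<and> \<rho> m r 0 = r"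
    and a0: "\<And>m. \<bar>\<epsilon>a m * a m 0\<bar> \<le> 1 / 2"
    and a: "\<And>m i. i \<le> n \<Longrightarrow> \<bar>\<epsilon>a m * a m i\<bar> \<le> B"
    and b: "\<And>m i. i \<le> n \<Longrightarrow> \<bar>\<epsilon>b m * b m i\<bar> \<le> B"
  obtains \<kappa> :: "nat \<Rightarrow> 'i \<Rightarrow> real \<Rightarrow> real \<Rightarrow> real" and c :: "nat \<Rightarrow> real" where "\<And>i N. jet N {0..pi/2} (\<kappa> i)"
    "\<And>i m. \<forall>\<^sub>0 r. c i \<le> \<kappa> i m r (pi/2)" "\<And>i. c i > 0"
    "\<And>m. \<forall>\<^sub>0 r. \<rho> m r (2*pi) - r =
        r * (\<Sum>i\<le>n. \<epsilon>a m * a m i * r ^ (2 * i) * \<kappa> i m r (pi/2))"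
proof -
  define \<alpha> where "\<alpha> = (\<lambda>m i. \<epsilon>a m * a m i)"
  define \<beta> where "\<beta> = (\<lambda>m i. \<epsilon>b m * b m i)"
  have \<alpha>: "\<bar>\<alpha> m i\<bar> \<le> B" and \<beta>: "\<bar>\<beta> m i\<bar> \<le> B" if "i \<le> n" for m i
    using a b that by (auto simp: \<alpha>_def \<beta>_def)
  let ?I = "{0..2*pi}"
  define w where "w = (\<lambda>m r \<theta>. \<rho> m r \<theta> / r)"
  let ?U = "\<lambda>m r \<theta>. NN n (\<alpha> m) (\<beta> m) (r * (w m r \<theta> * cos \<theta>))"
  define \<psi> where "\<psi> = (\<lambda>m r \<theta>. psi n (\<alpha> m) (\<beta> m) (\<rho> m r \<theta>) \<theta>)"
  have ev: "\<forall>\<^sub>0 r. r > 0 \<and> polar_solution n (a m) (b m) (\<epsilon>a m) (\<epsilon>b m) (\<rho> m r) \<and> \<rho> m r 0 = r \<and>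
     (\<forall>\<theta>\<in>?I. \<bar>?U m r \<theta>\<bar> \<le> 1 \<and>
       exp (- (4 * pi)) \<le> w m r \<theta> \<and> w m r \<theta> \<le> exp (4 * pi)) \<and>
     \<psi> m r = (\<lambda>\<theta>. (sin \<theta>)\<^sup>2 * ?U m r \<theta> *
         inverse (1 + sin \<theta> * cos \<theta> * ?U m r \<theta>)) \<and>
     (\<forall>\<theta>\<in>?I. w m r \<theta> = exp (integral {0..\<theta>} (\<psi> m r)))" for m
  proof -
    have "\<bar>\<alpha> m 0\<bar> \<le> 1 / 2" using a0 by (simp add: \<alpha>_def)
    from NN_small[of "\<alpha> m" n "\<beta> m", OF this] obtain \<delta> where \<delta>: "\<delta> > 0"
      "\<And>u. \<bar>u\<bar> \<le> \<delta> \<Longrightarrow> \<bar>Se n (\<alpha> m) u\<bar> + \<bar>So n (\<beta> m) u\<bar> \<le> 1" by blast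
    have \<delta>': "\<bar>NN n (\<alpha> m) (\<beta> m) u\<bar> \<le> 1" if "\<bar>u\<bar> \<le> \<delta>" for u
      using \<delta>(2)[OF that] unfolding NN_def by linarith
    show ?thesis using sol[of m] eventually_small[OF \<delta>(1), of "exp (4 * pi)"]
    proof eventually_elim
      case (elim r)
      then have s: "polar_solution n (a m) (b m) (\<epsilon>a m) (\<epsilon>b m) (\<rho> m r)" and r0: "\<rho> m r 0 = r"
        and r: "r > 0" and small: "\<rho> m r 0 * exp (4 * pi) < \<delta>" by auto
      have u: "\<rho> m r \<theta> * cos \<theta> = r * (w m r \<theta> * cos \<theta>)" for \<theta> using r by (simp add: w_def)
      have fold: "(\<lambda>i. \<epsilon>a m * a m i) = \<alpha> m" "(\<lambda>i. \<epsilon>b m * b m i) = \<beta> m"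
        by (simp_all add: \<alpha>_def \<beta>_def)
      note pb = polar_bound[OF s, unfolded fold, of \<delta>, OF \<delta>' small]
      have "\<bar>?U m r \<theta>\<bar> \<le> 1 \<and>
         exp (- (4 * pi)) \<le> w m r \<theta> \<and> w m r \<theta> \<le> exp (4 * pi)" if "\<theta> \<in> ?I" for \<theta>
        using pb[OF _ that] r unfolding u r0 by (simp add: w_def field_simps)
      moreover have "w m r \<theta> = exp (integral {0..\<theta>} (\<psi> m r))" if "\<theta> \<in> ?I" for \<theta>
        using polar_ode(4)[OF s that] r unfolding r0 by (simp add: w_def \<psi>_def \<alpha>_def \<beta>_def)
      ultimately show ?case using s r0 r by (auto simp: \<psi>_def psi_def u)
    qed
  qed

  have cos: "jet N ?I (\<lambda>m r t. cos t)" and sin: "jet N ?I (\<lambda>m r t. sin t)" for N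
    by (intro jet_fun continuous_intros)+
  have step: "jet (Suc N) ?I \<psi>" if w: "jet N ?I w" for N
  proof -
    note NN = jet_NN[of N ?I "\<lambda>m r t. w m r t * cos t" n \<alpha> B \<beta>, OF jet_mult[OF w cos] \<alpha> \<beta>]
    have "jet (Suc N) ?I (\<lambda>m r \<theta>. inverse (1 + sin \<theta> * cos \<theta> * ?U m r \<theta>))"
    proof (rule jet_inverse[where \<delta> = "1 / 2"])
      show "jet (Suc N) ?I (\<lambda>m r \<theta>. 1 + sin \<theta> * cos \<theta> * ?U m r \<theta>)"
        by (rule jet_add[OF jet_const jet_mult[OF jet_mult[OF sin cos] NN]])
      show "\<forall>\<^sub>0 r. \<forall>\<theta>\<in>?I. 1 / 2 \<le> 1 + sin \<theta> * cos \<theta> * ?U m r \<theta>" for m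
        using ev[of m]
      proof eventually_elim
        case (elim r)
        show ?case
        proof
          fix \<theta> assume "\<theta> \<in> ?I"
          with elim have "\<bar>?U m r \<theta>\<bar> \<le> 1" by blast
          then have "\<bar>NN n (\<alpha> m) (\<beta> m) (r * w m r \<theta> * cos \<theta>)\<bar> \<le> 1" by (simp only: mult.assoc)
          from psi_bound(2)[OF this]
          show "1 / 2 \<le> 1 + sin \<theta> * cos \<theta> * ?U m r \<theta>"
            by (simp only: mult.assoc)
        qed
      qed
    qed simp
    from jet_mult[OF jet_mult[OF jet_power[OF sin] NN] this]
    have "jet (Suc N) ?I (\<lambda>m r \<theta>. (sin \<theta>)\<^sup>2 * ?U m r \<theta> *
         inverse (1 + sin \<theta> * cos \<theta> * ?U m r \<theta>))" .
    then show ?thesis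
    proof (rule jet_cong)
      show "\<forall>\<^sub>0 r. \<forall>\<theta>\<in>?I. (sin \<theta>)\<^sup>2 * ?U m r \<theta> *
         inverse (1 + sin \<theta> * cos \<theta> * ?U m r \<theta>) = \<psi> m r \<theta>" for m
        using ev[of m] by eventually_elim simp
    qed
  qed
  have w: "jet N ?I w" for N
  proof (induction N)
    case 0
    have "\<forall>\<^sub>0 r. continuous_on ?I (w m r) \<and> (\<forall>\<theta>\<in>?I. \<bar>w m r \<theta>\<bar> \<le> exp (4 * pi))" for m
      using ev[of m]
    proof eventually_elim
      case (elim r)
      then have "continuous_on ?I (\<rho> m r)" by (simp add: polar_solution_def)
      then have "continuous_on ?I (w m r)" using elim unfolding w_def by (intro continuous_intros) auto
      moreover have "\<bar>w m r \<theta>\<bar> \<le> exp (4 * pi)" if "\<theta> \<in> ?I" for \<theta>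
        using elim that by (smt (verit) exp_gt_zero)
      ultimately show ?case by blast
    qed
    then show ?case by auto
  next
    case (Suc N)
    show ?case using jet_exp_integral[OF step[OF Suc]]
    proof (rule jet_cong)
      show "\<forall>\<^sub>0 r. \<forall>t\<in>?I. exp (integral {0..t} (\<psi> m r)) = w m r t" for m
        using ev[of m] by eventually_elim simp
    qed
  qed

  have half: "\<exists>\<kappa> c. (\<forall>i N. jet N {0..pi/2} (\<kappa> i)) \<and> (\<forall>i m. \<forall>\<^sub>0 r. c i \<le> \<kappa> i m r (pi/2)) \<and>
      (\<forall>i. (c i :: real) > 0) \<and> (\<forall>m. \<forall>\<^sub>0 r. w m r (c0 + pi/2) - w m r (c0 - pi/2) =
        (\<Sum>i\<le>n. \<alpha> m i * r ^ (2 * i) * \<kappa> i m r (pi/2)))"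
    if c0: "c0 = pi / 2 \<and> \<sigma> = 1 \<or> c0 = 3 * pi / 2 \<and> \<sigma> = -1" for c0 \<sigma> :: real
  proof -
    have tr: "sin (c0 + t) = \<sigma> * cos t" "cos (c0 + t) = - (\<sigma> * sin t)"
      "sin (c0 - t) = \<sigma> * cos t" "cos (c0 - t) = \<sigma> * sin t" for t
    proof -
      have "sin (3 * pi / 2) = -1" "cos (3 * pi / 2) = 0"
        using sin_periodic_pi[of "pi / 2"] cos_periodic_pi[of "pi / 2"] by (simp_all add: field_simps)
      with c0 have "sin c0 = \<sigma>" "cos c0 = 0" by (metis sin_pi_half, metis cos_pi_half)
      then show "sin (c0 + t) = \<sigma> * cos t" "cos (c0 + t) = - (\<sigma> * sin t)"
        "sin (c0 - t) = \<sigma> * cos t" "cos (c0 - t) = \<sigma> * sin t"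
        by (auto simp: sin_add cos_add sin_diff cos_diff)
    qed
    have \<sigma>: "\<sigma> = 1 \<or> \<sigma> = -1" using c0 by auto
    have range: "c0 + t \<in> ?I" "c0 - t \<in> ?I" if "t \<in> {0..pi/2}" for t using that c0 by auto
    have range': "c0 + t \<in> {0<..<2*pi}" "c0 - t \<in> {0<..<2*pi}" if "t \<in> {0<..<pi/2}" for t
      using that c0 by auto
    have jz: "\<And>N. jet N {0..pi/2} (\<lambda>m r t. w m r (c0 + t))"
      by (rule jet_reparam[OF w], intro continuous_intros) (use range in blast)
    have jw: "\<And>N. jet N {0..pi/2} (\<lambda>m r t. w m r (c0 - t))"
      by (rule jet_reparam[OF w], intro continuous_intros) (use range in blast)
    have pos: "\<forall>\<^sub>0 r. \<forall>t\<in>{0..pi/2}. exp (- (4 * pi)) \<le> w m r (c0 + t) \<and> exp (- (4 * pi)) \<le> w m r (c0 - t)" for m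
      using ev[of m] by (rule eventually_mono) (use range in blast)
    have ode: "\<forall>\<^sub>0 r. \<forall>t\<in>{0<..<pi/2}.
       ((\<lambda>t. w m r (c0 + t)) has_real_derivative w m r (c0 + t) *
          phi t (Se n (\<alpha> m) (r * (w m r (c0 + t) * sin t)) - \<sigma> * So n (\<beta> m) (r * (w m r (c0 + t) * sin t)))) (at t) \<and>
       ((\<lambda>t. w m r (c0 - t)) has_real_derivative w m r (c0 - t) *
          phi t (- Se n (\<alpha> m) (r * (w m r (c0 - t) * sin t)) - \<sigma> * So n (\<beta> m) (r * (w m r (c0 - t) * sin t)))) (at t)" for m
      using ev[of m]
    proof eventually_elim
      case (elim r)
      then have r: "r > 0" and s: "polar_solution n (a m) (b m) (\<epsilon>a m) (\<epsilon>b m) (\<rho> m r)" by auto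
      have der: "(w m r has_real_derivative w m r \<theta> * psi n (\<alpha> m) (\<beta> m) (r * w m r \<theta>) \<theta>) (at \<theta>)"
        if "\<theta> \<in> {0<..<2*pi}" "cos \<theta> \<noteq> 0" for \<theta>
        using DERIV_cdivide[OF polar_ode(2)[OF s that], of r] r by (simp add: w_def \<alpha>_def \<beta>_def)
      have Se_\<sigma>: "Se n A (\<sigma> * u) = Se n A u" and So_\<sigma>: "So n A (\<sigma> * u) = \<sigma> * So n A u" for A u
        using \<sigma> by auto
      show ?case
      proof (intro ballI conjI)
        fix t assume t: "t \<in> {0<..<pi/2}"
        have "sin t > 0" using t by (intro sin_gt_zero) auto
        then have nz: "cos (c0 + t) \<noteq> 0" "cos (c0 - t) \<noteq> 0" unfolding tr using \<sigma> by auto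
        have u: "r * W * - (\<sigma> * sin t) = \<sigma> * - (r * (W * sin t))" "r * W * (\<sigma> * sin t) = \<sigma> * (r * (W * sin t))" for W
          by simp_all
        have sc: "\<sigma> * cos t * - (\<sigma> * sin t) = - (sin t * cos t)" "\<sigma> * cos t * (\<sigma> * sin t) = sin t * cos t"
          "(\<sigma> * cos t)\<^sup>2 = (cos t)\<^sup>2"
          using \<sigma> by (auto simp: power2_eq_square)
        have p1: "psi n (\<alpha> m) (\<beta> m) (r * W) (c0 + t) =
            phi t (Se n (\<alpha> m) (r * (W * sin t)) - \<sigma> * So n (\<beta> m) (r * (W * sin t)))" for W
          unfolding psi_def phi_def NN_def tr u sc Se_\<sigma> So_\<sigma> by simp
        have p2: "- psi n (\<alpha> m) (\<beta> m) (r * W) (c0 - t) =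
            phi t (- Se n (\<alpha> m) (r * (W * sin t)) - \<sigma> * So n (\<beta> m) (r * (W * sin t)))" for W
          unfolding psi_def phi_def NN_def tr u sc Se_\<sigma> So_\<sigma> by (simp add: algebra_simps)
        have "((\<lambda>t. c0 + t) has_real_derivative 1) (at t)" "((\<lambda>t. c0 - t) has_real_derivative - 1) (at t)"
          by (auto intro!: derivative_eq_intros)
        note d = DERIV_chain2[OF der[OF range'(1)[OF t] nz(1)] this(1)]
          DERIV_chain2[OF der[OF range'(2)[OF t] nz(2)] this(2)]
        show "((\<lambda>t. w m r (c0 + t)) has_real_derivative w m r (c0 + t) *
          phi t (Se n (\<alpha> m) (r * (w m r (c0 + t) * sin t)) - \<sigma> * So n (\<beta> m) (r * (w m r (c0 + t) * sin t)))) (at t)"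
          using d(1) unfolding p1 by simp
        show "((\<lambda>t. w m r (c0 - t)) has_real_derivative w m r (c0 - t) *
          phi t (- Se n (\<alpha> m) (r * (w m r (c0 - t) * sin t)) - \<sigma> * So n (\<beta> m) (r * (w m r (c0 - t) * sin t)))) (at t)"
          using d(2) unfolding p2[symmetric] by simp
      qed
    qed
    have \<alpha>0: "\<bar>\<alpha> m 0\<bar> \<le> 1 / 2" for m using a0 by (simp add: \<alpha>_def)
    have init: "\<forall>\<^sub>0 r. w m r (c0 + 0) = w m r (c0 - 0)" for m by simp
    have epos: "exp (- (4 * pi)) > 0" by simp
    show ?thesis
      by (rule half_turn[OF \<sigma> \<alpha>0 _ _ jz jw epos pos init ode]; (use \<alpha> \<beta> in blast)?)
  qed
  from half[of "pi / 2" 1] obtain \<kappa>1 c1 where 1: "\<And>i N. jet N {0..pi/2} (\<kappa>1 i)"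
      "\<And>i m. \<forall>\<^sub>0 r. c1 i \<le> \<kappa>1 i m r (pi/2)" "\<And>i. c1 i > (0 :: real)"
      "\<And>m. \<forall>\<^sub>0 r. w m r pi - w m r 0 = (\<Sum>i\<le>n. \<alpha> m i * r ^ (2 * i) * \<kappa>1 i m r (pi/2))"
    by (auto simp: field_simps)
  from half[of "3 * pi / 2" "-1"] obtain \<kappa>2 c2 where 2: "\<And>i N. jet N {0..pi/2} (\<kappa>2 i)"
      "\<And>i m. \<forall>\<^sub>0 r. c2 i \<le> \<kappa>2 i m r (pi/2)" "\<And>i. c2 i > (0 :: real)"
      "\<And>m. \<forall>\<^sub>0 r. w m r (2 * pi) - w m r pi = (\<Sum>i\<le>n. \<alpha> m i * r ^ (2 * i) * \<kappa>2 i m r (pi/2))"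
    by (auto simp: field_simps)
  show ?thesis
  proof (rule that[of "\<lambda>i m r t. \<kappa>1 i m r t + \<kappa>2 i m r t" "\<lambda>i. c1 i + c2 i"])
    show "jet N {0..pi/2} (\<lambda>m r t. \<kappa>1 i m r t + \<kappa>2 i m r t)" for i N
      by (rule jet_add[OF 1(1) 2(1)])
    show "\<forall>\<^sub>0 r. c1 i + c2 i \<le> \<kappa>1 i m r (pi/2) + \<kappa>2 i m r (pi/2)" for i m
      using 1(2)[of i m] 2(2)[of i m] by eventually_elim simp
    show "c1 i + c2 i > 0" for i using 1(3)[of i] 2(3)[of i] by simp
    show "\<forall>\<^sub>0 r. \<rho> m r (2*pi) - r =
        r * (\<Sum>i\<le>n. \<epsilon>a m * a m i * r ^ (2 * i) * (\<kappa>1 i m r (pi/2) + \<kappa>2 i m r (pi/2)))" for m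
      using 1(4)[of m] 2(4)[of m] ev[of m]
    proof eventually_elim
      case (elim r)
      have "\<rho> m r (2*pi) - r = r * (w m r (2*pi) - w m r 0)" using elim by (simp add: w_def field_simps)
      also have "w m r (2*pi) - w m r 0 = (\<Sum>i\<le>n. \<alpha> m i * r ^ (2 * i) * (\<kappa>1 i m r (pi/2) + \<kappa>2 i m r (pi/2)))"
        using elim by (simp add: distrib_left sum.distrib)
      finally show ?case by (simp add: \<alpha>_def)
    qed
  qed
qed

section \<open>Asymptotic expansions at zero\<close>

text \<open>
  \<open>aexp N f x\<close>: $f(r) = \sum_{k<N} x_k r^k + O(r^N)$ as $r \to 0$ from the right.
\<close>

definition aexp :: "nat \<Rightarrow> (real \<Rightarrow> real) \<Rightarrow> (nat \<Rightarrow> real) \<Rightarrow> bool" where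
  "aexp N f x \<longleftrightarrow> (\<exists>M. \<forall>\<^sub>0 r. \<bar>f r - (\<Sum>k<N. x k * r ^ k)\<bar> \<le> M * r ^ N)"

lemma aexp_cong: "aexp N f x \<Longrightarrow> \<forall>\<^sub>0 r. f r = g r \<Longrightarrow> aexp N g x"
  unfolding aexp_def by (elim exE, rule exI, erule (1) eventually_elim2) simp

lemma aexp_add:
  assumes "aexp N f x" "aexp N g y"
  shows "aexp N (\<lambda>r. f r + g r) (\<lambda>k. x k + y k)"
proof -
  from assms obtain M M' where
    "\<forall>\<^sub>0 r. \<bar>f r - (\<Sum>k<N. x k * r ^ k)\<bar> \<le> M * r ^ N"
    "\<forall>\<^sub>0 r. \<bar>g r - (\<Sum>k<N. y k * r ^ k)\<bar> \<le> M' * r ^ N"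
    unfolding aexp_def by blast
  then have "\<forall>\<^sub>0 r. \<bar>f r + g r - (\<Sum>k<N. (x k + y k) * r ^ k)\<bar> \<le> (M + M') * r ^ N"
  proof eventually_elim
    case (elim r)
    have "f r + g r - (\<Sum>k<N. (x k + y k) * r ^ k) =
        (f r - (\<Sum>k<N. x k * r ^ k)) + (g r - (\<Sum>k<N. y k * r ^ k))"
      by (simp add: distrib_right sum.distrib)
    with elim show ?case by (simp add: distrib_right)
  qed
  then show ?thesis unfolding aexp_def by blast
qed

lemma aexp_cmult:
  assumes "aexp N f x"
  shows "aexp N (\<lambda>r. c * f r) (\<lambda>k. c * x k)"
proof -
  from assms obtain M where
    "\<forall>\<^sub>0 r. \<bar>f r - (\<Sum>k<N. x k * r ^ k)\<bar> \<le> M * r ^ N"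
    unfolding aexp_def by blast
  then have "\<forall>\<^sub>0 r. \<bar>c * f r - (\<Sum>k<N. c * x k * r ^ k)\<bar> \<le> (\<bar>c\<bar> * M) * r ^ N"
  proof eventually_elim
    case (elim r)
    have "c * f r - (\<Sum>k<N. c * x k * r ^ k) = c * (f r - (\<Sum>k<N. x k * r ^ k))"
      by (simp add: right_diff_distrib sum_distrib_left mult.assoc)
    then show ?case using mult_left_mono[OF elim, of "\<bar>c\<bar>"] by (simp add: abs_mult mult.assoc)
  qed
  then show ?thesis unfolding aexp_def by blast
qed

lemma aexp_0: "aexp N (\<lambda>r. 0) (\<lambda>k. 0)"
  unfolding aexp_def by (intro exI[of _ 0]) simp

lemma aexp_sum:
  "(\<And>i. i \<in> A \<Longrightarrow> aexp N (f i) (x i)) \<Longrightarrow> aexp N (\<lambda>r. \<Sum>i\<in>A. f i r) (\<lambda>k. \<Sum>i\<in>A. x i k)"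
  by (induction A rule: infinite_finite_induct) (auto intro: aexp_0 aexp_add)

lemma aexp_SucD:
  assumes "aexp (Suc N) f x"
  shows "aexp N f x"
proof -
  from assms obtain M where
    "\<forall>\<^sub>0 r. \<bar>f r - (\<Sum>k<Suc N. x k * r ^ k)\<bar> \<le> M * r ^ Suc N"
    unfolding aexp_def by blast
  then have "\<forall>\<^sub>0 r. \<bar>f r - (\<Sum>k<N. x k * r ^ k)\<bar> \<le> (\<bar>M\<bar> + \<bar>x N\<bar>) * r ^ N"
    using eventually_right_0[OF zero_less_one]
  proof eventually_elim
    case (elim r)
    have "M * r ^ Suc N \<le> \<bar>M\<bar> * r ^ N"
      using elim by (intro mult_mono) (auto intro: mult_left_le_one_le)
    moreover have "\<bar>x N * r ^ N\<bar> = \<bar>x N\<bar> * r ^ N" using elim by (simp add: abs_mult)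
    ultimately show ?case using elim(1) by (simp add: distrib_right)
  qed
  then show ?thesis unfolding aexp_def by blast
qed

lemma aexp_shift1:
  assumes "aexp N f x"
  shows "aexp (Suc N) (\<lambda>r. r * f r) (case_nat 0 x)"
proof -
  from assms obtain M where
    "\<forall>\<^sub>0 r. \<bar>f r - (\<Sum>k<N. x k * r ^ k)\<bar> \<le> M * r ^ N"
    unfolding aexp_def by blast
  then have "\<forall>\<^sub>0 r. \<bar>r * f r - (\<Sum>k<Suc N. case_nat 0 x k * r ^ k)\<bar> \<le> M * r ^ Suc N"
    using eventually_right_0[OF zero_less_one]
  proof eventually_elim
    case (elim r)
    have "r * f r - (\<Sum>k<Suc N. case_nat 0 x k * r ^ k) = r * (f r - (\<Sum>k<N. x k * r ^ k))"
      unfolding sum.lessThan_Suc_shift by (simp add: right_diff_distrib sum_distrib_left mult_ac)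
    then show ?case using elim mult_left_mono[OF elim(1), of r] by (simp add: abs_mult mult_ac)
  qed
  then show ?thesis unfolding aexp_def by blast
qed

lemma aexp_shift:
  assumes "aexp N f x"
  shows "aexp N (\<lambda>r. r ^ j * f r) (\<lambda>k. if k < j then 0 else x (k - j))"
proof (induction j)
  case (Suc j)
  have "(case_nat 0 (\<lambda>k. if k < j then 0 else x (k - j))) = (\<lambda>k. if k < Suc j then 0 else x (k - Suc j))"
    by (auto split: nat.split)
  with aexp_SucD[OF aexp_shift1[OF Suc]] show ?case by (simp add: mult.assoc)
qed (use assms in simp)

lemma aexp_zero_unique:
  assumes "aexp N (\<lambda>r. 0) x" "k < N"
  shows "x k = 0"
  using assms
proof (induction N arbitrary: x k)
  case (Suc N)
  from Suc.prems(1) obtain M where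
    M: "\<forall>\<^sub>0 r. \<bar>0 - (\<Sum>k<Suc N. x k * r ^ k)\<bar> \<le> M * r ^ Suc N"
    unfolding aexp_def by blast
  have "((\<lambda>r. M * r ^ Suc N) \<longlongrightarrow> M * 0 ^ Suc N) (at_right 0)"
    by (intro tendsto_intros)
  then have "((\<lambda>r. M * r ^ Suc N) \<longlongrightarrow> 0) (at_right 0)" by simp
  then have "((\<lambda>r. 0 - (\<Sum>k<Suc N. x k * r ^ k)) \<longlongrightarrow> 0) (at_right 0)"
    by (rule Lim_null_comparison[OF M[folded real_norm_def]])
  moreover have "((\<lambda>r. 0 - (\<Sum>k<Suc N. x k * r ^ k)) \<longlongrightarrow> 0 - (\<Sum>k<Suc N. x k * 0 ^ k)) (at_right 0)"
    by (intro tendsto_intros)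
  moreover have "(\<Sum>k<Suc N. x k * 0 ^ k) = x 0"
    unfolding sum.lessThan_Suc_shift by simp
  ultimately have "0 = 0 - x 0"
    using tendsto_unique[OF trivial_limit_at_right_real] by (metis (no_types, lifting))
  then have x0: "x 0 = 0" by simp
  have "aexp N (\<lambda>r. 0) (\<lambda>k. x (Suc k))"
    unfolding aexp_def
  proof (intro exI)
    show "\<forall>\<^sub>0 r. \<bar>0 - (\<Sum>k<N. x (Suc k) * r ^ k)\<bar> \<le> M * r ^ N"
      using M eventually_right_0[OF zero_less_one]
    proof eventually_elim
      case (elim r)
      have "(\<Sum>k<Suc N. x k * r ^ k) = r * (\<Sum>k<N. x (Suc k) * r ^ k)"
        unfolding sum.lessThan_Suc_shift by (simp add: x0 sum_distrib_left mult_ac)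
      then have "r * \<bar>\<Sum>k<N. x (Suc k) * r ^ k\<bar> \<le> r * (M * r ^ N)"
        using elim by (simp add: abs_mult mult_ac)
      then show ?case using elim by simp
    qed
  qed
  from Suc.IH[OF this] Suc.prems(2) x0 show ?case by (cases k) auto
qed simp

lemma aexp_unique:
  assumes "aexp N f x" "aexp N f y" "k < N"
  shows "x k = y k"
proof -
  have "aexp N (\<lambda>r. f r + -1 * f r) (\<lambda>k. x k + -1 * y k)"
    by (intro aexp_add aexp_cmult assms)
  then have "aexp N (\<lambda>r. 0) (\<lambda>k. x k - y k)" by simp
  from aexp_zero_unique[OF this assms(3)] show ?thesis by simp
qed

lemma aexp_power_series:
  assumes "r0 > 0" "\<And>r. 0 < r \<Longrightarrow> r < r0 \<Longrightarrow> (\<lambda>i. x i * r ^ i) sums f r"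
  shows "aexp N f x"
proof -
  define r1 where "r1 = r0 / 2"
  have r1: "0 < r1" "r1 < r0" using assms(1) by (auto simp: r1_def)
  have sm: "summable (\<lambda>i. x (i + N) * r ^ i)" if "\<bar>r\<bar> < r1" for r
  proof -
    have "summable (\<lambda>i. x (i + N) * r1 ^ (i + N))"
      using sums_summable[OF assms(2)[OF r1]] summable_iff_shift[of "\<lambda>i. x i * r1 ^ i" N] by simp
    then have "summable (\<lambda>i. inverse (r1 ^ N) * (x (i + N) * r1 ^ (i + N)))" by (rule summable_mult)
    then have "summable (\<lambda>i. x (i + N) * r1 ^ i)" using r1 by (simp add: power_add field_simps)
    then show ?thesis by (rule powser_inside) (use that r1 in auto)
  qed
  define g where "g = (\<lambda>r. \<Sum>i. x (i + N) * r ^ i)"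
  have "(g \<longlongrightarrow> x (0 + N)) (at 0)"
    by (rule powser_limit_0_strong[OF r1(1), of "\<lambda>i. x (i + N)"]) (use sm in \<open>auto simp: g_def intro: summable_sums\<close>)
  then have "(g \<longlongrightarrow> x N) (at_right 0)" by (simp add: filterlim_at_split)
  then have "((\<lambda>r. \<bar>g r\<bar>) \<longlongrightarrow> \<bar>x N\<bar>) (at_right 0)" by (rule tendsto_rabs)
  then have "\<forall>\<^sub>0 r. \<bar>g r\<bar> < \<bar>x N\<bar> + 1" by (rule order_tendstoD) simp
  then have "\<forall>\<^sub>0 r. \<bar>f r - (\<Sum>k<N. x k * r ^ k)\<bar> \<le> (\<bar>x N\<bar> + 1) * r ^ N"
    using eventually_right_0[OF r1(1)]
  proof eventually_elim
    case (elim r)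
    then have "(\<lambda>i. x i * r ^ i) sums f r" using r1 by (intro assms) auto
    then have "(\<lambda>i. x (i + N) * r ^ (i + N)) sums (f r - (\<Sum>k<N. x k * r ^ k))"
      by (rule sums_split_initial_segment)
    moreover have "(\<lambda>i. r ^ N * (x (i + N) * r ^ i)) sums (r ^ N * g r)"
      unfolding g_def using elim by (intro sums_mult summable_sums sm) auto
    ultimately have "f r - (\<Sum>k<N. x k * r ^ k) = r ^ N * g r"
      by (intro sums_unique2[of "\<lambda>i. x (i + N) * r ^ (i + N)"]) (simp_all add: power_add mult_ac)
    then show ?case using elim mult_left_mono[of "\<bar>g r\<bar>" "\<bar>x N\<bar> + 1" "r ^ N"]
      by (simp add: abs_mult mult_ac)
  qed
  then show ?thesis unfolding aexp_def by blast
qed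

section \<open>The selected coefficients at the origin\<close>

lemma origin_coeff_structure:
  fixes a b C :: "'i \<Rightarrow> nat \<Rightarrow> real" and \<epsilon>a \<epsilon>b :: "'i \<Rightarrow> real"
  assumes oc: "\<And>m. origin_coeffs n (a m) (b m) (\<epsilon>a m) (\<epsilon>b m) (C m)"
    and a0: "\<And>m. \<bar>\<epsilon>a m * a m 0\<bar> \<le> 1 / 2"
    and a: "\<And>m i. i \<le> n \<Longrightarrow> \<bar>\<epsilon>a m * a m i\<bar> \<le> B"
    and b: "\<And>m i. i \<le> n \<Longrightarrow> \<bar>\<epsilon>b m * b m i\<bar> \<le> B"
  obtains k :: "nat \<Rightarrow> nat \<Rightarrow> 'i \<Rightarrow> real" and K :: "nat \<Rightarrow> nat \<Rightarrow> real" and c :: "nat \<Rightarrow> real"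
  where "\<And>i l m. \<bar>k i l m\<bar> \<le> K i l" "\<And>i m. c i \<le> k i 0 m" "\<And>i. c i > 0"
    "\<And>m j. j \<le> n \<Longrightarrow> C m (2 * j) = (\<Sum>i\<le>j. \<epsilon>a m * a m i * k i (2 * j - 2 * i) m)"
proof -
  define S where "S = (\<lambda>m r \<rho>. polar_solution n (a m) (b m) (\<epsilon>a m) (\<epsilon>b m) \<rho> \<and> \<rho> 0 = r \<and>
     (\<lambda>i. C m i * r ^ (i + 1)) sums (\<rho> (2*pi) - r))"
  define \<rho> where "\<rho> = (\<lambda>m r. SOME \<rho>. S m r \<rho>)"
  have "\<exists>r0>0. \<forall>r. 0 < r \<and> r < r0 \<longrightarrow> S m r (\<rho> m r)" for m
  proof -
    from oc[of m] obtain r0 where r0: "r0 > 0" "\<And>r. r \<in> {0<..<r0} \<Longrightarrow> \<exists>\<rho>. S m r \<rho>"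
      unfolding origin_coeffs_def first_return_def S_def by blast
    have "S m r (\<rho> m r)" if "0 < r" "r < r0" for r
      unfolding \<rho>_def by (rule someI_ex[OF r0(2)]) (use that in simp)
    with r0(1) show ?thesis by blast
  qed
  then obtain r0 where r0: "\<And>m. r0 m > 0" "\<And>m r. 0 < r \<Longrightarrow> r < r0 m \<Longrightarrow> S m r (\<rho> m r)" by metis
  have sol: "\<forall>\<^sub>0 r. polar_solution n (a m) (b m) (\<epsilon>a m) (\<epsilon>b m) (\<rho> m r) \<and> \<rho> m r 0 = r" for m
    using eventually_right_0[OF r0(1)[of m]] by (rule eventually_mono) (use r0(2) in \<open>auto simp: S_def\<close>)
  obtain \<kappa> :: "nat \<Rightarrow> 'i \<Rightarrow> real \<Rightarrow> real \<Rightarrow> real" and c :: "nat \<Rightarrow> real" where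
    \<kappa>: "\<And>i N. jet N {0..pi/2} (\<kappa> i)"
    and c: "\<And>i m. \<forall>\<^sub>0 r. c i \<le> \<kappa> i m r (pi/2)" "\<And>i. c i > 0"
    and exp: "\<And>m. \<forall>\<^sub>0 r. \<rho> m r (2*pi) - r =
        r * (\<Sum>i\<le>n. \<epsilon>a m * a m i * r ^ (2 * i) * \<kappa> i m r (pi/2))"
    by (rule displacement_expansion[of n a b \<epsilon>a \<epsilon>b \<rho> B, OF sol a0 a b]) blast+
  \<comment> \<open>expansions up to and including the order $2n$ of the last selected coefficient\<close>
  define N where "N = Suc (2 * n)"
  have "\<exists>d. (\<forall>l. bdd_cont {0..pi/2} (d l)) \<and> (\<forall>m. aexp N (\<lambda>r. \<kappa> i m r (pi/2)) (\<lambda>l. d l m (pi/2)))" for i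
  proof -
    obtain d where d: "\<And>l. bdd_cont {0..pi/2} (d l)" "\<And>m. \<exists>M. \<forall>\<^sub>0 r. \<forall>t\<in>{0..pi/2}.
        \<bar>\<kappa> i m r t - (\<Sum>l<N. d l m t * r ^ l)\<bar> \<le> M * r ^ N"
      using jet_expand[OF \<kappa>[of N i]] by blast
    have "aexp N (\<lambda>r. \<kappa> i m r (pi/2)) (\<lambda>l. d l m (pi/2))" for m
    proof -
      from d(2)[of m] obtain M where "\<forall>\<^sub>0 r. \<forall>t\<in>{0..pi/2}.
        \<bar>\<kappa> i m r t - (\<Sum>l<N. d l m t * r ^ l)\<bar> \<le> M * r ^ N" by blast
      then show ?thesis unfolding aexp_def by (intro exI[of _ M]) (auto elim!: eventually_mono)
    qed
    with d(1) show ?thesis by blast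
  qed
  then obtain d where d: "\<And>i l. bdd_cont {0..pi/2} (d i l)"
    and d_exp: "\<And>i m. aexp N (\<lambda>r. \<kappa> i m r (pi/2)) (\<lambda>l. d i l m (pi/2))" by metis
  have "\<exists>K. \<forall>m. \<bar>d i l m (pi/2)\<bar> \<le> K" for i l
    using d[of i l] unfolding bdd_cont_def by fastforce
  then obtain K where K: "\<And>i l m. \<bar>d i l m (pi/2)\<bar> \<le> K i l" by metis
  have lower: "c i \<le> d i 0 m (pi/2)" for i m
  proof -
    have "aexp 1 (\<lambda>r. \<kappa> i m r (pi/2)) (\<lambda>l. d i l m (pi/2))"
    proof -
      have "aexp (Suc k) (\<lambda>r. \<kappa> i m r (pi/2)) (\<lambda>l. d i l m (pi/2)) \<Longrightarrow> ?thesis" for k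
        by (induction k) (auto dest: aexp_SucD)
      then show ?thesis using d_exp[of i m] unfolding N_def by blast
    qed
    then obtain M where "\<forall>\<^sub>0 r. \<bar>\<kappa> i m r (pi/2) - d i 0 m (pi/2)\<bar> \<le> M * r"
      unfolding aexp_def by auto
    with c(1)[of i m] have "\<forall>\<^sub>0 r. c i \<le> d i 0 m (pi/2) + M * r"
      by eventually_elim linarith
    moreover have "((\<lambda>r. d i 0 m (pi/2) + M * r) \<longlongrightarrow> d i 0 m (pi/2) + M * 0) (at_right 0)"
      by (intro tendsto_intros)
    ultimately show ?thesis
      using tendsto_lowerbound[of "\<lambda>r. d i 0 m (pi/2) + M * r" _ "at_right 0" "c i"] by simp
  qed
  have coeff: "C m (2 * j) = (\<Sum>i\<le>j. \<epsilon>a m * a m i * d i (2 * j - 2 * i) m (pi/2))" if j: "j \<le> n" for m j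
  proof -
    define f where "f = (\<lambda>r. (\<rho> m r (2*pi) - r) / r)"
    have 1: "aexp N f (C m)"
    proof (rule aexp_power_series[OF r0(1)[of m]])
      fix r assume r: "0 < r" "r < r0 m"
      then have "(\<lambda>i. C m i * r ^ (i + 1)) sums (\<rho> m r (2*pi) - r)" using r0(2) by (simp add: S_def)
      from sums_divide[OF this, of r] show "(\<lambda>i. C m i * r ^ i) sums f r"
        using r by (simp add: f_def)
    qed
    have "aexp N (\<lambda>r. \<Sum>i\<le>n. (\<epsilon>a m * a m i) * (r ^ (2 * i) * \<kappa> i m r (pi/2)))
      (\<lambda>k. \<Sum>i\<le>n. (\<epsilon>a m * a m i) * (if k < 2 * i then 0 else d i (k - 2 * i) m (pi/2)))"
      by (intro aexp_sum aexp_cmult aexp_shift d_exp)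
    then have 2: "aexp N f (\<lambda>k. \<Sum>i\<le>n. (\<epsilon>a m * a m i) * (if k < 2 * i then 0 else d i (k - 2 * i) m (pi/2)))"
    proof (rule aexp_cong)
      show "\<forall>\<^sub>0 r. (\<Sum>i\<le>n. (\<epsilon>a m * a m i) * (r ^ (2 * i) * \<kappa> i m r (pi/2))) = f r"
        using exp[of m] eventually_right_0[OF zero_less_one]
        by eventually_elim (auto simp: f_def mult.assoc)
    qed
    have "C m (2 * j) = (\<Sum>i\<le>n. (\<epsilon>a m * a m i) * (if 2 * j < 2 * i then 0 else d i (2 * j - 2 * i) m (pi/2)))"
      using aexp_unique[OF 1 2, of "2 * j"] j by (simp add: N_def)
    also have "\<dots> = (\<Sum>i\<le>j. \<epsilon>a m * a m i * d i (2 * j - 2 * i) m (pi/2))"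
      using j by (intro sum.mono_neutral_cong_right) auto
    finally show ?thesis .
  qed
  show ?thesis using that[of "\<lambda>i l m. d i l m (pi/2)" K c, OF K lower c(2) coeff] .
qed

section \<open>The line integral along the orbits of the lips\<close>

text \<open>
  The integrand of $M^+(h)$ in polar coordinates $u = \sqrt{2h}\cos\theta$, $y = \sqrt{2h}\sin\theta$,
  in which the orbit is a circle.
\<close>

definition Gfun :: "nat \<Rightarrow> (nat \<Rightarrow> real) \<Rightarrow> real \<Rightarrow> real \<Rightarrow> real" where
  "Gfun n a h \<theta> = 2 * h * (sin \<theta>)\<^sup>2 * Se n a (sqrt (2 * h) * cos \<theta>)"

text \<open>
  The line integral $M^+(h)$ as an explicit function of \<open>a\<close> and \<open>h\<close>.
\<close>

definition Mfun :: "nat \<Rightarrow> (nat \<Rightarrow> real) \<Rightarrow> real \<Rightarrow> real" where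
  "Mfun n a h = integral {0..2*pi} (Gfun n a h)"

lemma small_radius: "0 < h \<Longrightarrow> h < 1 / 6 \<Longrightarrow> 3 * (sqrt (2 * h) * cos \<theta>)\<^sup>2 < 1"
proof -
  assume h: "0 < h" "h < 1 / 6"
  have "(cos \<theta>)\<^sup>2 \<le> 1" by (simp add: cos_squared_eq)
  then have "h * (cos \<theta>)\<^sup>2 \<le> h * 1"
    using h by (intro mult_left_mono) auto
  moreover have "(sqrt (2 * h) * cos \<theta>)\<^sup>2 = 2 * (h * (cos \<theta>)\<^sup>2)"
    using h by (simp add: power_mult_distrib)
  ultimately show ?thesis using h by linarith
qed

lemma continuous_Gfun: "0 < h \<Longrightarrow> h < 1 / 6 \<Longrightarrow> continuous_on I (Gfun n a h)"
  unfolding Gfun_def using small_radius by (intro continuous_intros) auto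

lemma Gfun_periodic: "Gfun n a h (\<theta> + 2 * pi) = Gfun n a h \<theta>"
  by (simp add: Gfun_def)

lemma integral_period:
  fixes f :: "real \<Rightarrow> real"
  assumes "continuous_on UNIV f" "\<And>x. f (x + p) = f x" "p > 0"
    "\<And>x. (F has_real_derivative f x) (at x)"
  shows "F (x + p) - F x = integral {0..p} f"
proof -
  have D: "((\<lambda>x. F (x + p) - F x) has_real_derivative 0) (at x)" for x
  proof -
    have "((\<lambda>x. x + p) has_real_derivative 1) (at x)" by (auto intro!: derivative_eq_intros)
    from DERIV_diff[OF DERIV_chain2[OF assms(4) this] assms(4)] show ?thesis by (simp add: assms(2))
  qed
  from DERIV_isconst_all[of "\<lambda>x. F (x + p) - F x" x 0, OF allI, OF D]
  have "F (x + p) - F x = F (0 + p) - F 0" .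
  also have "(f has_integral (F p - F 0)) {0..p}"
    using assms by (intro fundamental_theorem_of_calculus)
      (auto simp: has_real_derivative_iff_has_vector_derivative intro: has_vector_derivative_at_within)
  then have "F (0 + p) - F 0 = integral {0..p} f" by (simp add: integral_unique)
  finally show ?thesis .
qed

text \<open>
  The factor with $u = x\,s(x)$ and $H = (u^2 + y^2)/2$.
\<close>

definition sx :: "real \<Rightarrow> real" where
  "sx x = sqrt (1 - x\<^sup>2 + x ^ 4 / 3)"

lemma quartic_pos: "1 - x\<^sup>2 + x ^ 4 / 3 > (0 :: real)"
  using quadratic_ge[of "x\<^sup>2"] by (simp add: power_mult[symmetric])

lemma sx_pos: "sx x > 0"
  using quartic_pos by (simp add: sx_def)

lemma sx_square: "(sx x)\<^sup>2 = 1 - x\<^sup>2 + x ^ 4 / 3"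
  using quartic_pos[of x] by (simp add: sx_def)

lemma om_x: "om (x * sx x) = x\<^sup>2"
proof (rule om_eqI)
  have "(x * sx x)\<^sup>2 = x\<^sup>2 * (1 - x\<^sup>2 + x ^ 4 / 3)" by (simp add: power_mult_distrib sx_square)
  then show "3 * (x * sx x)\<^sup>2 = (x\<^sup>2 - 1) ^ 3 + 1"
    by (simp add: power2_eq_square power3_eq_cube power4_eq_xxxx algebra_simps)
qed

lemma sq_x: "sq (x * sx x) = sx x"
  unfolding sq_def om_x by (simp add: sx_def power_mult[symmetric])

lemma deriv_u: "((\<lambda>x. x * sx x) has_real_derivative (x\<^sup>2 - 1)\<^sup>2 / sx x) (at x)"
proof -
  have "((\<lambda>x. 1 - x\<^sup>2 + x ^ 4 / 3) has_real_derivative - (2 * x) + 4 * x ^ 3 / 3) (at x)"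
    by (auto intro!: derivative_eq_intros)
  from DERIV_chain2[OF DERIV_real_sqrt[OF quartic_pos] this]
  have "(sx has_real_derivative inverse (sx x) / 2 * (- (2 * x) + 4 * x ^ 3 / 3)) (at x)"
    by (simp add: sx_def[abs_def])
  from DERIV_mult[OF DERIV_ident this]
  have "((\<lambda>x. x * sx x) has_real_derivative sx x + inverse (sx x) / 2 * (- (2 * x) + 4 * x ^ 3 / 3) * x) (at x)"
    by simp
  also have "sx x + inverse (sx x) / 2 * (- (2 * x) + 4 * x ^ 3 / 3) * x = (x\<^sup>2 - 1)\<^sup>2 / sx x"
  proof -
    have "sx x + inverse (sx x) / 2 * (- (2 * x) + 4 * x ^ 3 / 3) * x =
        ((sx x)\<^sup>2 + (- (2 * x) + 4 * x ^ 3 / 3) * x / 2) / sx x"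
      using sx_pos[of x] by (simp add: field_simps power2_eq_square)
    also have "(sx x)\<^sup>2 + (- (2 * x) + 4 * x ^ 3 / 3) * x / 2 = (x\<^sup>2 - 1)\<^sup>2"
      unfolding sx_square by (simp add: power2_eq_square power3_eq_cube power4_eq_xxxx field_simps)
    finally show ?thesis .
  qed
  finally show ?thesis .
qed

lemma inside_lips: "H_fun x y < 1 / 6 \<Longrightarrow> x\<^sup>2 < 1"
proof (rule ccontr)
  assume H: "H_fun x y < 1 / 6" and "\<not> x\<^sup>2 < 1"
  then have "0 \<le> (x\<^sup>2 - 1) ^ 3" by simp
  also have "(x\<^sup>2 - 1) ^ 3 = 3 * x\<^sup>2 - 3 * x ^ 4 + x ^ 6 - 1"
    by (simp add: power2_eq_square power3_eq_cube power4_eq_xxxx eval_nat_numeral algebra_simps)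
  finally have "1 \<le> 3 * x\<^sup>2 - 3 * x ^ 4 + x ^ 6" by simp
  then have "0 + 1 / 6 \<le> H_fun x y" unfolding H_fun_def by (rule add_mono[OF _ divide_right_mono, rotated 1]) auto
  then show False using H by simp
qed

lemma H_circle: "H_fun x y = ((x * sx x)\<^sup>2 + y\<^sup>2) / 2"
  unfolding power_mult_distrib sx_square H_fun_def
  by (simp add: power2_eq_square power4_eq_xxxx eval_nat_numeral field_simps)

text \<open>
  Solutions of $u' = g y$, $y' = -g u$ rotate about the origin, by the angle $-\int g$.
\<close>

lemma polar_angle:
  fixes u y A :: "real \<Rightarrow> real"
  assumes A: "\<And>t. (A has_real_derivative g t) (at t)"
    and u: "\<And>t. (u has_real_derivative g t * y t) (at t)"
    and y: "\<And>t. (y has_real_derivative - (g t * u t)) (at t)"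
  shows "u t = u 0 * cos (A t - A 0) + y 0 * sin (A t - A 0)"
    "y t = y 0 * cos (A t - A 0) - u 0 * sin (A t - A 0)"
proof -
  have 1: "((\<lambda>t. u t * cos (A t) - y t * sin (A t)) has_real_derivative 0) (at t)" for t
  proof -
    have "((\<lambda>t. u t * cos (A t) - y t * sin (A t)) has_real_derivative
        (g t * y t * cos (A t) + - sin (A t) * g t * u t) - (- (g t * u t) * sin (A t) + cos (A t) * g t * y t)) (at t)"
      by (intro DERIV_diff DERIV_mult u y DERIV_chain2[OF DERIV_cos A] DERIV_chain2[OF DERIV_sin A])
    then show ?thesis
      by (simp add: algebra_simps)
  qed
  have 2: "((\<lambda>t. u t * sin (A t) + y t * cos (A t)) has_real_derivative 0) (at t)" for t
  proof -
    have "((\<lambda>t. u t * sin (A t) + y t * cos (A t)) has_real_derivative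
        (g t * y t * sin (A t) + cos (A t) * g t * u t) + (- (g t * u t) * cos (A t) + - sin (A t) * g t * y t)) (at t)"
      by (intro DERIV_add DERIV_mult u y DERIV_chain2[OF DERIV_cos A] DERIV_chain2[OF DERIV_sin A])
    then show ?thesis
      by (simp add: algebra_simps)
  qed
  have e: "u 0 * cos (A 0) - y 0 * sin (A 0) = u t * cos (A t) - y t * sin (A t)"
    "u 0 * sin (A 0) + y 0 * cos (A 0) = u t * sin (A t) + y t * cos (A t)"
    using DERIV_isconst_all[of "\<lambda>t. u t * cos (A t) - y t * sin (A t)" 0 t, OF allI, OF 1]
      DERIV_isconst_all[of "\<lambda>t. u t * sin (A t) + y t * cos (A t)" 0 t, OF allI, OF 2] by simp_all
  have sc: "sin (A t) * sin (A t) = 1 - cos (A t) * cos (A t)"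
    using sin_cos_squared_add[of "A t"] by (simp add: power2_eq_square)
  have "u 0 * cos (A t - A 0) + y 0 * sin (A t - A 0) =
     (u 0 * cos (A 0) - y 0 * sin (A 0)) * cos (A t) + (u 0 * sin (A 0) + y 0 * cos (A 0)) * sin (A t)"
    by (simp add: cos_diff sin_diff algebra_simps)
  also have "\<dots> = u t * (cos (A t) * cos (A t)) + u t * (sin (A t) * sin (A t))"
    unfolding e by (simp add: algebra_simps)
  also have "\<dots> = u t" unfolding sc by (simp add: algebra_simps)
  finally show "u t = u 0 * cos (A t - A 0) + y 0 * sin (A t - A 0)" by simp
  have "y 0 * cos (A t - A 0) - u 0 * sin (A t - A 0) =
     (u 0 * sin (A 0) + y 0 * cos (A 0)) * cos (A t) - (u 0 * cos (A 0) - y 0 * sin (A 0)) * sin (A t)"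
    by (simp add: cos_diff sin_diff algebra_simps)
  also have "\<dots> = y t * (cos (A t) * cos (A t)) + y t * (sin (A t) * sin (A t))"
    unfolding e by (simp add: algebra_simps)
  also have "\<dots> = y t" unfolding sc by (simp add: algebra_simps)
  finally show "y t = y 0 * cos (A t - A 0) - u 0 * sin (A t - A 0)" by simp
qed

lemma antiderivative_UNIV:
  fixes f :: "real \<Rightarrow> real"
  assumes "continuous_on UNIV f"
  obtains F where "\<And>x. (F has_real_derivative f x) (at x)"
proof -
  define F where "F = (\<lambda>x. if x \<ge> 0 then integral {0..x} f else - integral {x..0} f)"
  have "(F has_real_derivative f x) (at x)" for x
  proof -
    define N where "N = \<bar>x\<bar> + 1"
    have c: "continuous_on {-N..N} f" using assms by (rule continuous_on_subset) simp
    have int: "f integrable_on {a..b}" for a b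
      by (rule integrable_continuous_real, rule continuous_on_subset[OF assms]) simp
    have x: "x \<in> {-N<..<N}" by (auto simp: N_def)
    then have "((\<lambda>x. integral {-N..x} f) has_real_derivative f x) (at x within {-N..N})"
      by (intro integral_has_real_derivative c) auto
    then have "((\<lambda>x. integral {-N..x} f) has_real_derivative f x) (at x)"
      using x by (simp add: at_within_Icc_at)
    from DERIV_diff[OF this DERIV_const]
    have d: "((\<lambda>x. integral {-N..x} f - integral {-N..0} f) has_real_derivative f x) (at x)" by simp
    have e: "\<forall>\<^sub>F z in nhds x. integral {-N..z} f - integral {-N..0} f = F z"
    proof (rule eventually_nhds_in_open[THEN eventually_mono])
      show "open {-N<..<N}" "x \<in> {-N<..<N}" using x by auto
      fix z assume z: "z \<in> {-N<..<N}"
      show "integral {-N..z} f - integral {-N..0} f = F z"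
      proof (cases "z \<ge> 0")
        case True
        then have "integral {-N..0} f + integral {0..z} f = integral {-N..z} f"
          by (intro Henstock_Kurzweil_Integration.integral_combine int) (auto simp: N_def)
        then show ?thesis using True by (simp add: F_def)
      next
        case False
        then have "integral {-N..z} f + integral {z..0} f = integral {-N..0} f"
          using z by (intro Henstock_Kurzweil_Integration.integral_combine int) auto
        then show ?thesis using False by (simp add: F_def)
      qed
    qed
    show ?thesis using d DERIV_cong_ev[OF refl e refl, of "f x"] by simp
  qed
  then show ?thesis using that by blast
qed

text \<open>
  Every parametrization of the orbit by the flow yields the same value. In the coordinates $(u,y)$ the
  flow rotates clockwise with positive speed, and minimality of the period means that the angle runs
  through exactly one turn.
\<close>

lemma lips_integral:
  assumes orb: "lips_orbit h x y T" and h: "0 < h" "h < 1 / 6"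
  shows "((\<lambda>t. (\<Sum>i\<le>n. a i * x t ^ (2*i)) * y t * y t) has_integral Mfun n a h) {0..T}"
proof -
  have dx: "\<And>t. (x has_real_derivative y t) (at t)"
    and dy: "\<And>t. (y has_real_derivative - (x t * ((x t)\<^sup>2 - 1)\<^sup>2)) (at t)"
    and H: "\<And>t. H_fun (x t) (y t) = h" and T: "T > 0"
    and per: "\<And>t. x (t + T) = x t \<and> y (t + T) = y t"
    and min: "\<And>t. 0 < t \<Longrightarrow> t < T \<Longrightarrow> (x t, y t) \<noteq> (x 0, y 0)"
    using orb unfolding lips_orbit_def by auto
  have cx: "continuous_on UNIV x" using dx by (meson DERIV_isCont continuous_at_imp_continuous_on)
  define u where "u = (\<lambda>t. x t * sx (x t))"
  define g where "g = (\<lambda>t. ((x t)\<^sup>2 - 1)\<^sup>2 / sx (x t))"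
  have x1: "(x t)\<^sup>2 < 1" for t using inside_lips[of "x t" "y t"] H h by simp
  have g: "g t > 0" for t using x1[of t] sx_pos[of "x t"] by (simp add: g_def)
  have du: "(u has_real_derivative g t * y t) (at t)" for t
    using DERIV_chain2[OF deriv_u dx] by (simp add: u_def g_def)
  have dy': "(y has_real_derivative - (g t * u t)) (at t)" for t
    using dy[of t] sx_pos[of "x t"] by (simp add: u_def g_def mult_ac)
  have "continuous_on UNIV g" unfolding g_def sx_def using quartic_pos
    by (intro continuous_intros cx) (auto simp: less_imp_le less_imp_neq[THEN not_sym])
  then obtain A where A: "\<And>t. (A has_real_derivative g t) (at t)" by (rule antiderivative_UNIV) blast
  have A_mono: "s < t \<Longrightarrow> A s < A t" for s t
    using DERIV_pos_imp_increasing[of s t A] A g by blast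
  have cA: "continuous_on UNIV A" using A by (meson DERIV_isCont continuous_at_imp_continuous_on)
  note rot = polar_angle[of A g u y, OF A du dy']
  define R where "R = sqrt (2 * h)"
  have R: "R > 0" "R\<^sup>2 = 2 * h" using h by (auto simp: R_def)
  have circ: "(u t)\<^sup>2 + (y t)\<^sup>2 = R\<^sup>2" for t
    using H[of t] by (simp add: H_circle u_def R(2))
  have "(u 0 / R)\<^sup>2 + (y 0 / R)\<^sup>2 = 1"
    using circ[of 0] R(1) by (simp add: power_divide add_divide_distrib[symmetric])
  then obtain \<theta>0 where \<theta>0: "u 0 / R = cos \<theta>0" "y 0 / R = sin \<theta>0" by (metis sincos_total_2pi)
  then have u0: "u 0 = R * cos \<theta>0" "y 0 = R * sin \<theta>0" using R(1) by (auto simp: field_simps)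
  define \<theta> where "\<theta> = (\<lambda>t. \<theta>0 - (A t - A 0))"
  have u: "u t = R * cos (\<theta> t)" and y: "y t = R * sin (\<theta> t)" for t
    unfolding \<theta>_def cos_diff[of \<theta>0] sin_diff[of \<theta>0] rot(1)[of t] rot(2)[of t] u0
    by (simp_all add: algebra_simps)
  have inj: "x s = x t" if "u s = u t" "y s = y t" for s t
  proof -
    have "(x s)\<^sup>2 = (x t)\<^sup>2" using om_x[of "x s"] om_x[of "x t"] that(1) by (simp add: u_def)
    then have "x s = x t \<or> x s = - x t" by (rule power2_eq_iff[THEN iffD1])
    then show ?thesis
    proof
      assume "x s = - x t"
      then have "u s = - u t" by (simp add: u_def sx_def)
      then have "u t = 0" using that by simp
      then have "x t = 0" using sx_pos[of "x t"] by (simp add: u_def)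
      then show ?thesis using \<open>x s = - x t\<close> by simp
    qed
  qed
  \<comment> \<open>periodicity gives a positive multiple of $2\pi$; a larger one would be preceded by an earlier return\<close>
  have turn: "A T - A 0 = 2 * pi"
  proof -
    have pos: "A T - A 0 > 0" using A_mono[OF T] by simp
    have "u T = u 0" "y T = y 0" using per[of 0] by (auto simp: u_def)
    then have "cos (\<theta> T) = cos (\<theta> 0)" "sin (\<theta> T) = sin (\<theta> 0)" using u[of T] u[of 0] y[of T] y[of 0] R(1) by auto
    then have "cos (\<theta> 0 - \<theta> T) = 1" by (simp add: cos_diff flip: power2_eq_square)
    then obtain k :: int where k: "\<theta> 0 - \<theta> T = of_int k * (2 * pi)" by (auto simp: cos_one_2pi_int)
    have e: "A T - A 0 = of_int k * (2 * pi)" using k by (simp add: \<theta>_def)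
    have "k \<ge> 1" using pos unfolding e by (simp add: zero_less_mult_iff)
    have ge: "A T - A 0 \<ge> 2 * pi"
      unfolding e using mult_right_mono[of 1 "of_int k" "2 * pi"] \<open>k \<ge> 1\<close> by simp
    show ?thesis
    proof (rule ccontr)
      assume "A T - A 0 \<noteq> 2 * pi"
      with ge have gt: "A 0 + 2 * pi < A T" by simp
      have "continuous_on {0..T} A" using cA by (rule continuous_on_subset) simp
      then obtain s where s: "0 \<le> s" "s \<le> T" "A s = A 0 + 2 * pi"
        using IVT'[of A 0 "A 0 + 2 * pi" T] gt T by auto
      have "s \<noteq> 0" "s \<noteq> T" using s gt by auto
      have "\<theta> s = \<theta> 0 - 2 * pi" using s by (simp add: \<theta>_def)
      then have "u s = u 0" "y s = y 0" using u[of s] u[of 0] y[of s] y[of 0] by (auto simp: cos_diff sin_diff)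
      then have "(x s, y s) = (x 0, y 0)" using inj[of s 0] by simp
      with min[of s] s \<open>s \<noteq> 0\<close> \<open>s \<noteq> T\<close> show False by auto
    qed
  qed
  have cG: "continuous_on UNIV (Gfun n a h)" by (rule continuous_Gfun[OF h])
  then obtain F where F: "\<And>x. (F has_real_derivative Gfun n a h x) (at x)" by (rule antiderivative_UNIV) blast
  have d\<theta>: "(\<theta> has_real_derivative - g t) (at t)" for t
    unfolding \<theta>_def by (auto intro!: derivative_eq_intros A)
  have integrand: "(\<Sum>i\<le>n. a i * x t ^ (2*i)) * y t * y t = Gfun n a h (\<theta> t) * g t" for t
  proof -
    have om: "om (u t) = (x t)\<^sup>2" and sq: "sq (u t) = sx (x t)" by (simp_all add: u_def om_x sq_x)
    have nz: "1 - (x t)\<^sup>2 \<noteq> 0" using x1[of t] by simp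
    have "((x t)\<^sup>2 - 1)\<^sup>2 = (1 - (x t)\<^sup>2)\<^sup>2" by (simp add: power2_eq_square algebra_simps)
    then have gt: "g t = (1 - (x t)\<^sup>2)\<^sup>2 / sx (x t)" by (simp add: g_def)
    have "Gfun n a h (\<theta> t) = (y t)\<^sup>2 * Se n a (u t)"
      by (simp add: Gfun_def R_def[symmetric] u y power_mult_distrib R(2))
    also have "Se n a (u t) = (\<Sum>i\<le>n. a i * x t ^ (2*i)) * sx (x t) / (1 - (x t)\<^sup>2)\<^sup>2"
      by (simp add: Se_def om sq power_mult)
    finally show ?thesis using nz sx_pos[of "x t"] by (simp add: gt power2_eq_square)
  qed
  have "((\<lambda>t. Gfun n a h (\<theta> t) * g t) has_integral (- F (\<theta> T) - - F (\<theta> 0))) {0..T}"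
  proof (rule fundamental_theorem_of_calculus)
    fix t
    have "((\<lambda>t. - F (\<theta> t)) has_real_derivative Gfun n a h (\<theta> t) * g t) (at t)"
      using DERIV_minus[OF DERIV_chain2[OF F d\<theta>]] by simp
    then show "((\<lambda>t. - F (\<theta> t)) has_vector_derivative Gfun n a h (\<theta> t) * g t) (at t within {0..T})"
      by (simp add: has_real_derivative_iff_has_vector_derivative has_vector_derivative_at_within)
  qed (use T in auto)
  also have "- F (\<theta> T) - - F (\<theta> 0) = F (\<theta> T + 2 * pi) - F (\<theta> T)" using turn by (simp add: \<theta>_def)
  also have "\<dots> = Mfun n a h" unfolding Mfun_def
    by (rule integral_period[OF cG Gfun_periodic _ F]) simp
  finally show ?thesis unfolding integrand .
qed

section \<open>The selected coefficients at the lips\<close>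

text \<open>
  The integrand that belongs to $x^{2i} y\,dx$; its integral is \<open>M1\<close>.
\<close>

abbreviation G1 :: "nat \<Rightarrow> real \<Rightarrow> real \<Rightarrow> real" where
  "G1 i \<equiv> Gfun i (\<lambda>j. if j = i then 1 else 0)"

lemma Gfun_split: "Gfun n a h \<theta> = (\<Sum>i\<le>n. a i * G1 i h \<theta>)"
proof -
  have "Se i (\<lambda>j. if j = i then 1 else 0) u = om u ^ i * sq u / (1 - om u)\<^sup>2" for i u
    by (simp add: Se_def if_distrib[of "\<lambda>x. x * _"] cong: if_cong)
  note single = this
  show ?thesis
    unfolding Gfun_def single unfolding Se_def
    by (simp add: sum_distrib_left sum_distrib_right sum_divide_distrib mult_ac)
qed

abbreviation M1 :: "nat \<Rightarrow> real \<Rightarrow> real" where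
  "M1 i \<equiv> Mfun i (\<lambda>j. if j = i then 1 else 0)"

lemma Mfun_sum:
  assumes "0 < h" "h < 1 / 6"
  shows "Mfun n a h = (\<Sum>i\<le>n. a i * M1 i h)"
proof -
  have int: "Gfun n a h integrable_on {0..2*pi}" for n a
    by (intro integrable_continuous_real continuous_Gfun assms)
  have "Mfun n a h = integral {0..2*pi} (\<lambda>\<theta>. \<Sum>i\<le>n. a i * G1 i h \<theta>)"
    unfolding Mfun_def by (subst Gfun_split[abs_def]) simp
  also have "\<dots> = (\<Sum>i\<le>n. a i * M1 i h)"
    unfolding Mfun_def by (subst integral_sum) (auto intro!: integrable_on_mult_right int)
  finally show ?thesis .
qed

lemma M1_integrand:
  "G1 i h \<theta> =
     2 * h * (om (sqrt (2 * h) * cos \<theta>) ^ i * sq (sqrt (2 * h) * cos \<theta>) *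
       ((sin \<theta>)\<^sup>2 / (1 - om (sqrt (2 * h) * cos \<theta>))\<^sup>2))"
  by (simp add: Gfun_def Se_def if_distrib[of "\<lambda>x. x * _"] cong: if_cong)

lemma M1_integrand_bounds:
  assumes h: "0 < h" "h < 1 / 6"
  shows "0 \<le> G1 i h \<theta>" "G1 i h \<theta> \<le> 1"
proof -
  define u where "u = sqrt (2 * h) * cos \<theta>"
  have u: "3 * u\<^sup>2 < 1" using small_radius[OF h] by (simp add: u_def)
  have o: "0 \<le> om u" "om u < 1" using om_nonneg om_less_1[OF u] by auto
  have s: "0 \<le> sq u" "sq u \<le> 1" using sq_ge[of u] sq_le[OF u] by auto
  have "(1 - om u) ^ 3 = 1 - 3 * u\<^sup>2"
    using om_cube[of u] power_minus_odd[of 3 "om u - 1"] by simp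
  moreover have "3 * u\<^sup>2 \<le> (cos \<theta>)\<^sup>2"
    using h mult_right_mono[of "6 * h" 1 "(cos \<theta>)\<^sup>2"] by (simp add: u_def power_mult_distrib)
  ultimately have "(sin \<theta>)\<^sup>2 \<le> (1 - om u) ^ 3" by (simp add: sin_squared_eq)
  also have "\<dots> \<le> (1 - om u)\<^sup>2" using o by (intro power_decreasing) auto
  finally have q: "(sin \<theta>)\<^sup>2 / (1 - om u)\<^sup>2 \<le> 1" using o by (simp add: divide_le_eq)
  show "0 \<le> G1 i h \<theta>"
    unfolding M1_integrand u_def[symmetric] using h o s by simp
  have "om u ^ i * sq u \<le> 1 * 1" using o s by (intro mult_mono power_le_one) auto
  from mult_mono[OF this q] have "om u ^ i * sq u * ((sin \<theta>)\<^sup>2 / (1 - om u)\<^sup>2) \<le> 1" by simp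
  from mult_mono[OF _ this, of "2 * h" 1]
  have "2 * h * (om u ^ i * sq u * ((sin \<theta>)\<^sup>2 / (1 - om u)\<^sup>2)) \<le> 1"
    using h o s by simp
  then show "G1 i h \<theta> \<le> 1"
    unfolding M1_integrand u_def[symmetric] by simp
qed

lemma M1_upper:
  assumes h: "0 < h" "h < 1 / 6"
  shows "0 \<le> M1 i h" "M1 i h \<le> 2 * pi"
proof -
  have int: "G1 i h integrable_on {0..2*pi}"
    by (intro integrable_continuous_real continuous_Gfun assms)
  show "0 \<le> M1 i h" unfolding Mfun_def using M1_integrand_bounds[OF h] by (intro integral_nonneg int) auto
  have "M1 i h \<le> integral {0..2*pi} (\<lambda>\<theta>. 1)"
    unfolding Mfun_def using M1_integrand_bounds[OF h] by (intro integral_le int) auto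
  then show "M1 i h \<le> 2 * pi" by simp
qed

lemma M1_lower:
  obtains c where "c > 0" "\<And>h. 1 / 12 \<le> h \<Longrightarrow> h < 1 / 6 \<Longrightarrow> c \<le> M1 i h"
proof
  define c0 where "c0 = (1 / 6) * ((1 / 12) ^ i * (1 / 2) * ((1 / 4) / 1 :: real))"
  show "c0 * (pi / 12) > 0" by (simp add: c0_def)
  fix h :: real assume h: "1 / 12 \<le> h" "h < 1 / 6"
  then have h': "0 < h" "h < 1 / 6" by auto
  let ?g = "G1 i h"
  have cont: "continuous_on I ?g" for I by (intro continuous_Gfun h')
  \<comment> \<open>on this range $\sin^2\theta \ge 1/4$ and $\omega \ge u^2 \ge 1/12$, so the integrand is not small\<close>
  have lower: "c0 \<le> ?g \<theta>" if t: "\<theta> \<in> {pi / 6..pi / 4}" for \<theta>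
  proof -
    define u where "u = sqrt (2 * h) * cos \<theta>"
    have u: "3 * u\<^sup>2 < 1" using small_radius[OF h'] by (simp add: u_def)
    have o: "0 \<le> om u" "om u < 1" using om_nonneg om_less_1[OF u] by auto
    have "sin (pi / 6) \<le> sin \<theta>" using t by (intro sin_monotone_2pi_le) auto
    then have "1 / 2 \<le> sin \<theta>" by (simp add: sin_30)
    from power_mono[OF this, of 2] have s: "1 / 4 \<le> (sin \<theta>)\<^sup>2" by (simp add: power2_eq_square)
    have "cos (pi / 4) \<le> cos \<theta>" using t by (intro cos_monotone_0_pi_le) auto
    then have "sqrt 2 / 2 \<le> cos \<theta>" by (simp add: cos_45)
    from power_mono[OF this, of 2] have c: "1 / 2 \<le> (cos \<theta>)\<^sup>2" by (simp add: power_divide)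
    have "1 / 12 \<le> u\<^sup>2"
      using h c mult_mono[of "1 / 12" h "1 / 2" "(cos \<theta>)\<^sup>2"] by (simp add: u_def power_mult_distrib)
    also have "\<dots> \<le> om u" using om_V[of u] V_ge_1[OF u] mult_left_mono[of 1 "V u" "u\<^sup>2"] by simp
    finally have ou: "1 / 12 \<le> om u" .
    have q: "(1 / 4) / 1 \<le> (sin \<theta>)\<^sup>2 / (1 - om u)\<^sup>2"
      using s o by (intro frac_le) (auto simp: power_le_one)
    show ?thesis
      unfolding M1_integrand u_def[symmetric] c0_def
      using h ou sq_ge[of u] q o
      by (intro mult_mono power_mono) auto
  qed
  have "c0 * (pi / 12) = integral {pi / 6..pi / 4} (\<lambda>\<theta>. c0)" by simp
  also have "\<dots> \<le> integral {pi / 6..pi / 4} ?g"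
    by (intro integral_le integrable_continuous_real cont lower) auto
  also have "\<dots> \<le> integral {0..2*pi} ?g"
    using M1_integrand_bounds[OF h'] by (intro integral_subset_le integrable_continuous_real cont) auto
  finally show "c0 * (pi / 12) \<le> M1 i h" unfolding Mfun_def .
qed

text \<open>
  A linear functional on a subspace is bounded by the first \<open>k\<close> coordinates if it vanishes
  wherever these coordinates vanish. The subspace and the functional are given together as a linear
  relation \<open>R\<close>. In the induction step, subtracting a multiple of one vector \<open>p\<close> whose
  only nonzero coordinate among those considered is the last one reduces to vectors with vanishing
  last coordinate.
\<close>

lemma linear_relation_bounded:
  fixes R :: "(nat \<Rightarrow> real) \<Rightarrow> real \<Rightarrow> bool"
  assumes lin: "\<And>a l a' l' s. R a l \<Longrightarrow> R a' l' \<Longrightarrow> R (\<lambda>i. a i + s * a' i) (l + s * l')"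
    and zero: "\<And>a l. R a l \<Longrightarrow> (\<And>i. i < k \<Longrightarrow> a i = 0) \<Longrightarrow> l = 0"
  obtains K where "K \<ge> 0" "\<And>a l. R a l \<Longrightarrow> \<bar>l\<bar> \<le> K * (\<Sum>i<k. \<bar>a i\<bar>)"
proof -
  have "\<exists>K\<ge>0. \<forall>a l. R a l \<longrightarrow> \<bar>l\<bar> \<le> K * (\<Sum>i<k. \<bar>a i\<bar>)"
    using assms
  proof (induction k arbitrary: R)
    case 0
    then have "\<bar>l\<bar> \<le> 0 * (\<Sum>i<0. \<bar>a i\<bar>)" if "R a l" for a l using that by fastforce
    then show ?case by blast
  next
    case (Suc k)
    show ?case
    proof (cases "\<forall>a l. R a l \<longrightarrow> (\<forall>i<k. a i = 0) \<longrightarrow> l = 0")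
      case True
      with Suc.IH[of R] Suc.prems(1) obtain K where K: "K \<ge> 0" "\<And>a l. R a l \<Longrightarrow> \<bar>l\<bar> \<le> K * (\<Sum>i<k. \<bar>a i\<bar>)"
        by blast
      have "\<bar>l\<bar> \<le> K * (\<Sum>i<Suc k. \<bar>a i\<bar>)" if "R a l" for a l
        using K(2)[OF that] mult_left_mono[of "\<Sum>i<k. \<bar>a i\<bar>" "\<Sum>i<Suc k. \<bar>a i\<bar>" K] K(1) by simp
      with K(1) show ?thesis by blast
    next
      case False
      then obtain p lp where p: "R p lp" "\<And>i. i < k \<Longrightarrow> p i = 0" "lp \<noteq> 0" by blast
      have pk: "p k \<noteq> 0" using Suc.prems(2)[OF p(1)] p(2,3) less_Suc_eq by metis
      define R' where "R' = (\<lambda>a l. R a l \<and> a k = 0)"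
      have "\<exists>K\<ge>0. \<forall>a l. R' a l \<longrightarrow> \<bar>l\<bar> \<le> K * (\<Sum>i<k. \<bar>a i\<bar>)"
      proof (rule Suc.IH)
        show "R' (\<lambda>i. a i + s * a' i) (l + s * l')" if "R' a l" "R' a' l'" for a l a' l' s
          using that Suc.prems(1) by (simp add: R'_def)
        show "l = 0" if "R' a l" "\<And>i. i < k \<Longrightarrow> a i = 0" for a l
          using that Suc.prems(2)[of a l] by (auto simp: R'_def less_Suc_eq)
      qed
      then obtain K where K: "K \<ge> 0" "\<And>a l. R' a l \<Longrightarrow> \<bar>l\<bar> \<le> K * (\<Sum>i<k. \<bar>a i\<bar>)" by blast
      have "\<bar>l\<bar> \<le> (K + \<bar>lp / p k\<bar>) * (\<Sum>i<Suc k. \<bar>a i\<bar>)" if "R a l" for a l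
      proof -
        have "R' (\<lambda>i. a i + (- a k / p k) * p i) (l + (- a k / p k) * lp)"
          using Suc.prems(1)[OF that p(1), of "- a k / p k"] pk by (simp add: R'_def)
        from K(2)[OF this] have 1: "\<bar>l - a k * (lp / p k)\<bar> \<le> K * (\<Sum>i<k. \<bar>a i\<bar>)"
          using p(2) by simp
        have 2: "\<bar>a k * (lp / p k)\<bar> \<le> \<bar>lp / p k\<bar> * \<bar>a k\<bar>" by (simp add: abs_mult mult.commute)
        have "\<bar>l\<bar> \<le> \<bar>l - a k * (lp / p k)\<bar> + \<bar>a k * (lp / p k)\<bar>"
          using abs_triangle_ineq[of "l - a k * (lp / p k)" "a k * (lp / p k)"] by simp
        also have "\<dots> \<le> (K * (\<Sum>i<k. \<bar>a i\<bar>) + K * \<bar>a k\<bar>) + (\<bar>lp / p k\<bar> * (\<Sum>i<k. \<bar>a i\<bar>) + \<bar>lp / p k\<bar> * \<bar>a k\<bar>)"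
          using K(1) by (intro add_mono order_trans[OF 1] order_trans[OF 2]) (auto intro!: mult_nonneg_nonneg sum_nonneg)
        finally show ?thesis by (simp only: sum.lessThan_Suc distrib_left distrib_right add.assoc)
      qed
      then show ?thesis using K(1) by (intro exI[of _ "K + \<bar>lp / p k\<bar>"]) auto
    qed
  qed
  then show ?thesis using that by blast
qed

text \<open>
  With $\tau = s^6$ the three series of the lips expansion combine to one power series in $s$: the
  terms of $C$, $D$, $E$ have exponents $6j$, $6j+5$, $6j+7$, which are distinct. \<open>lidx k\<close>
  is the exponent that belongs to $\Lambda_k^+$.
\<close>

definition lidx :: "nat \<Rightarrow> nat" where
  "lidx k = (if k = 0 then 0 else k + 4 + 3 * ((k - 1) div 3))"

lemma lidx_simps: "lidx 0 = 0" "lidx (3 * j + 1) = 6 * j + 5" "lidx (3 * j + 2) = 6 * j + 6" "lidx (3 * j + 3) = 6 * j + 7"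
  by (simp_all add: lidx_def)

lemma lips_aexp:
  assumes "lips_coeffs n a L"
  obtains p where "\<And>N. aexp N (\<lambda>s. Mfun n a (1 / 6 - s ^ 6)) p" "\<And>k. p (lidx k) = L k"
proof -
  obtain C D E where exp: "lips_expansion n a C D E" and L0: "L 0 = C 0"
    and L: "\<And>j. L (3*j+1) = D j \<and> L (3*j+2) = C (j+1) \<and> L (3*j+3) = E j"
    using assms unfolding lips_coeffs_def by blast
  obtain \<tau>0 where \<tau>0: "\<tau>0 > 0" "\<forall>\<tau>\<in>{0<..<\<tau>0}. \<exists>c d e.
        (\<lambda>j. C j * \<tau> ^ j) sums c \<and> (\<lambda>j. D j * \<tau> powr (real j + 5/6)) sums d \<and>
        (\<lambda>j. E j * \<tau> powr (real j + 7/6)) sums e \<and> M_plus n a (1/6 - \<tau>) (c + d + e)"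
    using exp unfolding lips_expansion_def by (elim exE conjE)
  define pC where "pC = (\<lambda>k. if k \<in> range (\<lambda>j. 6 * j) then C (k div 6) else 0)"
  define pD where "pD = (\<lambda>k. if k \<in> range (\<lambda>j. 6 * j + 5) then D (k div 6) else 0)"
  define pE where "pE = (\<lambda>k. if k \<in> range (\<lambda>j. 6 * j + 7) then E ((k - 7) div 6) else 0)"
  define p where "p = (\<lambda>k. pC k + pD k + pE k)"
  have sums: "(\<lambda>k. p k * s ^ k) sums Mfun n a (1 / 6 - s ^ 6)" if s: "0 < s" "s < min (root 6 \<tau>0) (root 6 (1 / 6))" for s
  proof -
    have "s ^ 6 < root 6 \<tau>0 ^ 6" "s ^ 6 < root 6 (1 / 6) ^ 6" by (intro power_strict_mono; use s in simp)+
    then have t: "s ^ 6 < \<tau>0" "s ^ 6 < 1 / 6" "0 < s ^ 6" using \<tau>0(1) s by simp_all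
    then obtain c d e where C: "(\<lambda>j. C j * (s ^ 6) ^ j) sums c" and D: "(\<lambda>j. D j * (s ^ 6) powr (real j + 5/6)) sums d"
      and E: "(\<lambda>j. E j * (s ^ 6) powr (real j + 7/6)) sums e" and M: "M_plus n a (1/6 - s ^ 6) (c + d + e)"
      using bspec[OF \<tau>0(2), of "s ^ 6"] by auto
    have pw: "(s ^ 6) powr (real k / 6) = s ^ k" for k
    proof -
      have "(s ^ 6) powr (real k / 6) = (s powr real 6) powr (real k / 6)"
        using powr_realpow[OF s(1), of 6] by simp
      also have "\<dots> = s powr (real 6 * (real k / 6))" by (rule powr_powr)
      also have "\<dots> = s powr real k" by simp
      also have "\<dots> = s ^ k" by (rule powr_realpow[OF s(1)])
      finally show ?thesis .
    qed
    have "(\<lambda>j. pC (6 * j) * s ^ (6 * j)) sums c" using C by (simp add: pC_def power_mult)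
    then have 1: "(\<lambda>k. pC k * s ^ k) sums c"
      by (subst (asm) sums_mono_reindex[of "\<lambda>j. 6 * j" "\<lambda>k. pC k * s ^ k"]) (auto simp: strict_mono_def pC_def)
    have "(s ^ 6) powr (real j + 5/6) = s ^ (6 * j + 5)" for j
      using pw[of "6 * j + 5"] by (simp add: add_divide_distrib)
    with D have "(\<lambda>j. pD (6 * j + 5) * s ^ (6 * j + 5)) sums d" by (simp add: pD_def)
    then have 2: "(\<lambda>k. pD k * s ^ k) sums d"
      by (subst (asm) sums_mono_reindex[of "\<lambda>j. 6 * j + 5" "\<lambda>k. pD k * s ^ k"]) (auto simp: strict_mono_def pD_def)
    have "(s ^ 6) powr (real j + 7/6) = s ^ (6 * j + 7)" for j
      using pw[of "6 * j + 7"] by (simp add: add_divide_distrib)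
    with E have "(\<lambda>j. pE (6 * j + 7) * s ^ (6 * j + 7)) sums e" by (simp add: pE_def)
    then have 3: "(\<lambda>k. pE k * s ^ k) sums e"
      by (subst (asm) sums_mono_reindex[of "\<lambda>j. 6 * j + 7" "\<lambda>k. pE k * s ^ k"]) (auto simp: strict_mono_def pE_def)
    from M obtain x y T where orb: "lips_orbit (1/6 - s ^ 6) x y T"
      and int: "((\<lambda>t. (\<Sum>i\<le>n. a i * x t ^ (2*i)) * y t * y t) has_integral (c + d + e)) {0..T}"
      unfolding M_plus_def by blast
    have "c + d + e = Mfun n a (1/6 - s ^ 6)"
      using has_integral_unique[OF int lips_integral[OF orb]] t by simp
    with sums_add[OF sums_add[OF 1 2] 3] show ?thesis by (simp add: p_def distrib_right)
  qed
  have "aexp N (\<lambda>s. Mfun n a (1 / 6 - s ^ 6)) p" for N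
    by (rule aexp_power_series[of "min (root 6 \<tau>0) (root 6 (1 / 6))"]) (use sums \<tau>0(1) in auto)
  moreover have "p (lidx k) = L k" for k
  proof -
    have rng: "6 * j \<notin> range (\<lambda>j. 6 * j + 5)" "6 * j \<notin> range (\<lambda>j. 6 * j + 7)"
      "6 * j + 5 \<notin> range (\<lambda>j. 6 * j)" "6 * j + 5 \<notin> range (\<lambda>j. 6 * j + 7)"
      "6 * j + 7 \<notin> range (\<lambda>j. 6 * j)" "6 * j + 7 \<notin> range (\<lambda>j. 6 * j + 5)" for j :: nat
      by (auto, presburger+)
    have pC: "p (6 * j) = C j" and pD: "p (6 * j + 5) = D j" and pE: "p (6 * j + 7) = E j" for j
      using rng[of j] by (simp_all add: p_def pC_def pD_def pE_def)
    have "k = 0 \<or> (\<exists>j. k = 3 * j + 1 \<or> k = 3 * j + 2 \<or> k = 3 * j + 3)" by presburger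
    then show ?thesis
    proof (elim disjE exE)
      assume k: "k = 0"
      show ?thesis unfolding k lidx_simps using L0 pC[of 0] by simp
    next
      fix j assume k: "k = 3 * j + 1"
      show ?thesis unfolding k lidx_simps using L[of j] pD[of j] by (elim conjE) (rule trans, assumption, erule sym)
    next
      fix j assume k: "k = 3 * j + 2"
      have "p (6 * j + 6) = C (j + 1)" using pC[of "j + 1"] by (simp add: algebra_simps)
      then show ?thesis unfolding k lidx_simps using L[of j] by (elim conjE) (rule trans, assumption, erule sym)
    next
      fix j assume k: "k = 3 * j + 3"
      show ?thesis unfolding k lidx_simps using L[of j] pE[of j] by (elim conjE) (rule trans, assumption, erule sym)
    qed
  qed
  ultimately show ?thesis using that by blast
qed

lemma lips_coeff_bounded:
  obtains K where "K \<ge> 0" "\<And>a L. lips_coeffs n a L \<Longrightarrow> \<bar>L k\<bar> \<le> K * (\<Sum>i<Suc n. \<bar>a i\<bar>)"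
proof -
  define R where "R = (\<lambda>a l. \<exists>p. (\<forall>N. aexp N (\<lambda>s. Mfun n a (1 / 6 - s ^ 6)) p) \<and> p (lidx k) = l)"
  have ev: "\<forall>\<^sub>F s in at_right 0. 0 < 1 / 6 - s ^ 6 \<and> 1 / 6 - s ^ 6 < (1 / 6 :: real)"
    using eventually_right_0[OF half_gt_zero[OF zero_less_one]]
  proof eventually_elim
    case (elim s)
    then have "s ^ 6 < (1 / 2) ^ 6" by (intro power_strict_mono) auto
    with elim show ?case by (simp add: power_divide)
  qed
  obtain K where K: "K \<ge> 0" "\<And>a l. R a l \<Longrightarrow> \<bar>l\<bar> \<le> K * (\<Sum>i<Suc n. \<bar>a i\<bar>)"
  proof (rule linear_relation_bounded[of R "Suc n"])
    fix a l a' l' and s :: real assume "R a l" "R a' l'"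
    then obtain p p' where p: "\<And>N. aexp N (\<lambda>s. Mfun n a (1 / 6 - s ^ 6)) p" "p (lidx k) = l"
      "\<And>N. aexp N (\<lambda>s. Mfun n a' (1 / 6 - s ^ 6)) p'" "p' (lidx k) = l'" unfolding R_def by blast
    have "aexp N (\<lambda>t. Mfun n (\<lambda>i. a i + s * a' i) (1 / 6 - t ^ 6)) (\<lambda>k. p k + s * p' k)" for N
    proof (rule aexp_cong)
      show "aexp N (\<lambda>t. Mfun n a (1 / 6 - t ^ 6) + s * Mfun n a' (1 / 6 - t ^ 6)) (\<lambda>k. p k + s * p' k)"
        by (intro aexp_add aexp_cmult p)
      show "\<forall>\<^sub>F t in at_right 0. Mfun n a (1 / 6 - t ^ 6) + s * Mfun n a' (1 / 6 - t ^ 6) =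
          Mfun n (\<lambda>i. a i + s * a' i) (1 / 6 - t ^ 6)"
        using ev
      proof eventually_elim
        case (elim t)
        then have h: "0 < 1 / 6 - t ^ 6" "1 / 6 - t ^ 6 < 1 / 6" by auto
        show ?case
          unfolding Mfun_sum[OF h, of n a] Mfun_sum[OF h, of n a'] Mfun_sum[OF h, of n "\<lambda>i. a i + s * a' i"]
          unfolding sum_distrib_left sum.distrib[symmetric] by (intro sum.cong refl) (simp add: algebra_simps)
      qed
    qed
    with p(2,4) show "R (\<lambda>i. a i + s * a' i) (l + s * l')" unfolding R_def by blast
  next
    fix a l assume "R a l" and z: "\<And>i. i < Suc n \<Longrightarrow> a i = 0"
    then obtain p where p: "\<And>N. aexp N (\<lambda>s. Mfun n a (1 / 6 - s ^ 6)) p" "p (lidx k) = l"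
      unfolding R_def by blast
    have "aexp (Suc (lidx k)) (\<lambda>s. 0) p"
    proof (rule aexp_cong[OF p(1)])
      show "\<forall>\<^sub>F s in at_right 0. Mfun n a (1 / 6 - s ^ 6) = 0"
        using ev by eventually_elim (simp add: Mfun_sum[of _ n a] z)
    qed
    from aexp_zero_unique[OF this, of "lidx k"] p(2) show "l = 0" by simp
  qed blast
  have "\<bar>L k\<bar> \<le> K * (\<Sum>i<Suc n. \<bar>a i\<bar>)" if L: "lips_coeffs n a L" for a L
  proof (rule lips_aexp[OF L])
    fix p assume "\<And>N. aexp N (\<lambda>s. Mfun n a (1 / 6 - s ^ 6)) p" "\<And>k. p (lidx k) = L k"
    then show ?thesis by (intro K(2)) (auto simp: R_def)
  qed
  with K(1) show ?thesis using that by blast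
qed

text \<open>
  $\Lambda_0^+$ is the limit of $M^+(h)$ as $h \to 1/6$.
\<close>

lemma lips_L0_lower:
  obtains c where "c > 0" "\<And>a L. lips_coeffs n a L \<Longrightarrow> c * \<bar>a n\<bar> - 2 * pi * (\<Sum>i<n. \<bar>a i\<bar>) \<le> \<bar>L 0\<bar>"
proof -
  obtain c where c: "c > 0" "\<And>h. 1 / 12 \<le> h \<Longrightarrow> h < 1 / 6 \<Longrightarrow> c \<le> M1 n h" by (rule M1_lower) blast
  have "c * \<bar>a n\<bar> - 2 * pi * (\<Sum>i<n. \<bar>a i\<bar>) \<le> \<bar>L 0\<bar>" if L: "lips_coeffs n a L" for a L
  proof -
    let ?A = "c * \<bar>a n\<bar> - 2 * pi * (\<Sum>i<n. \<bar>a i\<bar>)"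
    obtain p where p: "\<And>N. aexp N (\<lambda>s. Mfun n a (1 / 6 - s ^ 6)) p" "\<And>k. p (lidx k) = L k"
      by (rule lips_aexp[OF L]) blast
    have p0: "p 0 = L 0" using p(2)[of 0] by (simp add: lidx_def)
    from p(1)[of 1] obtain M where M: "\<forall>\<^sub>F s in at_right 0. \<bar>Mfun n a (1 / 6 - s ^ 6) - L 0\<bar> \<le> M * s"
      unfolding aexp_def by (auto simp: p0)
    have "\<forall>\<^sub>F s in at_right 0. ?A \<le> \<bar>L 0\<bar> + M * s"
      using M eventually_right_0[OF half_gt_zero[OF zero_less_one]]
    proof eventually_elim
      case (elim s)
      then have "s ^ 6 < (1 / 2) ^ 6" by (intro power_strict_mono) auto
      with elim have h: "1 / 12 \<le> 1 / 6 - s ^ 6" "0 < 1 / 6 - s ^ 6" "1 / 6 - s ^ 6 < 1 / 6"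
        by (auto simp: power_divide)
      define h where "h = 1 / 6 - s ^ 6"
      note h = h[folded h_def]
      have "Mfun n a h = (\<Sum>i<n. a i * M1 i h) + a n * M1 n h"
        unfolding Mfun_sum[OF h(2,3), of n a] lessThan_Suc_atMost[symmetric] by simp
      moreover have "\<bar>\<Sum>i<n. a i * M1 i h\<bar> \<le> 2 * pi * (\<Sum>i<n. \<bar>a i\<bar>)"
      proof -
        have "\<bar>\<Sum>i<n. a i * M1 i h\<bar> \<le> (\<Sum>i<n. \<bar>a i * M1 i h\<bar>)" by (rule sum_abs)
        also have "\<dots> \<le> (\<Sum>i<n. 2 * pi * \<bar>a i\<bar>)"
        proof (rule sum_mono)
          fix i
          have "\<bar>a i * M1 i h\<bar> = \<bar>a i\<bar> * M1 i h" using M1_upper(1)[OF h(2,3)] by (simp add: abs_mult)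
          also have "\<dots> \<le> \<bar>a i\<bar> * (2 * pi)" by (intro mult_left_mono M1_upper(2)[OF h(2,3)]) auto
          finally show "\<bar>a i * M1 i h\<bar> \<le> 2 * pi * \<bar>a i\<bar>" by (simp add: mult_ac)
        qed
        finally show ?thesis by (simp add: sum_distrib_left)
      qed
      moreover have "c * \<bar>a n\<bar> \<le> \<bar>a n * M1 n h\<bar>"
        using mult_left_mono[OF c(2)[OF h(1,3)], of "\<bar>a n\<bar>"] M1_upper(1)[OF h(2,3), of n]
        by (simp add: abs_mult mult_ac)
      ultimately show ?case using elim(1) unfolding h_def[symmetric] by linarith
    qed
    moreover have "((\<lambda>s. \<bar>L 0\<bar> + M * s) \<longlongrightarrow> \<bar>L 0\<bar> + M * 0) (at_right 0)"
      by (intro tendsto_intros)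
    ultimately show ?thesis
      using tendsto_lowerbound[of "\<lambda>s. \<bar>L 0\<bar> + M * s" _ "at_right 0" ?A] by simp
  qed
  with c(1) show ?thesis using that by blast
qed

section \<open>Incompatibility of the two hierarchies\<close>

lemma ratio_chain:
  fixes x :: "nat \<Rightarrow> nat \<Rightarrow> real"
  assumes "\<And>j. j < n \<Longrightarrow> (\<lambda>m. \<bar>x m j\<bar> / \<bar>x m (j + 1)\<bar>) \<longlonglongrightarrow> 0"
    and "\<And>m j. j \<le> n \<Longrightarrow> x m j \<noteq> 0" and "i < n"
  shows "(\<lambda>m. \<bar>x m i\<bar> / \<bar>x m n\<bar>) \<longlonglongrightarrow> 0"
  using assms
proof (induction n)
  case (Suc n)
  have last: "(\<lambda>m. \<bar>x m n\<bar> / \<bar>x m (Suc n)\<bar>) \<longlonglongrightarrow> 0" using Suc.prems(1)[of n] by simp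
  show ?case
  proof (cases "i = n")
    case False
    then have "(\<lambda>m. \<bar>x m i\<bar> / \<bar>x m n\<bar>) \<longlonglongrightarrow> 0" using Suc.prems by (intro Suc.IH) auto
    from tendsto_mult[OF this last] have "(\<lambda>m. \<bar>x m i\<bar> / \<bar>x m n\<bar> * (\<bar>x m n\<bar> / \<bar>x m (Suc n)\<bar>)) \<longlonglongrightarrow> 0" by simp
    moreover have "\<bar>x m i\<bar> / \<bar>x m n\<bar> * (\<bar>x m n\<bar> / \<bar>x m (Suc n)\<bar>) = \<bar>x m i\<bar> / \<bar>x m (Suc n)\<bar>" for m
      using Suc.prems(2)[of n m] by simp
    ultimately show ?thesis by (simp only:)
  qed (use last in simp)
qed simp

text \<open>
  Forward substitution in the triangular system for the selected coefficients.
\<close>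

lemma triangular_inverse_bound:
  fixes \<alpha> C :: "'i \<Rightarrow> nat \<Rightarrow> real"
  assumes k: "\<And>i l m. \<bar>k i l m\<bar> \<le> K i l" "\<And>i m. c i \<le> k i 0 m" "\<And>i. c i > 0"
    and C: "\<And>m j. j \<le> n \<Longrightarrow> C m (2 * j) = (\<Sum>i\<le>j. \<alpha> m i * k i (2 * j - 2 * i) m)"
    and j: "j \<le> n"
  shows "\<exists>B\<ge>0. \<forall>m. \<bar>\<alpha> m j\<bar> \<le> B * (\<Sum>i\<le>j. \<bar>C m (2 * i)\<bar>)"
  using j
proof (induction j rule: less_induct)
  case (less j)
  then have "\<forall>i. \<exists>B. i < j \<longrightarrow> B \<ge> 0 \<and> (\<forall>m. \<bar>\<alpha> m i\<bar> \<le> B * (\<Sum>i\<le>i. \<bar>C m (2 * i)\<bar>))" by fastforce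
  then obtain B where B: "\<And>i. i < j \<Longrightarrow> B i \<ge> 0" "\<And>i m. i < j \<Longrightarrow> \<bar>\<alpha> m i\<bar> \<le> B i * (\<Sum>i\<le>i. \<bar>C m (2 * i)\<bar>)"
    by metis
  have K: "K i l \<ge> 0" for i l using k(1)[of i l] abs_ge_zero order_trans by blast
  define D where "D = (1 + (\<Sum>i<j. B i * K i (2 * j - 2 * i))) / c j"
  have D: "D \<ge> 0" unfolding D_def using B(1) K k(3)[of j] by (intro divide_nonneg_nonneg add_nonneg_nonneg sum_nonneg mult_nonneg_nonneg) (auto simp: less_imp_le)
  have Dc: "D * c j = 1 + (\<Sum>i<j. B i * K i (2 * j - 2 * i))"
    using k(3)[of j] by (simp add: D_def)
  have "\<bar>\<alpha> m j\<bar> \<le> D * (\<Sum>i\<le>j. \<bar>C m (2 * i)\<bar>)" for m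
  proof -
    let ?S = "\<Sum>i\<le>j. \<bar>C m (2 * i)\<bar>"
    have "C m (2 * j) = (\<Sum>i<j. \<alpha> m i * k i (2 * j - 2 * i) m) + \<alpha> m j * k j 0 m"
      using C[OF less.prems, of m] unfolding lessThan_Suc_atMost[symmetric] by simp
    then have "\<alpha> m j * k j 0 m = C m (2 * j) + - (\<Sum>i<j. \<alpha> m i * k i (2 * j - 2 * i) m)" by simp
    then have "\<bar>\<alpha> m j * k j 0 m\<bar> \<le> \<bar>C m (2 * j)\<bar> + \<bar>\<Sum>i<j. \<alpha> m i * k i (2 * j - 2 * i) m\<bar>"
      using abs_triangle_ineq[of "C m (2 * j)" "- (\<Sum>i<j. \<alpha> m i * k i (2 * j - 2 * i) m)"] by simp
    also have "\<dots> \<le> 1 * ?S + (\<Sum>i<j. B i * K i (2 * j - 2 * i)) * ?S"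
    proof (rule add_mono)
      show "\<bar>C m (2 * j)\<bar> \<le> 1 * ?S" using member_le_sum[of j "{..j}" "\<lambda>i. \<bar>C m (2 * i)\<bar>"] by simp
      have "\<bar>\<Sum>i<j. \<alpha> m i * k i (2 * j - 2 * i) m\<bar> \<le> (\<Sum>i<j. \<bar>\<alpha> m i * k i (2 * j - 2 * i) m\<bar>)" by (rule sum_abs)
      also have "\<dots> \<le> (\<Sum>i<j. B i * K i (2 * j - 2 * i) * ?S)"
      proof (rule sum_mono)
        fix i assume i: "i \<in> {..<j}"
        have "\<bar>\<alpha> m i\<bar> \<le> B i * (\<Sum>i\<le>i. \<bar>C m (2 * i)\<bar>)" using B(2) i by simp
        also have "\<dots> \<le> B i * ?S" using i B(1) by (intro mult_left_mono sum_mono2) auto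
        finally have "\<bar>\<alpha> m i\<bar> * \<bar>k i (2 * j - 2 * i) m\<bar> \<le> B i * ?S * K i (2 * j - 2 * i)"
          using k(1) by (intro mult_mono') auto
        then show "\<bar>\<alpha> m i * k i (2 * j - 2 * i) m\<bar> \<le> B i * K i (2 * j - 2 * i) * ?S"
          by (simp only: abs_mult mult_ac)
      qed
      finally show "\<bar>\<Sum>i<j. \<alpha> m i * k i (2 * j - 2 * i) m\<bar> \<le> (\<Sum>i<j. B i * K i (2 * j - 2 * i)) * ?S"
        by (simp only: sum_distrib_right)
    qed
    also have "1 * ?S + (\<Sum>i<j. B i * K i (2 * j - 2 * i)) * ?S = (D * c j) * ?S"
      unfolding Dc by (simp only: distrib_right)
    finally have "\<bar>\<alpha> m j\<bar> * \<bar>k j 0 m\<bar> \<le> (D * ?S) * c j"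
      by (simp only: abs_mult mult_ac)
    moreover have "\<bar>\<alpha> m j\<bar> * c j \<le> \<bar>\<alpha> m j\<bar> * \<bar>k j 0 m\<bar>"
      using k(2)[of j m] by (intro mult_left_mono) auto
    ultimately have "\<bar>\<alpha> m j\<bar> * c j \<le> (D * ?S) * c j" by linarith
    then show ?thesis using k(3)[of j] by simp
  qed
  with D show ?case by blast
qed

text \<open>
  Along the hierarchy at the origin all components of \<open>a\<close> except the last one tend to zero.
  It suffices that \<open>delta\<close> is bounded, since the uniform bounds on the entries of the
  triangular system need no smallness of the $b_i$.
\<close>

lemma origin_hierarchy_limit:
  fixes a b C :: "nat \<Rightarrow> nat \<Rightarrow> real" and \<epsilon>a \<epsilon>b :: "nat \<Rightarrow> real"
  assumes n: "n \<ge> 1"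
    and norm: "\<And>m. L2_set (a m) {..n} = 1"
    and delta: "Bseq (\<lambda>m. delta n (a m) (b m) (\<epsilon>a m) (\<epsilon>b m))"
    and \<epsilon>: "\<And>m. 0 < \<epsilon>a m" "\<epsilon>a \<longlonglongrightarrow> 0"
    and org: "in_C_org n a b \<epsilon>a \<epsilon>b C" and i: "i < n"
  shows "(\<lambda>m. a m i) \<longlonglongrightarrow> 0"
proof -
  have a1: "\<bar>a m i\<bar> \<le> 1" if "i \<le> n" for m i
  proof -
    have "(a m i)\<^sup>2 \<le> (\<Sum>i\<le>n. (a m i)\<^sup>2)" using that by (intro member_le_sum) auto
    also have "\<dots> = (L2_set (a m) {..n})\<^sup>2" by (simp add: L2_set_def sum_nonneg)
    finally show ?thesis using norm[of m] abs_le_square_iff[of "a m i" 1] by simp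
  qed
  have "\<forall>\<^sub>F m in sequentially. \<epsilon>a m < 1 / 2" using \<epsilon>(2) by (rule order_tendstoD) simp
  then obtain m0 where m0: "\<And>m. \<epsilon>a (m + m0) \<le> 1 / 2"
    unfolding eventually_sequentially by (metis le_add2 less_imp_le)
  from delta obtain B where B: "\<And>m. \<bar>delta n (a m) (b m) (\<epsilon>a m) (\<epsilon>b m)\<bar> \<le> B" unfolding Bseq_def by auto
  have d: "\<bar>\<epsilon>a m * a m i\<bar> \<le> B" "\<bar>\<epsilon>b m * b m i\<bar> \<le> B" if "i \<le> n" for m i
  proof -
    have "max \<bar>\<epsilon>a m * a m i\<bar> \<bar>\<epsilon>b m * b m i\<bar> \<le> delta n (a m) (b m) (\<epsilon>a m) (\<epsilon>b m)"
      unfolding delta_def using that by (intro Max_ge) auto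
    then show "\<bar>\<epsilon>a m * a m i\<bar> \<le> B" "\<bar>\<epsilon>b m * b m i\<bar> \<le> B" using B[of m] by linarith+
  qed
  \<comment> \<open>the sequence is shifted so that $\varepsilon_a |a_0| \le 1/2$ throughout\<close>
  define C' where "C' = (\<lambda>m. C (m + m0))"
  define \<alpha> where "\<alpha> = (\<lambda>m i. \<epsilon>a (m + m0) * a (m + m0) i)"
  obtain k :: "nat \<Rightarrow> nat \<Rightarrow> nat \<Rightarrow> real" and K c where k: "\<And>i l m. \<bar>k i l m\<bar> \<le> K i l" "\<And>i m. c i \<le> k i 0 m" "\<And>i. c i > 0"
    "\<And>m j. j \<le> n \<Longrightarrow> C' m (2 * j) = (\<Sum>i\<le>j. \<alpha> m i * k i (2 * j - 2 * i) m)"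
  proof (rule origin_coeff_structure[of n "\<lambda>m. a (m + m0)" "\<lambda>m. b (m + m0)" "\<lambda>m. \<epsilon>a (m + m0)" "\<lambda>m. \<epsilon>b (m + m0)" C' B])
    show "origin_coeffs n (a (m + m0)) (b (m + m0)) (\<epsilon>a (m + m0)) (\<epsilon>b (m + m0)) (C' m)" for m
      using org by (simp add: in_C_org_def C'_def)
    show "\<bar>\<epsilon>a (m + m0) * a (m + m0) 0\<bar> \<le> 1 / 2" for m
      using mult_mono[OF m0[of m] a1[of 0 "m + m0"]] \<epsilon>(1)[of "m + m0"] by (simp add: abs_mult)
    show "\<bar>\<epsilon>a (m + m0) * a (m + m0) i\<bar> \<le> B" "\<bar>\<epsilon>b (m + m0) * b (m + m0) i\<bar> \<le> B" if "i \<le> n" for m i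
      using d[OF that] by auto
  qed (unfold \<alpha>_def, blast)
  obtain D where D: "D \<ge> 0" "\<And>m. \<bar>\<alpha> m i\<bar> \<le> D * (\<Sum>l\<le>i. \<bar>C' m (2 * l)\<bar>)"
    using triangular_inverse_bound[of k K c n C' \<alpha> i, OF k] i by auto
  define E where "E = (\<Sum>l\<le>n. K l (2 * n - 2 * l))"
  have E: "\<bar>C' m (2 * n)\<bar> \<le> \<epsilon>a (m + m0) * E" for m
  proof -
    have "\<bar>C' m (2 * n)\<bar> \<le> (\<Sum>l\<le>n. \<bar>\<alpha> m l * k l (2 * n - 2 * l) m\<bar>)"
      unfolding k(4)[OF order_refl] by (rule sum_abs)
    also have "\<dots> \<le> (\<Sum>l\<le>n. \<epsilon>a (m + m0) * K l (2 * n - 2 * l))"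
    proof (rule sum_mono)
      fix l assume l: "l \<in> {..n}"
      have "\<bar>\<alpha> m l\<bar> \<le> \<epsilon>a (m + m0) * 1"
        using \<epsilon>(1)[of "m + m0"] a1[of l "m + m0"] l by (simp add: \<alpha>_def abs_mult)
      then show "\<bar>\<alpha> m l * k l (2 * n - 2 * l) m\<bar> \<le> \<epsilon>a (m + m0) * K l (2 * n - 2 * l)"
        unfolding abs_mult using k(1) by (intro mult_mono') auto
    qed
    finally show ?thesis by (simp add: E_def sum_distrib_left)
  qed
  have nz: "C m (2 * j) \<noteq> 0" if "j \<le> n" for m j
  proof -
    have s: "0 < \<bar>C m 0\<bar>" "C m 0 * C m 2 > 0" "\<And>j. j \<in> {1..n-1} \<Longrightarrow> C m (2*j) * C m (2*j+2) < 0"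
      using org unfolding in_C_org_def by blast+
    consider "j = 0" | "j = 1" | "j \<ge> 2" by linarith
    then show ?thesis
    proof cases
      case 3
      then have "j - 1 \<in> {1..n - 1}" and "2 * (j - 1) + 2 = 2 * j" using that by auto
      with s(3)[of "j - 1"] show ?thesis by auto
    qed (use s in auto)
  qed
  have ratio: "(\<lambda>m. \<bar>C m (2 * l)\<bar> / \<bar>C m (2 * n)\<bar>) \<longlonglongrightarrow> 0" if "l < n" for l
    by (rule ratio_chain[of n "\<lambda>m j. C m (2 * j)"])
      (use org nz that in \<open>auto simp: in_C_org_def much_less_def\<close>)
  have bound: "\<bar>a (m + m0) i\<bar> \<le> D * E * (\<Sum>l\<le>i. \<bar>C' m (2 * l)\<bar> / \<bar>C' m (2 * n)\<bar>)" for m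
  proof -
    have e: "\<epsilon>a (m + m0) > 0" by (rule \<epsilon>)
    have Cn: "\<bar>C' m (2 * n)\<bar> > 0" using nz by (simp add: C'_def)
    have S: "(\<Sum>l\<le>i. \<bar>C' m (2 * l)\<bar>) = (\<Sum>l\<le>i. \<bar>C' m (2 * l)\<bar> / \<bar>C' m (2 * n)\<bar>) * \<bar>C' m (2 * n)\<bar>"
      using Cn by (simp add: sum_distrib_right)
    have "\<epsilon>a (m + m0) * \<bar>a (m + m0) i\<bar> = \<bar>\<alpha> m i\<bar>" using e by (simp add: \<alpha>_def abs_mult)
    also have "\<dots> \<le> D * ((\<Sum>l\<le>i. \<bar>C' m (2 * l)\<bar> / \<bar>C' m (2 * n)\<bar>) * \<bar>C' m (2 * n)\<bar>)"
      using D(2)[of m] unfolding S .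
    also have "\<dots> \<le> D * ((\<Sum>l\<le>i. \<bar>C' m (2 * l)\<bar> / \<bar>C' m (2 * n)\<bar>) * (\<epsilon>a (m + m0) * E))"
      by (intro mult_left_mono E D sum_nonneg) auto
    finally have "\<epsilon>a (m + m0) * \<bar>a (m + m0) i\<bar> \<le> \<epsilon>a (m + m0) * (D * E * (\<Sum>l\<le>i. \<bar>C' m (2 * l)\<bar> / \<bar>C' m (2 * n)\<bar>))"
      by (simp add: mult_ac)
    then show ?thesis using e by simp
  qed
  have "(\<lambda>m. D * E * (\<Sum>l\<le>i. \<bar>C' m (2 * l)\<bar> / \<bar>C' m (2 * n)\<bar>)) \<longlonglongrightarrow> D * E * (\<Sum>l\<le>i. 0)"
  proof (intro tendsto_mult tendsto_const tendsto_sum)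
    fix l assume "l \<in> {..i}"
    then show "(\<lambda>m. \<bar>C' m (2 * l)\<bar> / \<bar>C' m (2 * n)\<bar>) \<longlonglongrightarrow> 0"
      using LIMSEQ_ignore_initial_segment[OF ratio[of l], of m0] i by (simp add: C'_def)
  qed
  then have "(\<lambda>m. D * E * (\<Sum>l\<le>i. \<bar>C' m (2 * l)\<bar> / \<bar>C' m (2 * n)\<bar>)) \<longlonglongrightarrow> 0" by simp
  then have "(\<lambda>m. a (m + m0) i) \<longlonglongrightarrow> 0"
    by (rule Lim_null_comparison[OF always_eventually, rotated]) (use bound in simp)
  then show ?thesis by (rule LIMSEQ_offset)
qed

theorem proposition2:
  fixes n :: nat
  assumes "n \<ge> 2"
  shows "\<not> (\<exists>(a :: nat \<Rightarrow> nat \<Rightarrow> real) (b :: nat \<Rightarrow> nat \<Rightarrow> real)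
              (\<epsilon>a :: nat \<Rightarrow> real) (\<epsilon>b :: nat \<Rightarrow> real)
              (L :: nat \<Rightarrow> nat \<Rightarrow> real) (C :: nat \<Rightarrow> nat \<Rightarrow> real).
            (\<forall>m. L2_set (a m) {..n} = 1) \<and>
            (\<forall>m. a m n \<noteq> 0) \<and>
            Bseq (\<lambda>m. delta n (a m) (b m) (\<epsilon>a m) (\<epsilon>b m)) \<and>
            in_P3 n a \<epsilon>a \<epsilon>b L \<and>
            in_C_org n a b \<epsilon>a \<epsilon>b C)"
proof (intro notI, elim exE conjE)
  fix a b L C :: "nat \<Rightarrow> nat \<Rightarrow> real" and \<epsilon>a \<epsilon>b :: "nat \<Rightarrow> real"
  assume norm: "\<forall>m. L2_set (a m) {..n} = 1"
    and delta: "Bseq (\<lambda>m. delta n (a m) (b m) (\<epsilon>a m) (\<epsilon>b m))"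
    and P3: "in_P3 n a \<epsilon>a \<epsilon>b L" and org: "in_C_org n a b \<epsilon>a \<epsilon>b C"
  have \<epsilon>: "\<And>m. 0 < \<epsilon>a m" "\<And>m. 0 < \<epsilon>b m" "\<epsilon>a \<lless> \<epsilon>b" "\<epsilon>b \<lless> (\<lambda>m. 1)"
    and lips: "\<And>m. lips_coeffs n (a m) (L m)"
    and Lsign: "\<And>m j. j < n \<Longrightarrow> L m j * L m (j+1) < 0"
    and Lll: "\<And>j. j < n \<Longrightarrow> (\<lambda>m. \<bar>L m j\<bar>) \<lless> (\<lambda>m. \<bar>L m (j+1)\<bar>)"
    using P3 unfolding in_P3_def by blast+
  have "(\<lambda>m. \<epsilon>a m / \<epsilon>b m * (\<epsilon>b m / 1)) \<longlonglongrightarrow> 0 * 0"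
    using \<epsilon>(3,4) unfolding much_less_def by (intro tendsto_mult)
  moreover have "\<epsilon>a m / \<epsilon>b m * (\<epsilon>b m / 1) = \<epsilon>a m" for m using \<epsilon>(2)[of m] by simp
  ultimately have \<epsilon>0: "\<epsilon>a \<longlonglongrightarrow> 0" by simp
  have a0: "(\<lambda>m. a m i) \<longlonglongrightarrow> 0" if "i < n" for i
    using origin_hierarchy_limit[of n a b \<epsilon>a \<epsilon>b C i] assms norm delta \<epsilon>(1) \<epsilon>0 org that by simp
  have n1: "(\<lambda>m. \<bar>a m n\<bar>) \<longlonglongrightarrow> 1"
  proof -
    have "\<bar>a m n\<bar> = sqrt (1 - (\<Sum>i<n. (a m i)\<^sup>2))" for m
    proof -
      have "(\<Sum>i<n. (a m i)\<^sup>2) + (a m n)\<^sup>2 = (L2_set (a m) {..n})\<^sup>2"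
        by (simp add: L2_set_def sum_nonneg lessThan_Suc_atMost[symmetric])
      then have "(a m n)\<^sup>2 = 1 - (\<Sum>i<n. (a m i)\<^sup>2)" using norm by simp
      from arg_cong[OF this, of sqrt] show ?thesis by simp
    qed
    moreover have "(\<lambda>m. sqrt (1 - (\<Sum>i<n. (a m i)\<^sup>2))) \<longlonglongrightarrow> sqrt (1 - (\<Sum>i<n. 0\<^sup>2))"
      by (intro tendsto_intros a0) auto
    ultimately show ?thesis by simp
  qed
  obtain c where c: "c > 0" "\<And>m. c * \<bar>a m n\<bar> - 2 * pi * (\<Sum>i<n. \<bar>a m i\<bar>) \<le> \<bar>L m 0\<bar>"
    by (rule lips_L0_lower[of n]) (use lips in blast)
  obtain K where K: "K \<ge> 0" "\<And>m. \<bar>L m n\<bar> \<le> K * (\<Sum>i<Suc n. \<bar>a m i\<bar>)"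
    by (rule lips_coeff_bounded[of n n]) (use lips in blast)
  have nz: "L m j \<noteq> 0" if "j \<le> n" for m j
    using Lsign[of j m] Lsign[of "j - 1" m] that assms by (cases "j < n"; cases j) auto
  have "(\<lambda>m. \<bar>L m 0\<bar> / \<bar>L m n\<bar>) \<longlonglongrightarrow> 0"
    by (rule ratio_chain) (use Lll nz assms in \<open>auto simp: much_less_def\<close>)
  moreover have "(\<lambda>m. K * (\<Sum>i<Suc n. \<bar>a m i\<bar>)) \<longlonglongrightarrow> K * ((\<Sum>i<n. \<bar>0\<bar>) + 1)"
    unfolding sum.lessThan_Suc by (intro tendsto_intros a0 n1) auto
  ultimately have "(\<lambda>m. \<bar>L m 0\<bar> / \<bar>L m n\<bar> * (K * (\<Sum>i<Suc n. \<bar>a m i\<bar>))) \<longlonglongrightarrow> 0 * (K * ((\<Sum>i<n. \<bar>0\<bar>) + 1))"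
    by (rule tendsto_mult)
  then have upper: "(\<lambda>m. \<bar>L m 0\<bar> / \<bar>L m n\<bar> * (K * (\<Sum>i<Suc n. \<bar>a m i\<bar>))) \<longlonglongrightarrow> 0" by simp
  have "(\<lambda>m. c * \<bar>a m n\<bar> - 2 * pi * (\<Sum>i<n. \<bar>a m i\<bar>)) \<longlonglongrightarrow> c * 1 - 2 * pi * (\<Sum>i<n. \<bar>0\<bar>)"
    by (intro tendsto_intros a0 n1) auto
  then have lower: "(\<lambda>m. c * \<bar>a m n\<bar> - 2 * pi * (\<Sum>i<n. \<bar>a m i\<bar>)) \<longlonglongrightarrow> c" by simp
  have "c \<le> 0"
  proof (rule tendsto_le[OF sequentially_bot upper lower], rule always_eventually, rule allI)
    fix m
    have "\<bar>L m 0\<bar> = \<bar>L m 0\<bar> / \<bar>L m n\<bar> * \<bar>L m n\<bar>" using nz[of n m] by simp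
    also have "\<dots> \<le> \<bar>L m 0\<bar> / \<bar>L m n\<bar> * (K * (\<Sum>i<Suc n. \<bar>a m i\<bar>))"
      by (rule mult_left_mono[OF K(2)]) simp
    finally show "c * \<bar>a m n\<bar> - 2 * pi * (\<Sum>i<n. \<bar>a m i\<bar>) \<le>
        \<bar>L m 0\<bar> / \<bar>L m n\<bar> * (K * (\<Sum>i<Suc n. \<bar>a m i\<bar>))"
      using c(2)[of m] by linarith
  qed
  with c(1) show False by simp
qed

end
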